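(* There exist constants $C_n>0$ ($n\ge 1$) with $\sup_n C_n<\infty$ and $C_n\to \frac{2\pi}{\sqrt{e}}$ as $n\to\infty$ such that for every $N> n$ and every closed $n$-dimensional submanifold $M^n\subset\mathbb{R}^N$, $$W^{l^\infty}_{n-1}(M^n)\leq C_n\,\sqrt{n}\,\mathrm{vol}(M^n)^{\frac{1}{n}}.$$ In particular $W^{l^\infty}_{n-1}(M^n)\leq C\sqrt{n}\,\mathrm{vol}(M^n)^{1/n}$ for an absolute constant $C$ independent of $n$ and $N$.
   Context: For $x\in\mathbb{R}^N$, $\Vert x\Vert_{l^\infty}=\max_i |x_i|$. For a closed manifold $M^n\subset\mathbb{R}^N$, its $l^\infty$-width $W^{l^\infty}_{n-1}(M^n)$ is the infimum, over all $(n-1)$-dimensional polyhedra $K^{n-1}\subset\mathbb{R}^N$ and all continuous maps $\phi:M^n\to K^{n-1}$, of $\sup_{x\in M^n}\Vert x-\phi(x)\Vert_{l^\infty}$. Here $\mathrm{vol}(M^n)$ is the $n$-dimensional volume of $M^n$ induced by the Euclidean metric of $\mathbb{R}^N$. *)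

theory Defs
  imports "HOL-Analysis.Analysis"
begin

text \<open>Ambient model: the points of R^k are the finitely supported elements of
  l^infinity(N), realised as bounded continuous functions nat => real whose
  coordinates vanish from index k on.  The norm of this Banach space is the
  sup-norm, i.e. exactly the l^infinity norm max_i |x_i| on R^k.\<close>

type_synonym pt = "nat \<Rightarrow>\<^sub>C real"

definition Rsp :: "nat \<Rightarrow> pt set" where
  "Rsp k = {x. \<forall>i\<ge>k. apply_bcontfun x i = 0}"

definition eucl_norm :: "nat \<Rightarrow> pt \<Rightarrow> real" where
  "eucl_norm N x = sqrt (\<Sum>i<N. (apply_bcontfun x i)\<^sup>2)"

text \<open>Smoothness (C-infinity) on a relatively open subset W of a linear subspace V:
  all iterated directional derivatives in directions from V exist and are continuous.\<close>
fun smooth_dirs :: "pt set \<Rightarrow> (pt \<Rightarrow> pt) \<Rightarrow> pt list \<Rightarrow> bool" where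
  "smooth_dirs W f [] = continuous_on W f"
| "smooth_dirs W f (v # vs) =
     (\<exists>g. (\<forall>x\<in>W. ((\<lambda>t. f (x + t *\<^sub>R v)) has_vector_derivative g x) (at 0))
          \<and> smooth_dirs W g vs)"

definition smooth_on_sub :: "pt set \<Rightarrow> pt set \<Rightarrow> (pt \<Rightarrow> pt) \<Rightarrow> bool" where
  "smooth_on_sub V W f \<longleftrightarrow> (\<forall>vs. set vs \<subseteq> V \<longrightarrow> smooth_dirs W f vs)"

definition closed_submanifold :: "nat \<Rightarrow> nat \<Rightarrow> pt set \<Rightarrow> bool" where
  "closed_submanifold n N M \<longleftrightarrow>
     M \<subseteq> Rsp N \<and> compact M \<and> M \<noteq> {} \<and>
     (\<forall>p\<in>M. \<exists>U W \<phi> \<psi>. open U \<and> p \<in> U \<and> openin (top_of_set (Rsp n)) W \<and>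
        \<phi> ` W \<subseteq> Rsp N \<and>
        smooth_on_sub (Rsp n) W \<phi> \<and>
        homeomorphism W (M \<inter> U) \<phi> \<psi> \<and>
        (\<forall>w\<in>W. \<exists>D. (\<phi> has_derivative D) (at w within Rsp n) \<and> inj_on D (Rsp n)))"

definition polyhedron_dim :: "nat \<Rightarrow> nat \<Rightarrow> pt set \<Rightarrow> bool" where
  "polyhedron_dim d N K \<longleftrightarrow>
     (\<exists>\<S>. finite \<S> \<and> K = (\<Union>S\<in>\<S>. convex hull S) \<and>
        (\<forall>S\<in>\<S>. finite S \<and> S \<noteq> {} \<and> S \<subseteq> Rsp N \<and> \<not> affine_dependent S \<and> card S \<le> d + 1))"

definition linf_width :: "nat \<Rightarrow> nat \<Rightarrow> pt set \<Rightarrow> real" where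
  "linf_width n N M = Inf {e. \<exists>K \<phi>. polyhedron_dim (n - 1) N K \<and> continuous_on M \<phi> \<and>
        \<phi> ` M \<subseteq> K \<and> e = (SUP x\<in>M. norm (x - \<phi> x))}"

text \<open>n-dimensional Hausdorff measure w.r.t. the Euclidean metric of R^N, normalised
  (factor unit_ball_vol n) so that it agrees with the induced Riemannian volume.\<close>
definition eucl_diam :: "nat \<Rightarrow> pt set \<Rightarrow> ennreal" where
  "eucl_diam N C = (SUP x\<in>C. SUP y\<in>C. ennreal (eucl_norm N (x - y)))"

definition hausdorff_pre :: "nat \<Rightarrow> nat \<Rightarrow> real \<Rightarrow> pt set \<Rightarrow> ennreal" where
  "hausdorff_pre n N \<delta> A =
     (INF C\<in>{C :: nat \<Rightarrow> pt set. A \<subseteq> \<Union>(range C) \<and> (\<forall>i. C i \<subseteq> Rsp N \<and> eucl_diam N (C i) < ennreal \<delta>)}.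
        (\<Sum>i. ennreal (unit_ball_vol (real n)) * (eucl_diam N (C i) / 2) ^ n))"

definition hausdorff :: "nat \<Rightarrow> nat \<Rightarrow> pt set \<Rightarrow> ennreal" where
  "hausdorff n N A = (SUP \<delta>\<in>{0<..}. hausdorff_pre n N \<delta> A)"

definition vol :: "nat \<Rightarrow> nat \<Rightarrow> pt set \<Rightarrow> real" where
  "vol n N M = enn2real (hausdorff n N M)"

end

theory Submission
  imports Defs "HOL-Probability.Probability" "HOL-Real_Asymp.Real_Asymp"
begin

text \<open>
  Put \<open>\<omega> = \<pi> / L\<close>.  The squares \<open>f\<^sub>z\<close> of the \<open>2\<^sup>N\<close> functions
  \<open>g\<^sub>z x = \<Prod>i<N. (cos or sin) (\<omega> x\<^sub>i)\<close> form a partition of unity; the set where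
  \<open>f\<^sub>z > 0\<close> is a disjoint union of open cubes of side \<open>L\<close>.  Moreover
  \<open>(\<Sum>z. (\<partial>\<^sub>u g\<^sub>z)\<^sup>2) = \<omega>\<^sup>2 |u|\<^sup>2\<close>, independently of \<open>N\<close>.
  For each of \<open>n\<close> colours draw independent pairs \<open>(z, h)\<close> with \<open>h\<close> uniform in the unit
  interval, and let a point belong to the first pair of the colour with \<open>f\<^sub>z x > h\<close> (as in the
  construction of spherical cubes of Kindler, O'Donnell, Rao and Wigderson).  The expected
  number of points of \<open>M\<close> that lie on a cell boundary for every colour is at most
  \<open>(2 \<omega>)\<^sup>n (n!)\<^sup>1\<^sup>/\<^sup>2 vol M\<close>: a tangent \<open>n\<close>-ball is mapped by
  \<open>(f\<^sub>z\<^sub>1, ..., f\<^sub>z\<^sub>n)\<close> to an ellipsoid, and Cauchy-Schwarz applied to one row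
  after the other bounds the sum of the determinants by \<open>(2 \<omega>)\<^sup>n (n!)\<^sup>1\<^sup>/\<^sup>2\<close>.
  If no such point exists, then \<open>M\<close> is covered by the open cells with multiplicity at most
  \<open>n\<close>, and the nerve map that sends a cell to the centre of its cube moves every point by at
  most \<open>L / 2\<close>.  A covering set of diameter \<open>d\<close> is replaced by a tangent ball of radius
  \<open>d\<close>, which costs a factor \<open>2\<^sup>n\<close> but avoids the isodiametric inequality; the
  factor \<open>1 / 2\<close> in \<open>L / 2\<close> makes up for it.
\<close>

section \<open>Linear images of balls\<close>

text \<open>Drawing \<open>z\<close> among \<open>2\<^sup>N\<close> functions seems to bring
  \<open>N\<close> back. It does not: because the squares sum to 1, a draw captures a given point
  with probability \<open>1 / 2\<^sup>N\<close>, so the mean waiting time is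
  \<open>2\<^sup>N\<close>, and this cancels the weight of the choice, once for each colour. Squares
  are used because the gradient of \<open>g\<^sub>z\<^sup>2\<close> carries the weight
  \<open>g\<^sub>z\<close>; the weights have square sum 1, so Cauchy-Schwarz needs only the square
  sum of the gradients. No area formula is used: the expectation is replaced by a union bound over a
  fine Hausdorff cover, and one event has to dominate all points of a covering set. This forces
  thickened ellipsoids, a slack \<theta> in the failure events and two-point derivative estimates.
  The expected count is below 1 once L / 2 exceeds 2 pi (n!)^(1/(2n)) vol^(1/n), and (n!)^(1/n) ~ n
  / e gives the constant 2 pi / sqrt e.\<close>

definition dot :: "nat \<Rightarrow> (nat \<Rightarrow> real) \<Rightarrow> (nat \<Rightarrow> real) \<Rightarrow> real" where
  "dot k x y = (\<Sum>i<k. x i * y i)"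

text \<open>The Householder reflection along \<open>v\<close>; if \<open>dot k v v = 0\<close>, division by zero makes it the identity.\<close>

definition refl_along :: "nat \<Rightarrow> (nat \<Rightarrow> real) \<Rightarrow> (nat \<Rightarrow> real) \<Rightarrow> nat \<Rightarrow> real" where
  "refl_along k v x = (\<lambda>i. x i - 2 * dot k v x / dot k v v * v i)"

lemma dot_commute: "dot k x y = dot k y x"
  by (simp add: dot_def mult.commute)

lemma dot_nonneg [simp]: "dot k x x \<ge> 0"
  by (auto simp: dot_def intro!: sum_nonneg)

lemma dot_diff_right: "dot k x (\<lambda>i. y i - c * z i) = dot k x y - c * dot k x z"
  by (simp add: dot_def algebra_simps sum_subtractf sum_distrib_left)

lemma dot_diff_left: "dot k (\<lambda>i. y i - c * z i) x = dot k y x - c * dot k z x"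
  by (simp add: dot_def algebra_simps sum_subtractf sum_distrib_left)

lemma dot_scale_left: "dot k (\<lambda>i. c * y i) x = c * dot k y x"
  by (simp add: dot_def algebra_simps sum_distrib_left)

lemma dot_cong: "(\<And>i. i < k \<Longrightarrow> x i = x' i) \<Longrightarrow> (\<And>i. i < k \<Longrightarrow> y i = y' i) \<Longrightarrow> dot k x y = dot k x' y'"
  by (simp add: dot_def)

lemma dot_Suc: "dot (Suc k) x y = dot k x y + x k * y k"
  by (simp add: dot_def)

lemma dot_self_eq_0: "dot k x x = 0 \<Longrightarrow> i < k \<Longrightarrow> x i = 0"
  by (auto simp: dot_def sum_nonneg_eq_0_iff)

lemma refl_along_adjoint: "dot k (refl_along k v x) y = dot k x (refl_along k v y)"
  by (simp add: refl_along_def dot_diff_left dot_diff_right dot_commute[of k x v] del: times_divide_eq_left)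
    (simp add: mult.commute mult.left_commute)

lemma refl_along_involution: "refl_along k v (refl_along k v x) = x"
proof (cases "dot k v v = 0")
  case False
  then have "dot k v (refl_along k v x) = - dot k v x"
    by (simp add: refl_along_def dot_diff_right del: times_divide_eq_left) simp
  then have "refl_along k v (refl_along k v x) i = x i" for i
    by (subst refl_along_def) (simp add: refl_along_def)
  then show ?thesis by auto
qed (simp add: refl_along_def)

lemma refl_along_isometry: "dot k (refl_along k v x) (refl_along k v y) = dot k x y"
  by (simp add: refl_along_adjoint refl_along_involution)

text \<open>With v = a - |a| e_k one has v.v = 2 v.a, so reflecting \<open>a\<close> subtracts
  exactly v. If v.v = 0, then v vanishes on the first k + 1 indices, \<open>a\<close> already lies
  on the axis there, and the reflection is the identity.\<close>

lemma refl_along_to_axis: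
  fixes a :: "nat \<Rightarrow> real" and k i :: nat
  defines "\<alpha> \<equiv> sqrt (dot (Suc k) a a)"
  defines "v \<equiv> \<lambda>i. a i - \<alpha> * (if i = k then 1 else 0)"
  assumes "i < Suc k"
  shows "refl_along (Suc k) v a i = (if i = k then \<alpha> else 0)"
proof -
  have a2: "dot (Suc k) a a = \<alpha>\<^sup>2" by (simp add: \<alpha>_def)
  have e: "dot (Suc k) x (\<lambda>i. if i = k then 1 else 0) = x k" for x
    by (simp add: dot_def)
  have va: "dot (Suc k) v a = \<alpha>\<^sup>2 - \<alpha> * a k"
    unfolding v_def dot_diff_left a2 by (simp add: dot_commute[of _ _ a] e)
  have vv: "dot (Suc k) v v = 2 * dot (Suc k) v a"
  proof -
    have "dot (Suc k) v v = dot (Suc k) v a - \<alpha> * v k"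
      by (subst (2) v_def) (simp only: dot_diff_right e)
    then show ?thesis using va by (simp add: v_def algebra_simps power2_eq_square)
  qed
  show ?thesis
  proof (cases "dot (Suc k) v v = 0")
    case True
    with dot_self_eq_0[OF True assms(3)] show ?thesis
      by (auto simp: refl_along_def v_def)
  next
    case False
    then show ?thesis using vv by (simp add: refl_along_def) (simp add: v_def)
  qed
qed

section \<open>Slabs: thickened linear images of balls\<close>

definition ext_zero :: "nat \<Rightarrow> (nat \<Rightarrow> real) \<Rightarrow> nat \<Rightarrow> real" where
  "ext_zero k h = (\<lambda>i. if i < k then h i else 0)"

definition mat_vec :: "nat \<Rightarrow> (nat \<Rightarrow> nat \<Rightarrow> real) \<Rightarrow> (nat \<Rightarrow> real) \<Rightarrow> nat \<Rightarrow> real" where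
  "mat_vec k W x = (\<lambda>j. if j < k then dot k (W j) x else 0)"

definition nat_cball :: "nat \<Rightarrow> real \<Rightarrow> (nat \<Rightarrow> real) set" where
  "nat_cball k r = {x. (\<forall>i\<ge>k. x i = 0) \<and> dot k x x \<le> r\<^sup>2}"

definition nat_box :: "nat \<Rightarrow> real \<Rightarrow> (nat \<Rightarrow> real) set" where
  "nat_box k \<eta> = {x. (\<forall>i\<ge>k. x i = 0) \<and> (\<forall>i<k. \<bar>x i\<bar> \<le> \<eta>)}"

abbreviation tuples :: "nat \<Rightarrow> 'z set \<Rightarrow> (nat \<Rightarrow> 'z) set" where
  "tuples k Z \<equiv> Pi\<^sub>E {..<k} (\<lambda>_. Z)"

abbreviation leb :: "nat \<Rightarrow> (nat \<Rightarrow> real) measure" where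
  "leb k \<equiv> Pi\<^sub>M {..<k} (\<lambda>_. lborel)"

abbreviation iid :: "'i set \<Rightarrow> 'a measure \<Rightarrow> ('i \<Rightarrow> 'a) measure" where
  "iid I Q \<equiv> Pi\<^sub>M I (\<lambda>_. Q)"

text \<open>For \<eta> = 0 this is the image of the \<open>r\<close>-ball under the matrix with rows
  \<open>W j\<close>, a possibly degenerate ellipsoid. The thickness \<eta> leaves room for the
  error of linearising the squared waves on a small piece of \<open>M\<close>.\<close>

definition slab :: "nat \<Rightarrow> (nat \<Rightarrow> nat \<Rightarrow> real) \<Rightarrow> real \<Rightarrow> real \<Rightarrow> (nat \<Rightarrow> real) set" where
  "slab k W r \<eta> = {h \<in> space (leb k). \<exists>x\<in>nat_cball k r. \<forall>j<k. \<bar>h j - dot k (W j) x\<bar> \<le> \<eta>}"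

lemma compact_nat_box: "compact (nat_box k \<eta>)"
proof -
  have "nat_box k \<eta> = Pi\<^sub>E UNIV (\<lambda>i. if i < k then {-\<eta>..\<eta>} else {0})"
    by (force simp: nat_box_def PiE_def Pi_def split: if_splits)
  moreover have "compactin (product_topology (\<lambda>i. euclidean) UNIV) (Pi\<^sub>E UNIV (\<lambda>i. if i < k then {-\<eta>..\<eta>} else {0::real}))"
    by (subst compactin_PiE) auto
  ultimately show ?thesis by (simp add: euclidean_product_topology)
qed

lemma continuous_on_component [continuous_intros]: "continuous_on S (\<lambda>x::nat \<Rightarrow> real. x i)"
  by (rule continuous_on_product_then_coordinatewise[OF continuous_on_id])

lemma continuous_on_dot [continuous_intros]: "continuous_on S (dot k w)"
  unfolding dot_def by (intro continuous_intros)

lemma compact_nat_cball: "compact (nat_cball k r)"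
proof -
  have sub: "nat_cball k r \<subseteq> nat_box k \<bar>r\<bar>"
  proof
    fix x assume x: "x \<in> nat_cball k r"
    have "\<bar>x i\<bar> \<le> \<bar>r\<bar>" if "i < k" for i
    proof -
      have "(x i)\<^sup>2 \<le> dot k x x"
        unfolding dot_def power2_eq_square using that by (intro member_le_sum) auto
      also have "\<dots> \<le> r\<^sup>2" using x by (simp add: nat_cball_def)
      finally show ?thesis by (simp add: abs_le_square_iff)
    qed
    with x show "x \<in> nat_box k \<bar>r\<bar>" by (auto simp: nat_cball_def nat_box_def)
  qed
  have "nat_cball k r = (\<Inter>i\<in>{k..}. {x. x i = 0}) \<inter> {x. dot k x x \<le> r\<^sup>2}"
    by (auto simp: nat_cball_def)
  moreover have "closed \<dots>"
    unfolding dot_def by (intro closed_Int closed_INT ballI closed_Collect_eq closed_Collect_le continuous_intros)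
  ultimately have "closed (nat_cball k r)" by simp
  with sub compact_nat_box[of k "\<bar>r\<bar>"] show ?thesis
    by (metis closed_Int_compact inf.absorb1)
qed

lemma measurable_ext_zero: "ext_zero k \<in> measurable (leb k) borel"
proof -
  have "ext_zero k \<in> measurable (leb k) (Pi\<^sub>M UNIV (\<lambda>i. borel :: real measure))"
  proof (rule measurable_PiM_single')
    show "(\<lambda>h. ext_zero k h i) \<in> borel_measurable (leb k)" for i
      by (cases "i < k") (auto simp: ext_zero_def)
  qed auto
  then show ?thesis using sets_PiM_equal_borel measurable_cong_sets by blast
qed

text \<open>Points of \<open>leb k\<close> are undefined beyond \<open>k\<close>, while compactness
  is available for functions that vanish there. \<open>ext_zero\<close> passes between the two, and
  a slab becomes the preimage of a compact set, a linear image of a ball plus a box; measurability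
  and finite measure follow.\<close>

lemma slab_eq: "slab k W r \<eta> = ext_zero k -` ((\<lambda>(x,e). (\<lambda>j. mat_vec k W x j + e j)) ` (nat_cball k r \<times> nat_box k \<eta>)) \<inter> space (leb k)"
proof (intro set_eqI iffI)
  fix h assume "h \<in> slab k W r \<eta>"
  then obtain x where x: "x \<in> nat_cball k r" "\<forall>j<k. \<bar>h j - dot k (W j) x\<bar> \<le> \<eta>" "h \<in> space (leb k)"
    by (auto simp: slab_def)
  have "ext_zero k h = (\<lambda>(x,e). (\<lambda>j. mat_vec k W x j + e j)) (x, \<lambda>j. if j < k then h j - dot k (W j) x else 0)"
    by (auto simp: ext_zero_def mat_vec_def)
  moreover have "(x, \<lambda>j. if j < k then h j - dot k (W j) x else 0) \<in> nat_cball k r \<times> nat_box k \<eta>"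
    using x by (auto simp: nat_box_def)
  ultimately show "h \<in> ext_zero k -` ((\<lambda>(x,e). (\<lambda>j. mat_vec k W x j + e j)) ` (nat_cball k r \<times> nat_box k \<eta>)) \<inter> space (leb k)"
    using x(3) by blast
next
  fix h assume "h \<in> ext_zero k -` ((\<lambda>(x,e). (\<lambda>j. mat_vec k W x j + e j)) ` (nat_cball k r \<times> nat_box k \<eta>)) \<inter> space (leb k)"
  then obtain x e where xe: "x \<in> nat_cball k r" "e \<in> nat_box k \<eta>" "ext_zero k h = (\<lambda>j. mat_vec k W x j + e j)" "h \<in> space (leb k)"
    by auto
  have "\<bar>h j - dot k (W j) x\<bar> \<le> \<eta>" if "j < k" for j
    using fun_cong[OF xe(3), of j] that xe(2) by (auto simp: ext_zero_def mat_vec_def nat_box_def)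
  with xe show "h \<in> slab k W r \<eta>" by (auto simp: slab_def)
qed

lemma continuous_on_mat_vec: "continuous_on S (mat_vec k W)"
proof (rule continuous_on_coordinatewise_then_product)
  show "continuous_on S (\<lambda>x. mat_vec k W x j)" for j
    by (cases "j < k") (auto simp: mat_vec_def intro!: continuous_intros)
qed

lemma compact_slab_image: "compact ((\<lambda>(x,e). (\<lambda>j. mat_vec k W x j + e j)) ` (nat_cball k r \<times> nat_box k \<eta>))"
proof (rule compact_continuous_image)
  have "continuous_on S (\<lambda>p::(nat\<Rightarrow>real)\<times>(nat\<Rightarrow>real). mat_vec k W (fst p) j)" for S j
    by (rule continuous_on_product_then_coordinatewise[OF continuous_on_compose2[OF continuous_on_mat_vec[of UNIV]]])
      (auto intro: continuous_intros)
  moreover have "continuous_on S (\<lambda>p::(nat\<Rightarrow>real)\<times>(nat\<Rightarrow>real). snd p j)" for S j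
    by (rule continuous_on_product_then_coordinatewise) (auto intro: continuous_intros)
  ultimately show "continuous_on (nat_cball k r \<times> nat_box k \<eta>) (\<lambda>(x,e). (\<lambda>j. mat_vec k W x j + e j))"
    by (intro continuous_on_coordinatewise_then_product) (auto simp: case_prod_beta intro!: continuous_on_add)
qed (intro compact_Times compact_nat_cball compact_nat_box)

lemma slab_measurable [measurable]: "slab k W r \<eta> \<in> sets (leb k)"
  unfolding slab_eq
  by (intro measurable_sets[OF measurable_ext_zero] borel_closed compact_imp_closed compact_slab_image)

text \<open>A product measure is determined by its values on boxes, so the scaling factor is
  computed there, coordinate by coordinate.\<close>

lemma emeasure_affine_vimage:
  assumes s: "s > 0" and S: "S \<in> sets (leb k)"
  shows "emeasure (leb k) {h \<in> space (leb k). (\<lambda>j\<in>{..<k}. (h j - c j) / s) \<in> S} = ennreal (s ^ k) * emeasure (leb k) S"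
proof -
  interpret product_sigma_finite "\<lambda>_::nat. lborel :: real measure" by standard
  define T where "T = (\<lambda>h::nat \<Rightarrow> real. \<lambda>j\<in>{..<k}. (h j - c j) / s)"
  have T[measurable]: "T \<in> measurable (leb k) (leb k)"
    unfolding T_def by measurable
  have one: "emeasure lborel {x::real. (x - d) / s \<in> A} = ennreal s * emeasure lborel A" if [measurable]: "A \<in> sets lborel" for A d
  proof -
    have "emeasure lborel {x::real. (x - d) / s \<in> A} = (\<integral>\<^sup>+x. indicator A ((x - d) / s) \<partial>lborel)"
    proof -
      have [measurable]: "{x::real. (x - d) / s \<in> A} \<in> sets borel"
      proof -
        have "(\<lambda>x. (x - d) / s) -` A \<inter> space borel \<in> sets borel"
          by (rule measurable_sets[where A=borel]) (use that in auto)
        then show ?thesis by (simp add: vimage_def)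
      qed
      show ?thesis by (simp add: nn_integral_indicator[symmetric] indicator_def del: nn_integral_indicator)
    qed
    also have "\<dots> = ennreal s * (\<integral>\<^sup>+x. indicator A x \<partial>lborel)"
      by (subst nn_integral_real_affine[where c=s and t=d]) (use s in auto)
    finally show ?thesis using that by simp
  qed
  have "density (distr (leb k) (leb k) T) (\<lambda>_. ennreal (1 / s ^ k)) = leb k"
  proof (rule PiM_eqI)
    fix A assume A: "\<And>i. i \<in> {..<k} \<Longrightarrow> A i \<in> sets (lborel :: real measure)"
    have PA: "Pi\<^sub>E {..<k} A \<in> sets (leb k)" using A by (intro sets_PiM_I_finite) auto
    have "T -` Pi\<^sub>E {..<k} A \<inter> space (leb k) = Pi\<^sub>E {..<k} (\<lambda>i. {x. (x - c i) / s \<in> A i})"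
      by (auto simp: T_def space_PiM PiE_def Pi_def extensional_def)
    then have "emeasure (distr (leb k) (leb k) T) (Pi\<^sub>E {..<k} A) = emeasure (leb k) (Pi\<^sub>E {..<k} (\<lambda>i. {x. (x - c i) / s \<in> A i}))"
      using PA by (simp add: emeasure_distr)
    also have "\<dots> = (\<Prod>i<k. emeasure lborel {x. (x - c i) / s \<in> A i})"
    proof (rule emeasure_PiM)
      fix i assume "i \<in> {..<k}"
      then have "(\<lambda>x. (x - c i) / s) -` A i \<inter> space borel \<in> sets borel"
        by (intro measurable_sets[where A=borel]) (use A in auto)
      then show "{x. (x - c i) / s \<in> A i} \<in> sets lborel" by (simp add: vimage_def)
    qed simp
    also have "\<dots> = (\<Prod>i<k. ennreal s * emeasure lborel (A i))"
      using A by (intro prod.cong) (auto simp: one)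
    also have "\<dots> = ennreal (s ^ k) * (\<Prod>i<k. emeasure lborel (A i))"
      using s by (simp add: prod.distrib ennreal_power)
    finally have "emeasure (distr (leb k) (leb k) T) (Pi\<^sub>E {..<k} A) = ennreal (s ^ k) * (\<Prod>i<k. emeasure lborel (A i))" .
    then show "emeasure (density (distr (leb k) (leb k) T) (\<lambda>_. ennreal (1 / s ^ k))) (Pi\<^sub>E {..<k} A) = (\<Prod>i\<in>{..<k}. emeasure lborel (A i))"
      using PA s by (simp add: emeasure_density_const mult.assoc[symmetric] ennreal_mult[symmetric])
  qed auto
  then have "emeasure (leb k) S = emeasure (density (distr (leb k) (leb k) T) (\<lambda>_. ennreal (1 / s ^ k))) S" by simp
  also have "\<dots> = ennreal (1 / s ^ k) * emeasure (leb k) (T -` S \<inter> space (leb k))"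
    using S by (simp add: emeasure_density_const emeasure_distr)
  finally have "ennreal (s ^ k) * emeasure (leb k) S = emeasure (leb k) (T -` S \<inter> space (leb k))"
    using s by (simp add: mult.assoc[symmetric] ennreal_mult[symmetric])
  moreover have "T -` S \<inter> space (leb k) = {h \<in> space (leb k). (\<lambda>j\<in>{..<k}. (h j - c j) / s) \<in> S}"
    by (auto simp: T_def)
  ultimately show ?thesis by simp
qed

text \<open>The substitution y = \<alpha> r x turns the integral into the Beta integral of sqrt(1 -
  x^2)^k over [-1, 1], which is the recursion for unit ball volumes. One factor \<alpha>, the length
  of the last row, comes out; the induction over the rows collects these factors.\<close>

lemma nn_integral_ball_slices:
  assumes "\<alpha> > 0" "r > 0" "V \<ge> 0"
  shows "(\<integral>\<^sup>+ y. indicator {-(\<alpha> * r)..\<alpha> * r} y * ennreal (V * unit_ball_vol (real k) * sqrt (r\<^sup>2 - (y / \<alpha>)\<^sup>2) ^ k) \<partial>lborel)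
    = ennreal (V * \<alpha> * unit_ball_vol (real (Suc k)) * r ^ Suc k)"
proof -
  have "indicator {-(\<alpha> * r)..\<alpha> * r} (0 + \<alpha> * r * x) * ennreal (V * unit_ball_vol (real k) * sqrt (r\<^sup>2 - ((0 + \<alpha> * r * x) / \<alpha>)\<^sup>2) ^ k)
    = ennreal (V * unit_ball_vol (real k) * r ^ k) * ennreal (indicator {-1..1} x * sqrt (1 - x\<^sup>2) ^ k)" for x :: real
  proof -
    have "sqrt (r\<^sup>2 - ((0 + \<alpha> * r * x) / \<alpha>)\<^sup>2) = r * sqrt (1 - x\<^sup>2)"
    proof -
      have "r\<^sup>2 - ((0 + \<alpha> * r * x) / \<alpha>)\<^sup>2 = r\<^sup>2 * (1 - x\<^sup>2)"
        using assms by (simp add: power_mult_distrib algebra_simps)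
      then show ?thesis using assms by (simp add: real_sqrt_mult)
    qed
    moreover have "0 + \<alpha> * r * x \<in> {-(\<alpha> * r)..\<alpha> * r} \<longleftrightarrow> x \<in> {-1..1}"
    proof -
      have "0 < \<alpha> * r" using assms by simp
      then show ?thesis
        by (metis (no_types, opaque_lifting) add_0 atLeastAtMost_iff mult.right_neutral mult_le_cancel_left_pos mult_minus_right)
    qed
    ultimately show ?thesis using assms
      by (auto simp: indicator_def ennreal_mult[symmetric] power_mult_distrib mult_ac abs_square_le_1 abs_le_iff)
  qed
  then have "(\<integral>\<^sup>+ y. indicator {-(\<alpha> * r)..\<alpha> * r} y * ennreal (V * unit_ball_vol (real k) * sqrt (r\<^sup>2 - (y / \<alpha>)\<^sup>2) ^ k) \<partial>lborel)
     = ennreal \<bar>\<alpha> * r\<bar> * (\<integral>\<^sup>+ x. ennreal (V * unit_ball_vol (real k) * r ^ k) * ennreal (indicator {-1..1} x * sqrt (1 - x\<^sup>2) ^ k) \<partial>lborel)"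
    using assms by (subst nn_integral_real_affine[where c="\<alpha> * r" and t=0]) auto
  also have "\<dots> = ennreal (\<alpha> * r) * (ennreal (V * unit_ball_vol (real k) * r ^ k) * ennreal (Beta (1/2) (real k / 2 + 1)))"
    using assms by (subst nn_integral_cmult) (auto simp: emeasure_cball_aux_integral)
  also have "\<dots> = ennreal (V * \<alpha> * (unit_ball_vol (real k) * Beta (1/2) (real k / 2 + 1)) * r ^ Suc k)"
    using assms by (simp add: ennreal_mult'[symmetric] mult_ac)
  also have "unit_ball_vol (real k) * Beta (1/2) (real k / 2 + 1) = unit_ball_vol (real (Suc k))"
    by (auto simp: unit_ball_vol_def Beta_def Gamma_eq_zero_iff field_simps
          Gamma_one_half_real powr_half_sqrt [symmetric] powr_add [symmetric])
  finally show ?thesis .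
qed

text \<open>A ball is invariant under reflections of the domain, so the last row may be taken to be
  \<alpha> e_k. Fixing the last coordinate \<open>y\<close> of the image then fixes u_k = y /
  \<alpha>, and the other coordinates of \<open>u\<close> run through a ball of radius sqrt(r^2 - (y
  / \<alpha>)^2). If \<alpha> = 0, the image lies in the null set y = 0.\<close>

lemma emeasure_slab_Suc:
  fixes W :: "nat \<Rightarrow> nat \<Rightarrow> real" and k :: nat
  defines "\<alpha> \<equiv> sqrt (dot (Suc k) (W k) (W k))"
  defines "R \<equiv> \<lambda>j. refl_along (Suc k) (\<lambda>i. W k i - \<alpha> * (if i = k then 1 else 0)) (W j)"
  assumes r: "r \<ge> 0"
  shows "\<alpha> = 0 \<Longrightarrow> emeasure (leb (Suc k)) (slab (Suc k) W r 0) = 0"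
    and "\<alpha> > 0 \<Longrightarrow> emeasure (leb (Suc k)) (slab (Suc k) W r 0)
      \<le> (\<integral>\<^sup>+ y. indicator {-(\<alpha> * r)..\<alpha> * r} y * emeasure (leb k) (slab k R (sqrt (r\<^sup>2 - (y / \<alpha>)\<^sup>2)) 0) \<partial>lborel)"
proof -
  interpret product_sigma_finite "\<lambda>_::nat. lborel :: real measure" by standard
  define S where "S y = {x \<in> space (leb k). x(k := y) \<in> slab (Suc k) W r 0}" for y
  have upd: "(\<lambda>x. x(k := y)) \<in> measurable (leb k) (leb (Suc k))" for y
    unfolding lessThan_Suc by (rule measurable_fun_upd[where J="{..<k}"]) auto
  have S_meas: "S y \<in> sets (leb k)" for y
  proof -
    have "S y = (\<lambda>x. x(k := y)) -` slab (Suc k) W r 0 \<inter> space (leb k)" by (auto simp: S_def)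
    then show ?thesis using measurable_sets[OF upd slab_measurable] by simp
  qed
  have "emeasure (leb (Suc k)) (slab (Suc k) W r 0) = (\<integral>\<^sup>+ h. indicator (slab (Suc k) W r 0) h \<partial>Pi\<^sub>M (insert k {..<k}) (\<lambda>_. lborel))"
    by (simp add: lessThan_Suc[symmetric])
  also have "\<dots> = (\<integral>\<^sup>+ y. \<integral>\<^sup>+ x. indicator (slab (Suc k) W r 0) (x(k := y)) \<partial>leb k \<partial>lborel)"
    by (rule product_nn_integral_insert_rev)
      (auto simp: lessThan_Suc[symmetric] intro!: borel_measurable_indicator)
  also have "\<dots> = (\<integral>\<^sup>+ y. \<integral>\<^sup>+ x. indicator (S y) x \<partial>leb k \<partial>lborel)"
    by (intro nn_integral_cong) (auto simp: S_def indicator_def)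
  also have "\<dots> = (\<integral>\<^sup>+ y. emeasure (leb k) (S y) \<partial>lborel)"
    using S_meas by simp
  finally have main: "emeasure (leb (Suc k)) (slab (Suc k) W r 0) = (\<integral>\<^sup>+ y. emeasure (leb k) (S y) \<partial>lborel)" .
  have key: "\<exists>u\<in>nat_cball (Suc k) r. y = \<alpha> * u k \<and> (\<forall>j<k. x j = dot k (R j) u + R j k * u k)" if "x \<in> S y" for x y
  proof -
    from that obtain u where u: "u \<in> nat_cball (Suc k) r" "\<And>j. j < Suc k \<Longrightarrow> (x(k := y)) j = dot (Suc k) (W j) u"
      by (auto simp: S_def slab_def)
    define v where "v = (\<lambda>i. W k i - \<alpha> * (if i = k then 1 else 0))"
    \<comment> \<open>The reflection may change indices beyond \<open>k\<close> as well; truncation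
      brings the point back into \<open>nat_cball\<close>.\<close>
    define u' where "u' = ext_zero (Suc k) (refl_along (Suc k) v u)"
    have "dot (Suc k) u' u' = dot (Suc k) u u"
      unfolding refl_along_isometry[of "Suc k" v u u, symmetric] by (rule dot_cong) (auto simp: u'_def ext_zero_def)
    with u have u'B: "u' \<in> nat_cball (Suc k) r" by (auto simp: nat_cball_def u'_def ext_zero_def)
    have eq: "(x(k := y)) j = dot (Suc k) (R j) u'" if "j < Suc k" for j
    proof -
      have "dot (Suc k) (W j) u = dot (Suc k) (R j) (refl_along (Suc k) v u)"
        by (simp add: R_def v_def refl_along_isometry)
      also have "\<dots> = dot (Suc k) (R j) u'" by (rule dot_cong) (auto simp: u'_def ext_zero_def)
      finally show ?thesis using u(2)[OF that] by simp
    qed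
    have "y = dot (Suc k) (R k) u'" using eq[of k] by simp
    also have "\<dots> = dot (Suc k) (\<lambda>i. if i = k then \<alpha> else 0) u'"
      by (rule dot_cong) (use refl_along_to_axis[of _ k "W k"] in \<open>auto simp: R_def \<alpha>_def\<close>)
    also have "\<dots> = \<alpha> * u' k" by (simp add: dot_Suc) (simp add: dot_def)
    finally have "y = \<alpha> * u' k" .
    moreover have "x j = dot k (R j) u' + R j k * u' k" if "j < k" for j
      using eq[of j] that by (simp add: dot_Suc)
    ultimately show ?thesis using u'B by blast
  qed
  show "emeasure (leb (Suc k)) (slab (Suc k) W r 0) = 0" if "\<alpha> = 0"
  proof -
    have "S y = {}" if "y \<noteq> 0" for y using key[of _ y] \<open>\<alpha> = 0\<close> that by auto
    then have "AE y in lborel. emeasure (leb k) (S y) = 0"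
      using AE_lborel_singleton[of "0::real"] by (auto elim!: eventually_mono)
    then show ?thesis unfolding main by (simp add: nn_integral_cong_AE)
  qed
  show "emeasure (leb (Suc k)) (slab (Suc k) W r 0)
      \<le> (\<integral>\<^sup>+ y. indicator {-(\<alpha> * r)..\<alpha> * r} y * emeasure (leb k) (slab k R (sqrt (r\<^sup>2 - (y / \<alpha>)\<^sup>2)) 0) \<partial>lborel)" if "\<alpha> > 0"
    unfolding main
  proof (rule nn_integral_mono)
    fix y :: real
    let ?\<rho> = "sqrt (r\<^sup>2 - (y / \<alpha>)\<^sup>2)"
    \<comment> \<open>The fixed coordinate u_k = y / \<alpha> only translates the slice. The
      division by 1 gives the shape of \<open>emeasure_affine_vimage\<close> with scale 1.\<close>
    let ?T = "{h \<in> space (leb k). (\<lambda>j\<in>{..<k}. (h j - R j k * (y / \<alpha>)) / 1) \<in> slab k R ?\<rho> 0}"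
    have *: "\<bar>y\<bar> \<le> \<alpha> * r \<and> x \<in> ?T" if x: "x \<in> S y" for x
    proof -
      from key[OF x] obtain u where u: "u \<in> nat_cball (Suc k) r" "y = \<alpha> * u k" "\<forall>j<k. x j = dot k (R j) u + R j k * u k"
        by blast
      have uk: "u k = y / \<alpha>" using u(2) \<open>\<alpha> > 0\<close> by simp
      have le: "dot k u u \<le> r\<^sup>2 - (y / \<alpha>)\<^sup>2"
        using u(1) by (simp add: nat_cball_def dot_Suc uk power2_eq_square)
      have sq: "(y / \<alpha>)\<^sup>2 \<le> r\<^sup>2" using le dot_nonneg[of k u] by linarith
      then have "\<bar>y / \<alpha>\<bar> \<le> r" using r by (simp add: abs_le_square_iff[symmetric])
      then have y: "\<bar>y\<bar> \<le> \<alpha> * r" using \<open>\<alpha> > 0\<close> by (simp add: abs_divide pos_divide_le_eq mult.commute)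
      have "ext_zero k u \<in> nat_cball k ?\<rho>"
        using le sq by (auto simp: nat_cball_def ext_zero_def dot_def)
      moreover have "dot k (R j) (ext_zero k u) = dot k (R j) u" for j
        by (rule dot_cong) (auto simp: ext_zero_def)
      ultimately have "(\<lambda>j\<in>{..<k}. (x j - R j k * (y / \<alpha>)) / 1) \<in> slab k R ?\<rho> 0"
        using u(3) uk by (auto simp: slab_def space_PiM intro!: bexI[of _ "ext_zero k u"])
      with y x show ?thesis by (auto simp: S_def)
    qed
    have T: "?T \<in> sets (leb k)"
    proof -
      have "(\<lambda>h. \<lambda>j\<in>{..<k}. (h j - R j k * (y / \<alpha>)) / 1) -` slab k R ?\<rho> 0 \<inter> space (leb k) \<in> sets (leb k)"
        by (rule measurable_sets[OF _ slab_measurable]) measurable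
      also have "(\<lambda>h. \<lambda>j\<in>{..<k}. (h j - R j k * (y / \<alpha>)) / 1) -` slab k R ?\<rho> 0 \<inter> space (leb k) = ?T" by auto
      finally show ?thesis .
    qed
    show "emeasure (leb k) (S y) \<le> indicator {-(\<alpha> * r)..\<alpha> * r} y * emeasure (leb k) (slab k R ?\<rho> 0)"
    proof (cases "\<bar>y\<bar> \<le> \<alpha> * r")
      case True
      have "emeasure (leb k) (S y) \<le> emeasure (leb k) ?T"
        using * T by (intro emeasure_mono) auto
      also have "\<dots> = emeasure (leb k) (slab k R ?\<rho> 0)"
        by (subst emeasure_affine_vimage) auto
      finally show ?thesis using True by (auto simp: abs_le_iff indicator_def)
    next
      case False
      then have "S y = {}" using * by blast
      then show ?thesis by simp
    qed
  qed
qed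

lemma emeasure_slab_finite: "emeasure (leb k) (slab k W r \<eta>) < \<infinity>"
proof -
  interpret product_sigma_finite "\<lambda>_::nat. lborel :: real measure" by standard
  let ?K = "(\<lambda>(x,e). (\<lambda>j. mat_vec k W x j + e j)) ` (nat_cball k r \<times> nat_box k \<eta>)"
  have "bounded ((\<lambda>h. h j) ` ?K)" for j
    by (intro compact_imp_bounded compact_continuous_image compact_slab_image continuous_intros)
  then have "\<forall>j. \<exists>c. \<forall>h\<in>?K. \<bar>h j\<bar> \<le> c"
    unfolding bounded_iff by simp
  from choice[OF this] obtain c where c: "\<And>j h. h \<in> ?K \<Longrightarrow> \<bar>h j\<bar> \<le> c j" by blast
  have "slab k W r \<eta> \<subseteq> Pi\<^sub>E {..<k} (\<lambda>j. {-c j..c j})"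
  proof
    fix h assume "h \<in> slab k W r \<eta>"
    then have h: "ext_zero k h \<in> ?K" "h \<in> space (leb k)" by (auto simp: slab_eq)
    have "h j \<in> {-c j..c j}" if "j < k" for j
      using c[OF h(1), of j] that by (auto simp: ext_zero_def abs_le_iff)
    with h(2) show "h \<in> Pi\<^sub>E {..<k} (\<lambda>j. {-c j..c j})"
      by (auto simp: space_PiM PiE_def Pi_def)
  qed
  then have "emeasure (leb k) (slab k W r \<eta>) \<le> emeasure (leb k) (Pi\<^sub>E {..<k} (\<lambda>j. {-c j..c j}))"
    by (intro emeasure_mono sets_PiM_I_finite) auto
  also have "\<dots> = (\<Prod>j<k. emeasure lborel {-c j..c j})"
    by (rule emeasure_PiM) auto
  also have "\<dots> < \<infinity>"
  proof -
    have "(\<Prod>j<k. emeasure lborel {-c j..c j}) \<noteq> top"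
      by (auto simp: ennreal_prod_eq_top emeasure_lborel_Icc_eq)
    then show ?thesis by (simp add: less_top)
  qed
  finally show ?thesis .
qed

text \<open>The measure grows with the radius, and monotone functions are Borel.
  \<open>max 0\<close> secures monotonicity, because \<open>nat_cball\<close> sees only the square
  of the radius.\<close>

lemma borel_measurable_emeasure_slab:
  "(\<lambda>\<rho>. emeasure (leb k) (slab k W (max 0 \<rho>) 0)) \<in> borel_measurable borel"
proof -
  define g where "g \<rho> = measure (leb k) (slab k W (max 0 \<rho>) 0)" for \<rho>
  have e: "emeasure (leb k) (slab k W (max 0 \<rho>) 0) = ennreal (g \<rho>)" for \<rho>
    using emeasure_slab_finite[of k W "max 0 \<rho>" 0] by (simp add: g_def emeasure_eq_ennreal_measure less_top)
  have "mono g"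
  proof (rule monoI)
    fix x y :: real assume "x \<le> y"
    then have "nat_cball k (max 0 x) \<subseteq> nat_cball k (max 0 y)"
      by (auto simp: nat_cball_def intro: order_trans power_mono)
    then have "slab k W (max 0 x) 0 \<subseteq> slab k W (max 0 y) 0"
      unfolding slab_def by blast
    then show "g x \<le> g y" unfolding g_def
      using emeasure_slab_finite[of k W "max 0 y" 0]
      by (intro measure_mono_fmeasurable) (auto simp: fmeasurable_def)
  qed
  then have "g \<in> borel_measurable borel" by (rule borel_measurable_mono)
  then show ?thesis unfolding e by measurable
qed

text \<open>Testing the frame bound on the unit vectors bounds the total squared length of the
  \<open>a z\<close> by k c^2; Cauchy-Schwarz against the weights \<gamma> does the rest. The
  cardinality of \<open>Z\<close> does not enter.\<close>

lemma sum_norm_le_of_frame: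
  fixes a :: "'z \<Rightarrow> nat \<Rightarrow> real"
  assumes "finite Z" "(\<Sum>z\<in>Z. (\<gamma> z)\<^sup>2) \<le> 1" "c \<ge> 0"
    and frame: "\<And>x. (\<Sum>z\<in>Z. (dot k (a z) x)\<^sup>2) \<le> c\<^sup>2 * dot k x x"
  shows "(\<Sum>z\<in>Z. \<bar>\<gamma> z\<bar> * sqrt (dot k (a z) (a z))) \<le> c * sqrt (real k)"
proof -
  have "(\<Sum>z\<in>Z. dot k (a z) (a z)) = (\<Sum>i<k. \<Sum>z\<in>Z. (a z i)\<^sup>2)"
    unfolding dot_def power2_eq_square by (rule sum.swap)
  also have "\<dots> \<le> (\<Sum>i<k. c\<^sup>2)"
  proof (rule sum_mono)
    fix i assume "i \<in> {..<k}"
    then have "(\<Sum>l<k. x l * (if l = i then 1 else 0)) = x i" for x :: "nat \<Rightarrow> real"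
      by (subst sum.remove[of _ i]) (auto intro!: sum.neutral)
    then have "dot k x (\<lambda>l. if l = i then 1 else 0) = x i" for x
      by (simp add: dot_def)
    with frame[of "\<lambda>l. if l = i then 1 else 0"] show "(\<Sum>z\<in>Z. (a z i)\<^sup>2) \<le> c\<^sup>2"
      by simp
  qed
  finally have A: "(\<Sum>z\<in>Z. dot k (a z) (a z)) \<le> (c * sqrt (real k))\<^sup>2"
    by (simp add: power_mult_distrib mult.commute)
  have "(\<Sum>z\<in>Z. \<bar>\<gamma> z\<bar> * sqrt (dot k (a z) (a z)))\<^sup>2
      \<le> (\<Sum>z\<in>Z. \<bar>\<gamma> z\<bar>\<^sup>2) * (\<Sum>z\<in>Z. (sqrt (dot k (a z) (a z)))\<^sup>2)"
    by (rule Cauchy_Schwarz_ineq_sum)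
  also have "\<dots> \<le> 1 * (c * sqrt (real k))\<^sup>2"
    using assms(2) A by (intro mult_mono) (auto intro!: sum_nonneg)
  finally show ?thesis
    using \<open>c \<ge> 0\<close> power2_le_imp_le[of _ "c * sqrt (real k)"] by simp
qed

text \<open>A reflection of the domain turns the last row into a multiple of the last unit vector, so slicing
  reduces \<open>k + 1\<close> to \<open>k\<close>; Cauchy-Schwarz over the last index then yields the factor
  \<open>c * sqrt (k + 1)\<close>.\<close>

proposition sum_emeasure_slab_le:
  fixes a :: "'z \<Rightarrow> nat \<Rightarrow> real"
  assumes Z: "finite Z" "(\<Sum>z\<in>Z. (\<gamma> z)\<^sup>2) \<le> 1" "c \<ge> 0"
    and "\<And>x. (\<Sum>z\<in>Z. (dot k (a z) x)\<^sup>2) \<le> c\<^sup>2 * dot k x x" "r \<ge> 0"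
  shows "(\<Sum>\<zeta>\<in>tuples k Z. emeasure (leb k) (slab k (\<lambda>j i. \<gamma> (\<zeta> j) * a (\<zeta> j) i) r 0))
     \<le> ennreal (c ^ k * sqrt (fact k) * unit_ball_vol (real k) * r ^ k)"
  using assms(4,5)
proof (induction k arbitrary: a r)
  case 0
  have "emeasure (leb 0) A \<le> 1" for A
    using emeasure_space[of "leb 0" A] by (simp add: space_PiM)
  then show ?case by (simp add: unit_ball_vol_def)
next
  case (Suc k)
  define W where "W \<zeta> = (\<lambda>j i. \<gamma> (\<zeta> j) * a (\<zeta> j) i)" for \<zeta> :: "nat \<Rightarrow> 'z"
  define C where "C = c ^ k * sqrt (fact k)"
  have C: "C \<ge> 0" using Z by (simp add: C_def)
  \<comment> \<open>Length of the last row \<open>\<gamma> z * a z\<close>, the \<alpha> of the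
    slicing lemma.\<close>
  define n where "n z = \<bar>\<gamma> z\<bar> * sqrt (dot (Suc k) (a z) (a z))" for z
  have n0: "n z \<ge> 0" for z by (simp add: n_def)
  have one: "(\<Sum>\<zeta>\<in>tuples k Z. emeasure (leb (Suc k)) (slab (Suc k) (W (\<zeta>(k := z))) r 0))
    \<le> ennreal (C * n z * unit_ball_vol (real (Suc k)) * r ^ Suc k)" if "z \<in> Z" for z
  proof -
    define w where "w = (\<lambda>i. \<gamma> z * a z i)"
    have wk: "W (\<zeta>(k := z)) k = w" for \<zeta> by (auto simp: W_def w_def)
    have "dot (Suc k) w w = (\<gamma> z)\<^sup>2 * dot (Suc k) (a z) (a z)"
      by (simp add: w_def dot_def sum_distrib_left power2_eq_square algebra_simps)
    then have nz: "sqrt (dot (Suc k) w w) = n z"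
      by (simp add: n_def real_sqrt_mult)
    define v where "v = (\<lambda>i. w i - n z * (if i = k then 1 else 0))"
    define b where "b y = refl_along (Suc k) v (a y)" for y
    \<comment> \<open>The frame bound survives: the reflection is an isometry, and for a vector
      whose last coordinate vanishes only the first \<open>k\<close> entries of a row
      matter.\<close>
    have "(\<Sum>y\<in>Z. (dot k (b y) x)\<^sup>2) \<le> c\<^sup>2 * dot k x x" for x
    proof -
      define x' where "x' = ext_zero k x"
      have "dot k (b y) x = dot (Suc k) (a y) (refl_along (Suc k) v x')" for y
        unfolding refl_along_adjoint[symmetric] b_def
        by (simp add: dot_Suc x'_def ext_zero_def dot_def)
      then have "(\<Sum>y\<in>Z. (dot k (b y) x)\<^sup>2) \<le> c\<^sup>2 * dot (Suc k) (refl_along (Suc k) v x') (refl_along (Suc k) v x')"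
        using Suc.prems(1) by simp
      also have "\<dots> = c\<^sup>2 * dot k x x"
        unfolding refl_along_isometry by (simp add: dot_Suc x'_def ext_zero_def dot_def)
      finally show ?thesis .
    qed
    note IH = Suc.IH[OF this]
    have Req: "refl_along (Suc k) (\<lambda>i. W (\<zeta>(k := z)) k i - sqrt (dot (Suc k) (W (\<zeta>(k := z)) k) (W (\<zeta>(k := z)) k)) * (if i = k then 1 else 0)) (W (\<zeta>(k := z)) j)
        = (\<lambda>i. \<gamma> (\<zeta> j) * b (\<zeta> j) i)" if "j < k" for j \<zeta>
    proof -
      have "dot (Suc k) v (\<lambda>i. \<gamma> (\<zeta> j) * a (\<zeta> j) i) = \<gamma> (\<zeta> j) * dot (Suc k) v (a (\<zeta> j))"
        by (simp add: dot_commute[of _ v] dot_scale_left)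
      then show ?thesis
        unfolding wk nz v_def[symmetric] using that
        by (auto simp: b_def refl_along_def W_def algebra_simps)
    qed
    have slab_R: "slab k (\<lambda>j. refl_along (Suc k) (\<lambda>i. W (\<zeta>(k := z)) k i - sqrt (dot (Suc k) (W (\<zeta>(k := z)) k) (W (\<zeta>(k := z)) k)) * (if i = k then 1 else 0)) (W (\<zeta>(k := z)) j)) \<rho> 0
        = slab k (\<lambda>j i. \<gamma> (\<zeta> j) * b (\<zeta> j) i) \<rho> 0" for \<zeta> \<rho>
      unfolding slab_def using Req by auto
    show ?thesis
    \<comment> \<open>The slice integral is evaluated for positive length and radius; in the
      degenerate cases the slab is a null set.\<close>
    proof (cases "n z = 0 \<or> r = 0")
      case True
      have "emeasure (leb (Suc k)) (slab (Suc k) (W (\<zeta>(k := z))) r 0) = 0" for \<zeta>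
      proof (cases "n z = 0")
        case True
        then show ?thesis using emeasure_slab_Suc(1)[of r k "W (\<zeta>(k := z))"] Suc.prems(2) wk nz by simp
      next
        case False
        with True have "r = 0" by simp
        have "n z > 0" using False n0[of z] by simp
        then have "emeasure (leb (Suc k)) (slab (Suc k) (W (\<zeta>(k := z))) r 0) \<le>
          (\<integral>\<^sup>+ y. indicator {0} y * emeasure (leb k) (slab k (\<lambda>j i. \<gamma> (\<zeta> j) * b (\<zeta> j) i) (sqrt (r\<^sup>2 - (y / n z)\<^sup>2)) 0) \<partial>lborel)"
          using emeasure_slab_Suc(2)[of r k "W (\<zeta>(k := z))"] Suc.prems(2) unfolding slab_R unfolding wk nz by (simp add: \<open>r = 0\<close>)
        also have "\<dots> = 0"
          by (subst nn_integral_cong_AE[where v="\<lambda>_. 0"])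
            (use AE_lborel_singleton[of "0::real"] in \<open>auto elim!: eventually_mono\<close>)
        finally show ?thesis by simp
      qed
      then show ?thesis by simp
    next
      case False
      then have pos: "n z > 0" "r > 0" using n0[of z] Suc.prems(2) by auto
      have bnd: "(\<Sum>\<zeta>\<in>tuples k Z. emeasure (leb k) (slab k (\<lambda>j i. \<gamma> (\<zeta> j) * b (\<zeta> j) i) (sqrt (r\<^sup>2 - (y / n z)\<^sup>2)) 0))
        \<le> ennreal (C * unit_ball_vol (real k) * sqrt (r\<^sup>2 - (y / n z)\<^sup>2) ^ k)" if "y \<in> {-(n z * r)..n z * r}" for y
      proof -
        have "\<bar>y / n z\<bar> \<le> r" using that pos by (simp add: abs_divide pos_divide_le_eq abs_le_iff mult.commute)
        then have "(y / n z)\<^sup>2 \<le> r\<^sup>2" using pos by (simp add: abs_le_square_iff[symmetric])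
        then show ?thesis using IH[of "sqrt (r\<^sup>2 - (y / n z)\<^sup>2)"] by (simp add: C_def)
      qed
      have "(\<Sum>\<zeta>\<in>tuples k Z. emeasure (leb (Suc k)) (slab (Suc k) (W (\<zeta>(k := z))) r 0))
        \<le> (\<Sum>\<zeta>\<in>tuples k Z. (\<integral>\<^sup>+ y. indicator {-(n z * r)..n z * r} y * emeasure (leb k) (slab k (\<lambda>j i. \<gamma> (\<zeta> j) * b (\<zeta> j) i) (sqrt (r\<^sup>2 - (y / n z)\<^sup>2)) 0) \<partial>lborel))"
      proof (rule sum_mono)
        fix \<zeta>
        show "emeasure (leb (Suc k)) (slab (Suc k) (W (\<zeta>(k := z))) r 0) \<le> (\<integral>\<^sup>+ y. indicator {-(n z * r)..n z * r} y * emeasure (leb k) (slab k (\<lambda>j i. \<gamma> (\<zeta> j) * b (\<zeta> j) i) (sqrt (r\<^sup>2 - (y / n z)\<^sup>2)) 0) \<partial>lborel)"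
          using emeasure_slab_Suc(2)[of r k "W (\<zeta>(k := z))"] Suc.prems(2) pos unfolding slab_R unfolding wk nz by simp
      qed
      also have "\<dots> \<le> (\<integral>\<^sup>+ y. indicator {-(n z * r)..n z * r} y * ennreal (C * unit_ball_vol (real k) * sqrt (r\<^sup>2 - (y / n z)\<^sup>2) ^ k) \<partial>lborel)"
      proof (subst nn_integral_sum[symmetric])
        fix \<zeta> :: "nat \<Rightarrow> 'z"
        \<comment> \<open>Beyond the interval of slices the radicand is negative, where the
          indicator cuts the integrand off anyway. \<open>G\<close> clamps the radius, so that it is
          Borel everywhere.\<close>
        define G where "G \<rho> = emeasure (leb k) (slab k (\<lambda>j i. \<gamma> (\<zeta> j) * b (\<zeta> j) i) (max 0 \<rho>) 0)" for \<rho>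
        have [measurable]: "G \<in> borel_measurable borel" unfolding G_def by (rule borel_measurable_emeasure_slab)
        have "(\<lambda>y. indicator {-(n z * r)..n z * r} y * G (sqrt (r\<^sup>2 - (y / n z)\<^sup>2))) \<in> borel_measurable lborel"
          by measurable
        also have "?this \<longleftrightarrow> (\<lambda>y. indicator {-(n z * r)..n z * r} y * emeasure (leb k) (slab k (\<lambda>j i. \<gamma> (\<zeta> j) * b (\<zeta> j) i) (sqrt (r\<^sup>2 - (y / n z)\<^sup>2)) 0)) \<in> borel_measurable lborel"
        proof (rule measurable_cong)
          fix y
          have "0 \<le> r\<^sup>2 - (y / n z)\<^sup>2" if "y \<in> {-(n z * r)..n z * r}"
          proof -
            have "\<bar>y / n z\<bar> \<le> \<bar>r\<bar>" using that pos by (simp add: abs_divide pos_divide_le_eq abs_le_iff mult.commute)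
            then show ?thesis unfolding abs_le_square_iff by simp
          qed
          then show "indicator {-(n z * r)..n z * r} y * G (sqrt (r\<^sup>2 - (y / n z)\<^sup>2)) = indicator {-(n z * r)..n z * r} y * emeasure (leb k) (slab k (\<lambda>j i. \<gamma> (\<zeta> j) * b (\<zeta> j) i) (sqrt (r\<^sup>2 - (y / n z)\<^sup>2)) 0)"
            by (auto simp: indicator_def G_def max_absorb2)
        qed
        finally show "(\<lambda>y. indicator {-(n z * r)..n z * r} y * emeasure (leb k) (slab k (\<lambda>j i. \<gamma> (\<zeta> j) * b (\<zeta> j) i) (sqrt (r\<^sup>2 - (y / n z)\<^sup>2)) 0)) \<in> borel_measurable lborel" .
      next
        show "(\<integral>\<^sup>+ y. (\<Sum>\<zeta>\<in>tuples k Z. indicator {-(n z * r)..n z * r} y * emeasure (leb k) (slab k (\<lambda>j i. \<gamma> (\<zeta> j) * b (\<zeta> j) i) (sqrt (r\<^sup>2 - (y / n z)\<^sup>2)) 0)) \<partial>lborel)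
          \<le> (\<integral>\<^sup>+ y. indicator {-(n z * r)..n z * r} y * ennreal (C * unit_ball_vol (real k) * sqrt (r\<^sup>2 - (y / n z)\<^sup>2) ^ k) \<partial>lborel)"
          using bnd by (intro nn_integral_mono) (auto simp: indicator_def)
      qed
      also have "\<dots> = ennreal (C * n z * unit_ball_vol (real (Suc k)) * r ^ Suc k)"
        by (rule nn_integral_ball_slices) (use pos C in auto)
      finally show ?thesis .
    qed
  qed
  have "(\<Sum>\<zeta>\<in>tuples (Suc k) Z. emeasure (leb (Suc k)) (slab (Suc k) (W \<zeta>) r 0))
    = (\<Sum>(z,\<zeta>)\<in>Z \<times> tuples k Z. emeasure (leb (Suc k)) (slab (Suc k) (W (\<zeta>(k := z))) r 0))"
    unfolding lessThan_Suc PiE_insert_eq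
    by (subst sum.reindex[OF inj_combinator]) (auto simp: case_prod_beta)
  also have "\<dots> = (\<Sum>z\<in>Z. \<Sum>\<zeta>\<in>tuples k Z. emeasure (leb (Suc k)) (slab (Suc k) (W (\<zeta>(k := z))) r 0))"
    by (rule sum.cartesian_product[symmetric])
  also have "\<dots> \<le> (\<Sum>z\<in>Z. ennreal (C * n z * unit_ball_vol (real (Suc k)) * r ^ Suc k))"
    by (rule sum_mono) (rule one)
  also have "\<dots> = ennreal (\<Sum>z\<in>Z. C * n z * unit_ball_vol (real (Suc k)) * r ^ Suc k)"
    using C n0 Suc.prems by (intro sum_ennreal) auto
  also have "\<dots> = ennreal (C * (\<Sum>z\<in>Z. n z) * unit_ball_vol (real (Suc k)) * r ^ Suc k)"
    by (simp only: sum_distrib_left sum_distrib_right)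
  also have "\<dots> \<le> ennreal (C * (c * sqrt (real (Suc k))) * unit_ball_vol (real (Suc k)) * r ^ Suc k)"
    using sum_norm_le_of_frame[OF Z Suc.prems(1)] C Suc.prems(2)
    by (intro ennreal_leI mult_right_mono mult_left_mono) (auto simp: n_def)
  also have "C * (c * sqrt (real (Suc k))) = c ^ Suc k * sqrt (fact (Suc k))"
    by (simp add: C_def real_sqrt_mult)
  finally show ?case by (simp add: W_def)
qed

text \<open>The slabs of thickness 1/m decrease to the slab of thickness 0 because the image of the
  compact ball is closed. Their measures are finite, so continuity from above applies.\<close>

lemma emeasure_slab_shrink:
  assumes "e > 0"
  shows "\<exists>\<eta>>0. emeasure (leb k) (slab k W r \<eta>) \<le> emeasure (leb k) (slab k W r 0) + ennreal e"
proof -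
  define A where "A m = slab k W r (1 / real (Suc m))" for m
  have mono: "slab k W r \<eta> \<subseteq> slab k W r \<eta>'" if "\<eta> \<le> \<eta>'" for \<eta> \<eta>'
    using that by (force simp: slab_def)
  have dec: "decseq A"
    unfolding A_def by (intro decseq_SucI mono) (simp add: field_simps)
  have "(\<Inter>m. A m) \<subseteq> slab k W r 0"
  proof
    fix h assume h: "h \<in> (\<Inter>m. A m)"
    have sp: "h \<in> space (leb k)" using h by (auto simp: A_def slab_def)
    have "\<exists>x\<in>nat_cball k r. \<forall>j<k. \<bar>h j - dot k (W j) x\<bar> \<le> 1 / real (Suc m)" for m
      using h by (auto simp: A_def slab_def)
    then obtain x where x: "\<And>m. x m \<in> nat_cball k r" "\<And>m j. j < k \<Longrightarrow> \<bar>h j - dot k (W j) (x m)\<bar> \<le> 1 / real (Suc m)"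
      by metis
    have cl: "closed (mat_vec k W ` nat_cball k r)"
      by (intro compact_imp_closed compact_continuous_image compact_nat_cball continuous_on_mat_vec)
    have "(\<lambda>m. mat_vec k W (x m) j) \<longlonglongrightarrow> ext_zero k h j" for j
    proof (cases "j < k")
      case True
      have "(\<lambda>m. h j - dot k (W j) (x m)) \<longlonglongrightarrow> 0"
        by (rule Lim_null_comparison[OF _ LIMSEQ_inverse_real_of_nat])
          (use x(2)[OF True] in \<open>auto simp: inverse_eq_divide\<close>)
      then have "(\<lambda>m. h j - (h j - dot k (W j) (x m))) \<longlonglongrightarrow> h j - 0"
        by (intro tendsto_intros)
      then show ?thesis using True by (simp add: mat_vec_def ext_zero_def)
    qed (simp add: mat_vec_def ext_zero_def)
    then have lim: "(\<lambda>m. mat_vec k W (x m)) \<longlonglongrightarrow> ext_zero k h"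
      using limitin_componentwise[of "\<lambda>_. euclidean" UNIV "\<lambda>m. mat_vec k W (x m)" "ext_zero k h" sequentially]
      by (simp add: euclidean_product_topology limitin_canonical_iff)
    have "ext_zero k h \<in> mat_vec k W ` nat_cball k r"
      by (rule closed_sequentially[OF cl _ lim]) (use x(1) in auto)
    then obtain y where y: "y \<in> nat_cball k r" "ext_zero k h = mat_vec k W y" by auto
    have "h j = dot k (W j) y" if "j < k" for j
      using fun_cong[OF y(2), of j] that by (simp add: ext_zero_def mat_vec_def)
    with y sp show "h \<in> slab k W r 0" by (auto simp: slab_def)
  qed
  moreover have "(INF m. emeasure (leb k) (A m)) = emeasure (leb k) (\<Inter>m. A m)"
    using emeasure_slab_finite[of k W r]
    by (intro INF_emeasure_decseq[OF _ dec]) (auto simp: A_def less_top)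
  ultimately have "(INF m. emeasure (leb k) (A m)) \<le> emeasure (leb k) (slab k W r 0)"
    by (simp add: emeasure_mono)
  also have "\<dots> < emeasure (leb k) (slab k W r 0) + ennreal e"
    using emeasure_slab_finite[of k W r 0] assms using ennreal_add_left_cancel_less[of "emeasure (leb k) (slab k W r 0)" 0 "ennreal e"] by (simp add: less_top)
  finally obtain m where "emeasure (leb k) (A m) < emeasure (leb k) (slab k W r 0) + ennreal e"
    by (auto simp: INF_less_iff)
  then show ?thesis unfolding A_def by (intro exI[of _ "1 / real (Suc m)"]) auto
qed

text \<open>There are only finitely many tuples, so one positive thickness serves all of them at
  total cost \<open>e\<close>.\<close>

proposition sum_emeasure_thick_slab_le:
  fixes a :: "'z \<Rightarrow> nat \<Rightarrow> real"
  assumes Z: "finite Z" "(\<Sum>z\<in>Z. (\<gamma> z)\<^sup>2) \<le> 1" "c \<ge> 0"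
    and frame: "\<And>x. (\<Sum>z\<in>Z. (dot k (a z) x)\<^sup>2) \<le> c\<^sup>2 * dot k x x" and "e > 0"
  shows "\<exists>\<eta>>0. (\<Sum>\<zeta>\<in>tuples k Z. emeasure (leb k) (slab k (\<lambda>j i. \<gamma> (\<zeta> j) * a (\<zeta> j) i) 1 \<eta>))
     \<le> ennreal (c ^ k * sqrt (fact k) * unit_ball_vol (real k) + e)"
proof -
  define P where "P = tuples k Z"
  have P: "finite P" using Z by (auto simp: P_def intro!: finite_PiE)
  define W where "W \<zeta> = (\<lambda>j i. \<gamma> (\<zeta> j) * a (\<zeta> j) i)" for \<zeta> :: "nat \<Rightarrow> 'z"
  define e' where "e' = e / real (Suc (card P))"
  have e': "e' > 0" using \<open>e > 0\<close> by (simp add: e'_def)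
  have "\<forall>\<zeta>. \<exists>\<eta>>0. emeasure (leb k) (slab k (W \<zeta>) 1 \<eta>) \<le> emeasure (leb k) (slab k (W \<zeta>) 1 0) + ennreal e'"
    using emeasure_slab_shrink[OF e'] by blast
  then obtain H where H: "\<And>\<zeta>. H \<zeta> > 0" "\<And>\<zeta>. emeasure (leb k) (slab k (W \<zeta>) 1 (H \<zeta>)) \<le> emeasure (leb k) (slab k (W \<zeta>) 1 0) + ennreal e'"
    by metis
  define \<eta> where "\<eta> = Min (insert 1 (H ` P))"
  have "\<eta> > 0" using P H(1) by (simp add: \<eta>_def)
  have le: "\<eta> \<le> H \<zeta>" if "\<zeta> \<in> P" for \<zeta> using P that by (simp add: \<eta>_def)
  have "emeasure (leb k) (slab k (W \<zeta>) 1 \<eta>) \<le> emeasure (leb k) (slab k (W \<zeta>) 1 0) + ennreal e'" if "\<zeta> \<in> P" for \<zeta>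
  proof -
    have "slab k (W \<zeta>) 1 \<eta> \<subseteq> slab k (W \<zeta>) 1 (H \<zeta>)"
      using le[OF that] by (force simp: slab_def)
    then have "emeasure (leb k) (slab k (W \<zeta>) 1 \<eta>) \<le> emeasure (leb k) (slab k (W \<zeta>) 1 (H \<zeta>))"
      by (intro emeasure_mono) auto
    with H(2) show ?thesis by (meson order_trans)
  qed
  then have "(\<Sum>\<zeta>\<in>P. emeasure (leb k) (slab k (W \<zeta>) 1 \<eta>)) \<le> (\<Sum>\<zeta>\<in>P. emeasure (leb k) (slab k (W \<zeta>) 1 0) + ennreal e')"
    by (intro sum_mono) auto
  also have "\<dots> = (\<Sum>\<zeta>\<in>P. emeasure (leb k) (slab k (W \<zeta>) 1 0)) + ennreal (real (card P) * e')"
    using e' by (simp add: sum.distrib ennreal_of_nat_eq_real_of_nat ennreal_mult)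
  also have "\<dots> \<le> ennreal (c ^ k * sqrt (fact k) * unit_ball_vol (real k)) + ennreal e"
  proof (rule add_mono)
    show "(\<Sum>\<zeta>\<in>P. emeasure (leb k) (slab k (W \<zeta>) 1 0)) \<le> ennreal (c ^ k * sqrt (fact k) * unit_ball_vol (real k))"
      using sum_emeasure_slab_le[OF Z frame, of 1] by (simp add: P_def W_def)
    show "ennreal (real (card P) * e') \<le> ennreal e"
      using \<open>e > 0\<close> by (intro ennreal_leI) (simp add: e'_def field_simps)
  qed
  also have "\<dots> = ennreal (c ^ k * sqrt (fact k) * unit_ball_vol (real k) + e)"
    using \<open>e > 0\<close> \<open>c \<ge> 0\<close> by (subst ennreal_plus) auto
  finally show ?thesis using \<open>\<eta> > 0\<close> by (auto simp: P_def W_def)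
qed

section \<open>Random thresholds\<close>

lemma sum_powers_mult_le_1:
  fixes u :: real
  assumes "0 \<le> u" "u < 1"
  shows "(\<Sum>l<K. u ^ l) \<le> 1 / (1 - u)"
proof -
  have "(\<Sum>l<K. u ^ l) = (1 - u ^ K) / (1 - u)"
    using assms by (simp add: geometric_sum field_simps)
  also have "\<dots> \<le> 1 / (1 - u)" using assms by (intro divide_right_mono) auto
  finally show ?thesis .
qed

text \<open>In the application \<kappa> prescribes the draw at which each colour first captures a
  point, and \<open>U\<close> is the event that an earlier draw fails. The two conditions concern
  disjoint sets of coordinates, the graph of \<kappa> and the region below it, so independence gives
  a product.\<close>

lemma emeasure_PiM_event_split:
  fixes Q :: "'q measure" and n K :: nat
  assumes Q: "prob_space Q" and S: "S \<in> sets (iid {..<n} Q)" and U: "U \<in> sets Q"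
    and \<kappa>: "\<kappa> \<in> tuples n {..<K}"
  defines "I \<equiv> {..<n} \<times> {..<K}"
  defines "B \<equiv> {\<omega> \<in> space (iid I Q). (\<lambda>j\<in>{..<n}. \<omega> (j, \<kappa> j)) \<in> S \<and> (\<forall>j<n. \<forall>l<\<kappa> j. \<omega> (j, l) \<in> U)}"
  shows "B \<in> sets (iid I Q)"
    and "emeasure (iid I Q) B = emeasure (iid {..<n} Q) S * (\<Prod>j<n. emeasure Q U ^ \<kappa> j)"
proof -
  interpret Q: prob_space Q by fact
  interpret product_sigma_finite "\<lambda>_::nat\<times>nat. Q"
    by (intro product_sigma_finite.intro Q.sigma_finite_measure_axioms)
  \<comment> \<open>\<open>I1\<close> is the graph of \<kappa> and \<open>J\<close> the region
    strictly below it. The coordinates in \<open>I2 - J\<close> are unconstrained and contribute the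
    factor 1.\<close>
  define I1 where "I1 = (\<lambda>j. (j, \<kappa> j)) ` {..<n}"
  define I2 where "I2 = I - I1"
  define J where "J = (SIGMA j:{..<n}. {..<\<kappa> j})"
  have \<kappa>': "\<kappa> j < K" if "j < n" for j using \<kappa> that by auto
  have I: "I1 \<inter> I2 = {}" "finite I1" "finite I2" "I = I1 \<union> I2" "J \<subseteq> I2" "I1 \<subseteq> I"
    using \<kappa>' by (auto simp: I1_def I2_def I_def J_def intro: less_trans)
  have [measurable]: "S \<in> sets (iid {..<n} Q)" "U \<in> sets Q" by fact+
  have finJ: "finite J" by (simp add: J_def)
  have JI: "J \<subseteq> I" using I by auto
  have Bsets: "B = {\<omega> \<in> space (iid I Q). (\<lambda>j\<in>{..<n}. \<omega> (j, \<kappa> j)) \<in> S} \<inter> {\<omega> \<in> space (iid I Q). \<forall>i\<in>J. \<omega> i \<in> U}"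
    by (auto simp: B_def J_def)
  have m1: "(\<lambda>\<omega>. \<lambda>j\<in>{..<n}. \<omega> (j, \<kappa> j)) \<in> measurable (iid I Q) (iid {..<n} Q)"
    using \<kappa>' by (intro measurable_restrict measurable_component_singleton) (auto simp: I_def)
  have m1': "(\<lambda>\<omega>. \<lambda>j\<in>{..<n}. \<omega> (j, \<kappa> j)) \<in> measurable (iid I1 Q) (iid {..<n} Q)"
    by (intro measurable_restrict measurable_component_singleton) (auto simp: I1_def)
  have s1: "{\<omega> \<in> space (iid I Q). (\<lambda>j\<in>{..<n}. \<omega> (j, \<kappa> j)) \<in> S} \<in> sets (iid I Q)"
    using measurable_sets[OF m1 S] by (simp add: vimage_def Int_def conj_commute)
  have s1': "{\<omega> \<in> space (iid I1 Q). (\<lambda>j\<in>{..<n}. \<omega> (j, \<kappa> j)) \<in> S} \<in> sets (iid I1 Q)"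
    using measurable_sets[OF m1' S] by (simp add: vimage_def Int_def conj_commute)
  have s2: "{\<omega> \<in> space (iid I Q). \<forall>i\<in>J. \<omega> i \<in> U} \<in> sets (iid I Q)"
  proof -
    have "{\<omega> \<in> space (iid I Q). \<omega> i \<in> U} \<in> sets (iid I Q)" if "i \<in> J" for i
      using measurable_sets[OF measurable_component_singleton[of i I "\<lambda>_. Q"] U] that JI
      by (auto simp: vimage_def Int_def conj_commute)
    then show ?thesis using finJ by (intro sets.sets_Collect_finite_All) auto
  qed
  show B: "B \<in> sets (iid I Q)" unfolding Bsets using s1 s2 by (rule sets.Int)
  define S1 where "S1 = {\<omega> \<in> space (iid I1 Q). (\<lambda>j\<in>{..<n}. \<omega> (j, \<kappa> j)) \<in> S}"
  define w where "w i = (\<lambda>q. if i \<in> J then indicator U q else (1::ennreal))" for i :: "nat \<times> nat"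
  have w[measurable]: "w i \<in> borel_measurable Q" for i unfolding w_def by measurable
  have split: "indicator B (merge I1 I2 (x, y)) = indicator S1 x * (\<Prod>i\<in>I2. w i (y i))"
    if x: "x \<in> space (iid I1 Q)" and y: "y \<in> space (iid I2 Q)" for x y
  proof -
    have xy: "merge I1 I2 (x, y) \<in> space (iid I Q)"
      using x y I(1) by (auto simp: space_PiM I(4) merge_def PiE_def Pi_def extensional_def)
    have "(\<lambda>j\<in>{..<n}. merge I1 I2 (x, y) (j, \<kappa> j)) = (\<lambda>j\<in>{..<n}. x (j, \<kappa> j))"
      by (auto simp: I1_def merge_def)
    moreover have "(\<forall>i\<in>J. merge I1 I2 (x, y) i \<in> U) \<longleftrightarrow> (\<forall>i\<in>J. y i \<in> U)"
      using I(1,5) by (intro ball_cong refl) (auto simp: merge_def)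
    ultimately have "merge I1 I2 (x, y) \<in> B \<longleftrightarrow> x \<in> S1 \<and> (\<forall>i\<in>J. y i \<in> U)"
      using xy x by (auto simp: Bsets S1_def)
    moreover have "(\<Prod>i\<in>I2. w i (y i)) = (if \<forall>i\<in>J. y i \<in> U then 1 else 0)"
      using I(3,5) by (auto simp: w_def prod_zero_iff indicator_def intro!: prod.neutral)
    ultimately show ?thesis by (auto simp: indicator_def)
  qed
  have "emeasure (iid I Q) B = (\<integral>\<^sup>+ \<omega>. indicator B \<omega> \<partial>Pi\<^sub>M (I1 \<union> I2) (\<lambda>_. Q))"
    using B by (simp add: I(4)[symmetric])
  also have "\<dots> = (\<integral>\<^sup>+ x. \<integral>\<^sup>+ y. indicator B (merge I1 I2 (x, y)) \<partial>iid I2 Q \<partial>iid I1 Q)"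
    using B I by (intro product_nn_integral_fold) (auto intro!: borel_measurable_indicator)
  also have "\<dots> = (\<integral>\<^sup>+ x. \<integral>\<^sup>+ y. indicator S1 x * (\<Prod>i\<in>I2. w i (y i)) \<partial>iid I2 Q \<partial>iid I1 Q)"
    by (intro nn_integral_cong) (simp add: split)
  also have "\<dots> = (\<integral>\<^sup>+ x. indicator S1 x * (\<integral>\<^sup>+ y. (\<Prod>i\<in>I2. w i (y i)) \<partial>iid I2 Q) \<partial>iid I1 Q)"
    by (intro nn_integral_cong nn_integral_cmult) (auto intro!: borel_measurable_prod)
  also have "\<dots> = emeasure (iid I1 Q) S1 * (\<integral>\<^sup>+ y. (\<Prod>i\<in>I2. w i (y i)) \<partial>iid I2 Q)"
    using s1' by (simp add: S1_def nn_integral_multc)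
  also have "(\<integral>\<^sup>+ y. (\<Prod>i\<in>I2. w i (y i)) \<partial>iid I2 Q) = (\<Prod>i\<in>I2. integral\<^sup>N Q (w i))"
    using I(3) by (intro product_nn_integral_prod) auto
  also have "\<dots> = (\<Prod>i\<in>I2. if i \<in> J then emeasure Q U else 1)"
    by (intro prod.cong) (auto simp: w_def Q.emeasure_space_1)
  also have "\<dots> = (\<Prod>i\<in>J. emeasure Q U)"
    using I(3,5) by (simp add: prod.If_cases Int_absorb1)
  also have "\<dots> = (\<Prod>j<n. emeasure Q U ^ \<kappa> j)"
    unfolding J_def using prod.Sigma[of "{..<n}" "\<lambda>j. {..<\<kappa> j}" "\<lambda>_ _. emeasure Q U"] by simp
  also have "emeasure (iid I1 Q) S1 = emeasure (iid {..<n} Q) S"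
  proof -
    have "distr (iid I1 Q) (iid {..<n} Q) (\<lambda>\<omega>. \<lambda>j\<in>{..<n}. \<omega> (j, \<kappa> j)) = iid {..<n} Q"
      using distr_PiM_reindex[of I1 "\<lambda>_. Q" "\<lambda>j. (j, \<kappa> j)" "{..<n}"] Q
      by (auto simp: I1_def inj_on_def)
    then have "emeasure (iid {..<n} Q) S = emeasure (distr (iid I1 Q) (iid {..<n} Q) (\<lambda>\<omega>. \<lambda>j\<in>{..<n}. \<omega> (j, \<kappa> j))) S" by simp
    also have "\<dots> = emeasure (iid I1 Q) ((\<lambda>\<omega>. \<lambda>j\<in>{..<n}. \<omega> (j, \<kappa> j)) -` S \<inter> space (iid I1 Q))"
      by (rule emeasure_distr[OF m1' S])
    also have "(\<lambda>\<omega>. \<lambda>j\<in>{..<n}. \<omega> (j, \<kappa> j)) -` S \<inter> space (iid I1 Q) = S1" by (auto simp: S1_def)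
    finally show ?thesis by simp
  qed
  finally show "emeasure (iid I Q) B = emeasure (iid {..<n} Q) S * (\<Prod>j<n. emeasure Q U ^ \<kappa> j)" .
qed

text \<open>Union bound over all \<kappa>: the sum of the products factorises into \<open>n\<close>
  geometric series, bounded independently of the number \<open>K\<close> of draws. For
  \<open>u\<close> close to 1 - 1 / card Z the factor 1 / (1 - u) is the mean waiting time, about
  card Z.\<close>

proposition emeasure_first_hits_le:
  fixes Q :: "'q measure" and n K :: nat
  assumes Q: "prob_space Q" and S: "S \<in> sets (iid {..<n} Q)" and U: "U \<in> sets Q"
    and u: "emeasure Q U \<le> ennreal u" "0 \<le> u" "u < 1"
  defines "I \<equiv> {..<n} \<times> {..<K}"
  defines "B \<equiv> {\<omega> \<in> space (iid I Q). \<exists>\<kappa>\<in>tuples n {..<K}.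
      (\<lambda>j\<in>{..<n}. \<omega> (j, \<kappa> j)) \<in> S \<and> (\<forall>j<n. \<forall>l<\<kappa> j. \<omega> (j, l) \<in> U)}"
  shows "B \<in> sets (iid I Q)"
    and "emeasure (iid I Q) B \<le> emeasure (iid {..<n} Q) S * ennreal ((1 / (1 - u)) ^ n)"
proof -
  define B' where "B' \<kappa> = {\<omega> \<in> space (iid I Q). (\<lambda>j\<in>{..<n}. \<omega> (j, \<kappa> j)) \<in> S \<and> (\<forall>j<n. \<forall>l<\<kappa> j. \<omega> (j, l) \<in> U)}" for \<kappa> :: "nat \<Rightarrow> nat"
  define P where "P = tuples n {..<K}"
  have P: "finite P" by (simp add: P_def finite_PiE)
  have B: "B = (\<Union>\<kappa>\<in>P. B' \<kappa>)" by (auto simp: B_def B'_def P_def)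
  note sp = emeasure_PiM_event_split[OF Q S U, where K=K, folded I_def P_def, folded B'_def]
  show "B \<in> sets (iid I Q)" unfolding B using P sp(1) by (intro sets.finite_UN) auto
  have "emeasure (iid I Q) B \<le> (\<Sum>\<kappa>\<in>P. emeasure (iid I Q) (B' \<kappa>))"
    unfolding B using P sp(1) by (intro emeasure_subadditive_finite) auto
  also have "\<dots> = (\<Sum>\<kappa>\<in>P. emeasure (iid {..<n} Q) S * (\<Prod>j<n. emeasure Q U ^ \<kappa> j))"
    by (intro sum.cong sp(2)) auto
  also have "\<dots> \<le> (\<Sum>\<kappa>\<in>P. emeasure (iid {..<n} Q) S * (\<Prod>j<n. ennreal (u ^ \<kappa> j)))"
  proof (intro sum_mono mult_left_mono prod_mono_ennreal)
    fix \<kappa> :: "nat \<Rightarrow> nat" and j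
    show "emeasure Q U ^ \<kappa> j \<le> ennreal (u ^ \<kappa> j)"
      using power_mono[OF u(1), of "\<kappa> j"] u(2) by (simp add: ennreal_power)
  qed auto
  also have "\<dots> = emeasure (iid {..<n} Q) S * (\<Sum>\<kappa>\<in>P. \<Prod>j<n. ennreal (u ^ \<kappa> j))"
    by (simp add: sum_distrib_left)
  also have "(\<Sum>\<kappa>\<in>P. \<Prod>j<n. ennreal (u ^ \<kappa> j)) = ennreal (\<Sum>\<kappa>\<in>P. \<Prod>j<n. u ^ \<kappa> j)"
    using u by (subst sum_ennreal[symmetric]) (auto simp: prod_ennreal intro!: prod_nonneg)
  also have "(\<Sum>\<kappa>\<in>P. \<Prod>j<n. u ^ \<kappa> j) = (\<Prod>j<n. \<Sum>l<K. u ^ l)"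
    unfolding P_def by (rule prod_sum_PiE[symmetric]) auto
  also have "emeasure (iid {..<n} Q) S * ennreal (\<Prod>j<n. \<Sum>l<K. u ^ l) \<le> emeasure (iid {..<n} Q) S * ennreal (\<Prod>j<n. 1 / (1 - u))"
    using u by (intro mult_left_mono ennreal_leI prod_mono) (auto intro!: sum_powers_mult_le_1 sum_nonneg)
  finally show "emeasure (iid I Q) B \<le> emeasure (iid {..<n} Q) S * ennreal ((1 / (1 - u)) ^ n)"
    by simp
qed

section \<open>Random pairs of a function and a threshold\<close>

definition threshold_measure :: "'z set \<Rightarrow> ('z \<times> real) measure" where
  "threshold_measure Z = measure_pmf (pmf_of_set Z) \<Otimes>\<^sub>M uniform_measure lborel {0..1}"

lemma prob_space_threshold_measure: "prob_space (threshold_measure Z)"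
proof -
  interpret A: prob_space "uniform_measure lborel {0..1::real}"
    by (intro prob_space_uniform_measure) auto
  interpret pair_prob_space "measure_pmf (pmf_of_set Z)" "uniform_measure lborel {0..1::real}" ..
  show ?thesis unfolding threshold_measure_def by (rule prob_space_axioms)
qed

lemma sets_threshold_measure [measurable_cong]: "sets (threshold_measure Z) = sets (count_space UNIV \<Otimes>\<^sub>M borel)"
  unfolding threshold_measure_def by (intro sets_pair_measure_cong) auto

lemma space_threshold_measure [simp]: "space (threshold_measure Z) = UNIV"
  by (simp add: threshold_measure_def space_pair_measure)

lemma nn_integral_threshold_measure:
  assumes Z: "finite Z" "Z \<noteq> {}" and f[measurable]: "f \<in> borel_measurable (count_space UNIV \<Otimes>\<^sub>M borel)"
  shows "(\<integral>\<^sup>+ q. f q \<partial>threshold_measure Z) = ennreal (1 / card Z) * (\<Sum>z\<in>Z. \<integral>\<^sup>+ h. f (z, h) * indicator {0..1} h \<partial>lborel)"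
proof -
  interpret A: prob_space "uniform_measure lborel {0..1::real}"
    by (intro prob_space_uniform_measure) auto
  have "(\<integral>\<^sup>+ q. f q \<partial>threshold_measure Z) = (\<integral>\<^sup>+ z. \<integral>\<^sup>+ h. f (z, h) \<partial>uniform_measure lborel {0..1} \<partial>measure_pmf (pmf_of_set Z))"
    unfolding threshold_measure_def
    by (rule A.nn_integral_fst[symmetric]) (use f in \<open>simp cong: measurable_cong_sets sets_pair_measure_cong\<close>)
  also have "\<dots> = (\<Sum>z\<in>Z. (\<integral>\<^sup>+ h. f (z, h) \<partial>uniform_measure lborel {0..1}) * ennreal (1 / card Z))"
    using Z by (subst nn_integral_measure_pmf_finite) (auto simp: )
  also have "\<dots> = ennreal (1 / card Z) * (\<Sum>z\<in>Z. \<integral>\<^sup>+ h. f (z, h) \<partial>uniform_measure lborel {0..1})"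
    by (simp add: sum_distrib_left mult.commute)
  finally show ?thesis
    by (simp add: nn_integral_uniform_measure divide_ennreal_def)
qed

text \<open>In the application the \<open>b z\<close> sum to nearly 1, so a draw fails with
  probability about 1 - 1 / card Z, whatever the point. A negative \<open>b z\<close> makes {b z..1}
  longer than the unit interval, hence an inequality.\<close>

lemma emeasure_threshold_ge_le:
  assumes Z: "finite Z" "Z \<noteq> {}" and b: "\<And>z. z \<in> Z \<Longrightarrow> b z \<le> 1"
  shows "{q. b (fst q) \<le> snd q} \<in> sets (threshold_measure Z)"
    and "emeasure (threshold_measure Z) {q. b (fst q) \<le> snd q} \<le> ennreal (1 - (\<Sum>z\<in>Z. b z) / card Z)"
proof -
  have m: "{q. b (fst q) \<le> snd q} \<in> sets (count_space UNIV \<Otimes>\<^sub>M (borel :: real measure))"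
  proof -
    have "(\<lambda>q. b (fst q)) \<in> borel_measurable (count_space UNIV \<Otimes>\<^sub>M (borel :: real measure))"
      by (rule measurable_compose[OF measurable_fst]) simp
    then have "{q \<in> space (count_space UNIV \<Otimes>\<^sub>M (borel :: real measure)). b (fst q) \<le> snd q} \<in> sets (count_space UNIV \<Otimes>\<^sub>M borel)"
      by (intro borel_measurable_le measurable_snd)
    then show ?thesis by (simp add: space_pair_measure)
  qed
  then show m': "{q. b (fst q) \<le> snd q} \<in> sets (threshold_measure Z)" by (simp add: sets_threshold_measure)
  have "emeasure (threshold_measure Z) {q. b (fst q) \<le> snd q} = (\<integral>\<^sup>+ q. indicator {q. b (fst q) \<le> snd q} q \<partial>threshold_measure Z)"
    using m' by simp
  also have "\<dots> = ennreal (1 / card Z) * (\<Sum>z\<in>Z. \<integral>\<^sup>+ h. indicator {q. b (fst q) \<le> snd q} (z, h) * indicator {0..1} h \<partial>lborel)"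
    using Z m by (intro nn_integral_threshold_measure) auto
  also have "\<dots> \<le> ennreal (1 / card Z) * (\<Sum>z\<in>Z. ennreal (1 - b z))"
  proof (intro mult_left_mono sum_mono)
    fix z assume z: "z \<in> Z"
    have "(\<integral>\<^sup>+ h. indicator {q. b (fst q) \<le> snd q} (z, h) * indicator {0..1} h \<partial>lborel) \<le> (\<integral>\<^sup>+ h. indicator {b z..1} h \<partial>lborel)"
      by (intro nn_integral_mono) (auto simp: indicator_def)
    also have "\<dots> = ennreal (1 - b z)" using b[OF z] by simp
    finally show "(\<integral>\<^sup>+ h. indicator {q. b (fst q) \<le> snd q} (z, h) * indicator {0..1} h \<partial>lborel) \<le> ennreal (1 - b z)" .
  qed auto
  also have "\<dots> = ennreal (1 / card Z * (\<Sum>z\<in>Z. 1 - b z))"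
    using b by (simp add: sum_ennreal ennreal_mult'[symmetric])
  also have "1 / card Z * (\<Sum>z\<in>Z. 1 - b z) = 1 - (\<Sum>z\<in>Z. b z) / card Z"
    using Z by (simp add: sum_subtractf field_simps)
  finally show "emeasure (threshold_measure Z) {q. b (fst q) \<le> snd q} \<le> ennreal (1 - (\<Sum>z\<in>Z. b z) / card Z)" .
qed

text \<open>Dropping the constraint that the thresholds lie in the unit interval only enlarges the
  integral. Probabilities thus turn into Lebesgue volumes, to which the slab estimates apply, with a
  weight 1 / card Z for each independent choice of \<open>z\<close>.\<close>

lemma nn_integral_PiM_threshold_le:
  assumes Z: "finite Z" "Z \<noteq> {}"
    and f: "f \<in> borel_measurable (Pi\<^sub>M {..<n} (\<lambda>_. count_space UNIV \<Otimes>\<^sub>M (borel :: real measure)))"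
  shows "(\<integral>\<^sup>+ \<omega>. f \<omega> \<partial>iid {..<n} (threshold_measure Z))
    \<le> ennreal ((1 / card Z) ^ n) * (\<Sum>\<zeta>\<in>tuples n Z. \<integral>\<^sup>+ h. f (\<lambda>j\<in>{..<n}. (\<zeta> j, h j)) \<partial>leb n)"
  using f
proof (induction n arbitrary: f)
  case 0
  then show ?case by (simp add: nn_integral_empty product_sigma_finite_def restrict_def space_PiM PiM_empty nn_integral_count_space_finite)
next
  case (Suc n)
  interpret Q: prob_space "threshold_measure Z" by (rule prob_space_threshold_measure)
  interpret P: product_sigma_finite "\<lambda>_::nat. threshold_measure Z"
    by (intro product_sigma_finite.intro Q.sigma_finite_measure_axioms)
  interpret L: product_sigma_finite "\<lambda>_::nat. lborel :: real measure" by standard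
  let ?QQ = "\<lambda>k::nat. Pi\<^sub>M {..<k} (\<lambda>_. count_space (UNIV::'a set) \<Otimes>\<^sub>M (borel :: real measure))"
  have f: "f \<in> borel_measurable (Pi\<^sub>M (insert n {..<n}) (\<lambda>_. count_space (UNIV::'a set) \<Otimes>\<^sub>M (borel :: real measure)))"
    using Suc.prems by (simp add: lessThan_Suc)
  have fQ: "f \<in> borel_measurable (iid (insert n {..<n}) (threshold_measure Z))"
    using f by (simp cong: measurable_cong_sets sets_PiM_cong add: sets_threshold_measure)
  \<comment> \<open>Bound for the first \<open>n\<close> draws while the last draw is frozen at
    \<open>q\<close>; measurability in \<open>q\<close> has to be secured before integrating over
    it.\<close>
  define F where "F = (\<lambda>q. \<Sum>\<zeta>\<in>tuples n Z. \<integral>\<^sup>+ h. f ((\<lambda>j\<in>{..<n}. (\<zeta> j, h j))(n := q)) \<partial>leb n)"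
  have upd: "(\<lambda>p. (\<lambda>j\<in>{..<n}. (\<zeta> j, snd p j))(n := fst p)) \<in> measurable ((count_space (UNIV::'a set) \<Otimes>\<^sub>M (borel::real measure)) \<Otimes>\<^sub>M leb n) (Pi\<^sub>M (insert n {..<n}) (\<lambda>_. count_space (UNIV::'a set) \<Otimes>\<^sub>M (borel :: real measure)))" for \<zeta>
  proof (rule measurable_fun_upd[where J="{..<n}"])
    show "(\<lambda>p. \<lambda>j\<in>{..<n}. (\<zeta> j, snd p j)) \<in> measurable ((count_space (UNIV::'a set) \<Otimes>\<^sub>M (borel::real measure)) \<Otimes>\<^sub>M leb n) (Pi\<^sub>M {..<n} (\<lambda>_. count_space (UNIV::'a set) \<Otimes>\<^sub>M (borel :: real measure)))"
    proof (intro measurable_restrict measurable_Pair)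
      fix j assume j: "j \<in> {..<n}"
      show "(\<lambda>p. snd p j) \<in> borel_measurable ((count_space (UNIV::'a set) \<Otimes>\<^sub>M (borel::real measure)) \<Otimes>\<^sub>M leb n)"
        using measurable_compose[OF measurable_snd measurable_component_singleton[OF j, of "\<lambda>_. lborel :: real measure"]] by simp
    qed auto
  qed (auto intro: measurable_fst)
  have finner: "(\<lambda>p. f ((\<lambda>j\<in>{..<n}. (\<zeta> j, snd p j))(n := fst p))) \<in> borel_measurable ((count_space (UNIV::'a set) \<Otimes>\<^sub>M (borel::real measure)) \<Otimes>\<^sub>M leb n)" for \<zeta>
    by (rule measurable_compose[OF upd f])
  interpret Ln: sigma_finite_measure "leb n"
    by (rule L.sigma_finite) auto
  have F: "F \<in> borel_measurable (count_space UNIV \<Otimes>\<^sub>M borel)"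
    unfolding F_def
    using Ln.borel_measurable_nn_integral_fst[OF finner] by (intro borel_measurable_sum) simp
  have "(\<integral>\<^sup>+ \<omega>. f \<omega> \<partial>iid {..<Suc n} (threshold_measure Z)) = (\<integral>\<^sup>+ q. \<integral>\<^sup>+ \<omega>. f (fun_upd \<omega> n q) \<partial>iid {..<n} (threshold_measure Z) \<partial>threshold_measure Z)"
    unfolding lessThan_Suc by (rule P.product_nn_integral_insert_rev[OF _ _ fQ]) auto
  also have "\<dots> \<le> (\<integral>\<^sup>+ q. ennreal ((1 / card Z) ^ n) * F q \<partial>threshold_measure Z)"
  proof (rule nn_integral_mono)
    fix q :: "'a \<times> real"
    have "(\<lambda>\<omega>. f (fun_upd \<omega> n q)) \<in> borel_measurable (?QQ n)"
      by (rule measurable_compose[OF measurable_fun_upd[where J="{..<n}"] f]) (auto simp: space_pair_measure)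
    then show "(\<integral>\<^sup>+ \<omega>. f (fun_upd \<omega> n q) \<partial>iid {..<n} (threshold_measure Z)) \<le> ennreal ((1 / card Z) ^ n) * F q"
      unfolding F_def by (rule Suc.IH)
  qed
  also have "\<dots> = ennreal ((1 / card Z) ^ n) * (\<integral>\<^sup>+ q. F q \<partial>threshold_measure Z)"
    using F by (intro nn_integral_cmult) (simp cong: measurable_cong_sets add: sets_threshold_measure)
  finally have A: "(\<integral>\<^sup>+ \<omega>. f \<omega> \<partial>iid {..<Suc n} (threshold_measure Z)) \<le> ennreal ((1 / card Z) ^ n) * (\<integral>\<^sup>+ q. F q \<partial>threshold_measure Z)" .
  have "(\<integral>\<^sup>+ q. F q \<partial>threshold_measure Z) \<le> ennreal (1 / card Z) * (\<Sum>z\<in>Z. \<integral>\<^sup>+ h. F (z, h) \<partial>lborel)"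
    unfolding nn_integral_threshold_measure[OF Z F]
    by (intro mult_left_mono sum_mono nn_integral_mono) (auto simp: indicator_def)
  also have "(\<Sum>z\<in>Z. \<integral>\<^sup>+ h. F (z, h) \<partial>lborel) = (\<Sum>z\<in>Z. \<Sum>\<zeta>\<in>tuples n Z. \<integral>\<^sup>+ y. \<integral>\<^sup>+ h. f ((\<lambda>j\<in>{..<n}. (\<zeta> j, h j))(n := (z, y))) \<partial>leb n \<partial>lborel)"
    unfolding F_def
  proof (intro sum.cong refl nn_integral_sum)
    fix z \<zeta>
    have "(\<lambda>y. \<integral>\<^sup>+ h. f ((\<lambda>j\<in>{..<n}. (\<zeta> j, snd ((z, y), h) j))(n := fst ((z, y), h))) \<partial>leb n) \<in> borel_measurable borel"
      by (rule measurable_compose[OF _ Ln.borel_measurable_nn_integral_fst[OF finner]]) auto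
    then show "(\<lambda>y. \<integral>\<^sup>+ h. f ((\<lambda>j\<in>{..<n}. (\<zeta> j, h j))(n := (z, y))) \<partial>leb n) \<in> borel_measurable lborel"
      by simp
  qed
  also have "\<dots> = (\<Sum>z\<in>Z. \<Sum>\<zeta>\<in>tuples n Z. \<integral>\<^sup>+ h. f (\<lambda>j\<in>{..<Suc n}. ((\<zeta>(n := z)) j, h j)) \<partial>leb (Suc n))"
  proof (intro sum.cong refl)
    fix z \<zeta>
    have m: "(\<lambda>h. f (\<lambda>j\<in>{..<Suc n}. ((\<zeta>(n := z)) j, h j))) \<in> borel_measurable (Pi\<^sub>M (insert n {..<n}) (\<lambda>_. lborel))"
      unfolding lessThan_Suc
    proof (rule measurable_compose[OF measurable_restrict f])
      fix j assume j: "j \<in> insert n {..<n}"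
      show "(\<lambda>h. ((\<zeta>(n := z)) j, h j)) \<in> measurable (Pi\<^sub>M (insert n {..<n}) (\<lambda>_. lborel :: real measure)) (count_space UNIV \<Otimes>\<^sub>M borel)"
        using measurable_component_singleton[OF j, of "\<lambda>_. lborel :: real measure"]
        by (intro measurable_Pair) auto
    qed
    have "(\<integral>\<^sup>+ h. f (\<lambda>j\<in>{..<Suc n}. ((\<zeta>(n := z)) j, h j)) \<partial>leb (Suc n))
      = (\<integral>\<^sup>+ y. \<integral>\<^sup>+ h. f (\<lambda>j\<in>{..<Suc n}. ((\<zeta>(n := z)) j, (h(n := y)) j)) \<partial>leb n \<partial>lborel)"
      unfolding lessThan_Suc[of n] by (rule L.product_nn_integral_insert_rev) (use m in \<open>auto simp: lessThan_Suc\<close>)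
    also have "\<dots> = (\<integral>\<^sup>+ y. \<integral>\<^sup>+ h. f ((\<lambda>j\<in>{..<n}. (\<zeta> j, h j))(n := (z, y))) \<partial>leb n \<partial>lborel)"
    proof -
      have "(\<lambda>j\<in>{..<Suc n}. ((\<zeta>(n := z)) j, (h(n := y)) j)) = (\<lambda>j\<in>{..<n}. (\<zeta> j, h j))(n := (z, y))" for h and y :: real
        by auto
      then show ?thesis by simp
    qed
    finally show "(\<integral>\<^sup>+ y. \<integral>\<^sup>+ h. f ((\<lambda>j\<in>{..<n}. (\<zeta> j, h j))(n := (z, y))) \<partial>leb n \<partial>lborel) = (\<integral>\<^sup>+ h. f (\<lambda>j\<in>{..<Suc n}. ((\<zeta>(n := z)) j, h j)) \<partial>leb (Suc n))" ..
  qed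
  also have "\<dots> = (\<Sum>\<zeta>\<in>tuples (Suc n) Z. \<integral>\<^sup>+ h. f (\<lambda>j\<in>{..<Suc n}. (\<zeta> j, h j)) \<partial>leb (Suc n))"
    unfolding lessThan_Suc PiE_insert_eq
    by (subst sum.reindex[OF inj_combinator]) (auto simp: case_prod_beta sum.cartesian_product)
  finally have B: "(\<integral>\<^sup>+ q. F q \<partial>threshold_measure Z) \<le> ennreal (1 / card Z) * (\<Sum>\<zeta>\<in>tuples (Suc n) Z. \<integral>\<^sup>+ h. f (\<lambda>j\<in>{..<Suc n}. (\<zeta> j, h j)) \<partial>leb (Suc n))" .
  have "ennreal ((1 / card Z) ^ Suc n) = ennreal ((1 / card Z) ^ n) * ennreal (1 / card Z)"
    by (subst ennreal_mult[symmetric]) (auto simp: mult.commute)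
  then show ?case
    using order_trans[OF A mult_left_mono[OF B]] by (simp only: mult.assoc zero_le)
qed

section \<open>The trigonometric partition of unity\<close>

lemma bounded_linear_apply_bcontfun: "bounded_linear (\<lambda>x::pt. apply_bcontfun x i)"
proof (rule bounded_linear_intro[where K=1])
  show "norm (apply_bcontfun x i) \<le> norm x * 1" for x :: pt
    using norm_bounded[of x i] by simp
qed auto

lift_definition coord_blinfun :: "nat \<Rightarrow> pt \<Rightarrow>\<^sub>L real" is "\<lambda>i x. apply_bcontfun x i"
  by (rule bounded_linear_apply_bcontfun)

lemma continuous_on_apply_coord [continuous_intros]:
  "continuous_on S f \<Longrightarrow> continuous_on S (\<lambda>x. apply_bcontfun (f x :: pt) i)"
  by (rule bounded_linear.continuous_on[OF bounded_linear_apply_bcontfun])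

definition unit_pt :: "nat \<Rightarrow> pt" where
  "unit_pt i = Bcontfun (\<lambda>j. if j = i then 1 else 0)"

definition pt_of :: "nat \<Rightarrow> (nat \<Rightarrow> real) \<Rightarrow> pt" where
  "pt_of N x = (\<Sum>i<N. x i *\<^sub>R unit_pt i)"

lemma apply_unit_pt [simp]: "apply_bcontfun (unit_pt i) j = (if j = i then 1 else 0)"
proof -
  have "(\<lambda>j. if j = i then 1 else 0 :: real) \<in> bcontfun"
    by (intro bcontfun_normI[where b=1]) auto
  then show ?thesis by (simp add: unit_pt_def Bcontfun_inverse)
qed

lemma apply_sum_pt: "apply_bcontfun (\<Sum>i\<in>A. f i :: pt) j = (\<Sum>i\<in>A. apply_bcontfun (f i) j)"
  by (induction A rule: infinite_finite_induct) auto

lemma apply_pt_of [simp]: "apply_bcontfun (pt_of N x) j = (if j < N then x j else 0)"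
  by (simp add: pt_of_def apply_sum_pt if_distrib[of "\<lambda>y. _ * y"] cong: if_cong)

lemma pt_of_in_Rsp [simp]: "pt_of N x \<in> Rsp N"
  by (simp add: Rsp_def)

lemma pt_of_apply: "x \<in> Rsp N \<Longrightarrow> pt_of N (apply_bcontfun x) = x"
  by (intro bcontfun_eqI) (auto simp: Rsp_def)

lemma continuous_on_pt_of: "continuous_on S (pt_of N)"
  unfolding pt_of_def by (intro continuous_intros)

lemma subspace_Rsp: "subspace (Rsp N)"
  by (auto simp: subspace_def Rsp_def)

lemma Rsp_diff: "x \<in> Rsp N \<Longrightarrow> y \<in> Rsp N \<Longrightarrow> x - y \<in> Rsp N"
  by (rule subspace_diff[OF subspace_Rsp])

lemma eucl_norm_dot: "eucl_norm N x = sqrt (dot N (apply_bcontfun x) (apply_bcontfun x))"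
  by (simp add: eucl_norm_def dot_def power2_eq_square)

lemma abs_coord_le_norm: "\<bar>apply_bcontfun (x::pt) i\<bar> \<le> norm x"
  using norm_bounded[of x i] by simp

lemma norm_le_coord: "(\<And>i. \<bar>apply_bcontfun (x::pt) i\<bar> \<le> b) \<Longrightarrow> norm x \<le> b"
  by (rule norm_bound) simp

lemma abs_coord_le_eucl: "i < N \<Longrightarrow> \<bar>x i\<bar> \<le> sqrt (dot N x x)"
proof -
  assume "i < N"
  then have "(x i)\<^sup>2 \<le> dot N x x"
    unfolding dot_def power2_eq_square by (intro member_le_sum) auto
  then show ?thesis by (metis real_sqrt_abs real_sqrt_le_iff)
qed

lemma norm_le_eucl: "x \<in> Rsp N \<Longrightarrow> norm x \<le> eucl_norm N x"
  unfolding eucl_norm_dot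
proof (rule norm_le_coord)
  fix i assume x: "x \<in> Rsp N"
  show "\<bar>apply_bcontfun x i\<bar> \<le> sqrt (dot N (apply_bcontfun x) (apply_bcontfun x))"
  proof (cases "i < N")
    case True then show ?thesis by (rule abs_coord_le_eucl)
  next
    case False
    then have "apply_bcontfun x i = 0" using x by (simp add: Rsp_def)
    then show ?thesis by simp
  qed
qed

text \<open>The dependence on \<open>N\<close> does no harm: the factor meets only error terms that
  are made small after \<open>N\<close> is fixed, and a bound whose finiteness is all that
  counts.\<close>

lemma eucl_le_norm: "eucl_norm N x \<le> sqrt (real N) * norm x"
proof -
  have "dot N (apply_bcontfun x) (apply_bcontfun x) \<le> (\<Sum>i<N. (norm x)\<^sup>2)"
    unfolding dot_def power2_eq_square[symmetric]
    by (intro sum_mono) (use abs_coord_le_norm[of x] in \<open>simp add: abs_le_square_iff[symmetric]\<close>)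
  then have "eucl_norm N x \<le> sqrt (real N * (norm x)\<^sup>2)"
    unfolding eucl_norm_dot by (intro real_sqrt_le_mono) simp
  then show ?thesis by (simp add: real_sqrt_mult)
qed

lemma eucl_norm_nonneg [simp]: "eucl_norm N x \<ge> 0"
  by (simp add: eucl_norm_dot)

text \<open>Two-point form of the derivative: points of a small covering set are compared with each
  other, while the linear map is taken at a fixed nearby point \<open>p\<close>.\<close>

definition strict_deriv :: "('a::real_normed_vector \<Rightarrow> 'b::real_normed_vector) \<Rightarrow> ('a \<Rightarrow> 'b) \<Rightarrow> 'a \<Rightarrow> 'a set \<Rightarrow> bool" where
  "strict_deriv f D p S \<longleftrightarrow> (\<forall>\<epsilon>>0. \<exists>\<rho>>0. \<forall>x\<in>ball p \<rho> \<inter> S. \<forall>y\<in>ball p \<rho> \<inter> S.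
      norm (f x - f y - D (x - y)) \<le> \<epsilon> * norm (x - y))"

lemma strict_deriv_C1:
  fixes f :: "'a::real_normed_vector \<Rightarrow> 'b::real_normed_vector" and F :: "'a \<Rightarrow> 'a \<Rightarrow>\<^sub>L 'b"
  assumes f: "\<And>x. (f has_derivative blinfun_apply (F x)) (at x)" and F: "continuous_on UNIV F"
  shows "strict_deriv f (F p) p UNIV"
  unfolding strict_deriv_def
proof (intro allI impI)
  fix \<epsilon> :: real assume "\<epsilon> > 0"
  with F obtain \<rho> where \<rho>: "\<rho> > 0" "\<And>x. dist x p < \<rho> \<Longrightarrow> dist (F x) (F p) < \<epsilon>"
    by (metis UNIV_I continuous_on_iff)
  have "norm (f x - f y - F p (x - y)) \<le> \<epsilon> * norm (x - y)" if xy: "x \<in> ball p \<rho>" "y \<in> ball p \<rho>" for x y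
  proof -
    have "norm (f x - f y - F p (x - y)) \<le> norm (x - y) * \<epsilon>"
    proof (rule differentiable_bound_linearization[where S="ball p \<rho>" and f'="\<lambda>x. blinfun_apply (F x)"])
      show "y + t *\<^sub>R (x - y) \<in> ball p \<rho>" if "t \<in> {0..1}" for t
      proof -
        have "y + t *\<^sub>R (x - y) = (1 - t) *\<^sub>R y + t *\<^sub>R x" by (simp add: algebra_simps)
        then show ?thesis using convexD[OF convex_ball xy(2) xy(1), of "1 - t" t] that by simp
      qed
      show "(f has_derivative blinfun_apply (F u)) (at u within ball p \<rho>)" for u
        by (rule has_derivative_at_withinI[OF f])
      fix u assume "u \<in> ball p \<rho>"
      then have "norm (F u - F p) < \<epsilon>" using \<rho>(2)[of u] by (simp add: dist_commute dist_norm norm_minus_commute)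
      moreover have "norm (F u - F p) = onorm (blinfun_apply (F u) - blinfun_apply (F p))"
        by (simp add: norm_blinfun.rep_eq minus_blinfun.rep_eq fun_diff_def)
      ultimately show "onorm (blinfun_apply (F u) - blinfun_apply (F p)) \<le> \<epsilon>" by simp
    qed (use \<rho> in simp)
    then show ?thesis by (simp add: mult.commute)
  qed
  with \<rho>(1) show "\<exists>\<rho>>0. \<forall>x\<in>ball p \<rho> \<inter> UNIV. \<forall>y\<in>ball p \<rho> \<inter> UNIV. norm (f x - f y - F p (x - y)) \<le> \<epsilon> * norm (x - y)"
    by auto
qed

section \<open>Products of sines and cosines and their derivatives\<close>

definition trig_factor :: "nat set \<Rightarrow> nat \<Rightarrow> real \<Rightarrow> real" where
  "trig_factor z i t = (if i \<in> z then sin t else cos t)"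

definition trig_factor' :: "nat set \<Rightarrow> nat \<Rightarrow> real \<Rightarrow> real" where
  "trig_factor' z i t = (if i \<in> z then cos t else - sin t)"

definition wave :: "real \<Rightarrow> nat \<Rightarrow> nat set \<Rightarrow> pt \<Rightarrow> real" where
  "wave \<omega> N z x = (\<Prod>i<N. trig_factor z i (\<omega> * apply_bcontfun x i))"

text \<open>The product rule applied to the last factor. The values are bounded linear maps, so that
  continuity in the base point refers to the operator norm, as \<open>strict_deriv_C1\<close>
  requires.\<close>

primrec dwave :: "real \<Rightarrow> nat \<Rightarrow> nat set \<Rightarrow> pt \<Rightarrow> pt \<Rightarrow>\<^sub>L real" where
  "dwave \<omega> 0 z x = 0"
| "dwave \<omega> (Suc N) z x = trig_factor z N (\<omega> * apply_bcontfun x N) *\<^sub>R dwave \<omega> N z x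
     + (wave \<omega> N z x * (trig_factor' z N (\<omega> * apply_bcontfun x N) * \<omega>)) *\<^sub>R coord_blinfun N"

lemma wave_Suc: "wave \<omega> (Suc N) z x = wave \<omega> N z x * trig_factor z N (\<omega> * apply_bcontfun x N)"
  by (simp add: wave_def)

lemma wave_0 [simp]: "wave \<omega> 0 z x = 1"
  by (simp add: wave_def)

lemma continuous_on_trig_factor [continuous_intros]:
  fixes f :: "pt \<Rightarrow> real"
  shows "continuous_on S f \<Longrightarrow> continuous_on S (\<lambda>x. trig_factor z i (f x))"
  by (cases "i \<in> z") (auto simp: trig_factor_def intro!: continuous_intros)

lemma continuous_on_trig_factor' [continuous_intros]:
  fixes f :: "pt \<Rightarrow> real"
  shows "continuous_on S f \<Longrightarrow> continuous_on S (\<lambda>x. trig_factor' z i (f x))"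
  by (cases "i \<in> z") (auto simp: trig_factor'_def intro!: continuous_intros)

lemma continuous_on_wave [continuous_intros]:
  fixes f :: "pt \<Rightarrow> pt"
  shows "continuous_on S f \<Longrightarrow> continuous_on S (\<lambda>x. wave \<omega> N z (f x))"
  unfolding wave_def by (intro continuous_intros)

lemma continuous_on_dwave: "continuous_on S (dwave \<omega> N z)"
proof (induction N)
  case (Suc N)
  then show ?case by (auto intro!: continuous_intros)
qed simp

lemma has_derivative_trig_factor:
  "((\<lambda>x::pt. trig_factor z i (\<omega> * apply_bcontfun x i)) has_derivative
    (\<lambda>u. trig_factor' z i (\<omega> * apply_bcontfun x i) * \<omega> * apply_bcontfun u i)) (at x)"
proof -
  have c: "((\<lambda>x::pt. apply_bcontfun x i) has_derivative (\<lambda>u. apply_bcontfun u i)) (at x)"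
    by (rule bounded_linear.has_derivative[OF bounded_linear_apply_bcontfun has_derivative_ident])
  show ?thesis
    by (cases "i \<in> z") (auto simp: trig_factor_def trig_factor'_def intro!: derivative_eq_intros c)
qed

lemma has_derivative_wave: "(wave \<omega> N z has_derivative blinfun_apply (dwave \<omega> N z x)) (at x)"
proof (induction N)
  case 0
  then show ?case by (simp add: wave_def[abs_def] zero_blinfun.rep_eq)
next
  case (Suc N)
  have "((\<lambda>x. wave \<omega> N z x * trig_factor z N (\<omega> * apply_bcontfun x N)) has_derivative
    (\<lambda>u. wave \<omega> N z x * (trig_factor' z N (\<omega> * apply_bcontfun x N) * \<omega> * apply_bcontfun u N)
      + dwave \<omega> N z x u * trig_factor z N (\<omega> * apply_bcontfun x N))) (at x)"
    by (rule has_derivative_mult[OF Suc has_derivative_trig_factor])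
  then show ?case
    by (simp add: wave_Suc[abs_def] plus_blinfun.rep_eq scaleR_blinfun.rep_eq coord_blinfun.rep_eq algebra_simps)
qed

lemma sum_Pow_lessThan_Suc:
  "(\<Sum>z\<in>Pow {..<Suc N}. F z) = (\<Sum>z\<in>Pow {..<N}. F z + F (insert N z))"
proof -
  have inj: "inj_on (insert N) (Pow {..<N})"
    by (auto simp: inj_on_def)
  have "Pow {..<Suc N} = Pow {..<N} \<union> insert N ` Pow {..<N}"
    by (simp add: lessThan_Suc Pow_insert)
  moreover have "Pow {..<N} \<inter> insert N ` Pow {..<N} = {}" by auto
  ultimately show ?thesis
    using inj by (simp add: sum.union_disjoint sum.reindex sum.distrib)
qed

lemma wave_cong: "(\<And>i. i < N \<Longrightarrow> i \<in> z \<longleftrightarrow> i \<in> z') \<Longrightarrow> wave \<omega> N z x = wave \<omega> N z' x"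
  by (simp add: wave_def trig_factor_def)

lemma dwave_cong: "(\<And>i. i < N \<Longrightarrow> i \<in> z \<longleftrightarrow> i \<in> z') \<Longrightarrow> dwave \<omega> N z x = dwave \<omega> N z' x"
  by (induction N) (auto simp: trig_factor_def trig_factor'_def wave_cong[of _ z z'])

lemma sum_wave_squares: "(\<Sum>z\<in>Pow {..<N}. (wave \<omega> N z x)\<^sup>2) = 1"
proof (induction N)
  case (Suc N)
  have "(wave \<omega> (Suc N) z x)\<^sup>2 + (wave \<omega> (Suc N) (insert N z) x)\<^sup>2 = (wave \<omega> N z x)\<^sup>2" if "z \<in> Pow {..<N}" for z
  proof -
    have "N \<notin> z" using that by auto
    moreover have "wave \<omega> N (insert N z) x = wave \<omega> N z x" by (rule wave_cong) auto
    ultimately show ?thesis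
      by (simp add: wave_Suc trig_factor_def power_mult_distrib distrib_left[symmetric])
  qed
  then show ?case using Suc by (simp add: sum_Pow_lessThan_Suc)
qed simp

text \<open>For a new coordinate \<open>N\<close>, the derivatives belonging to \<open>z\<close> and
  \<open>insert N z\<close> are the two components of the vector (\<open>d\<close>,
  \<open>g * q\<close>) rotated by the angle \<omega> x_N. The cross terms cancel, and summing the
  \<open>g\<^sup>2\<close> over all \<open>z\<close> gives 1.\<close>

lemma sum_dwave_squares:
  "(\<Sum>z\<in>Pow {..<N}. (dwave \<omega> N z x u)\<^sup>2) = \<omega>\<^sup>2 * dot N (apply_bcontfun u) (apply_bcontfun u)"
proof (induction N)
  case 0
  then show ?case by (simp add: dot_def zero_blinfun.rep_eq)
next
  case (Suc N)
  have "(dwave \<omega> (Suc N) z x u)\<^sup>2 + (dwave \<omega> (Suc N) (insert N z) x u)\<^sup>2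
      = (dwave \<omega> N z x u)\<^sup>2 + (\<omega> * apply_bcontfun u N)\<^sup>2 * (wave \<omega> N z x)\<^sup>2" if "z \<in> Pow {..<N}" for z
  proof -
    have N: "N \<notin> z" using that by auto
    have e: "wave \<omega> N (insert N z) x = wave \<omega> N z x" "dwave \<omega> N (insert N z) x = dwave \<omega> N z x"
      by (auto intro: wave_cong dwave_cong)
    define c s d g q where "c = cos (\<omega> * apply_bcontfun x N)" and "s = sin (\<omega> * apply_bcontfun x N)"
      and "d = dwave \<omega> N z x u" and "g = wave \<omega> N z x" and "q = \<omega> * apply_bcontfun u N"
    have cs: "c\<^sup>2 + s\<^sup>2 = 1" by (simp add: c_def s_def)
    have "(c * d - g * s * q)\<^sup>2 + (s * d + g * c * q)\<^sup>2 = (c\<^sup>2 + s\<^sup>2) * (d\<^sup>2 + q\<^sup>2 * g\<^sup>2)"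
      by (simp add: power2_eq_square algebra_simps)
    then show ?thesis using N cs
      by (simp add: e trig_factor_def trig_factor'_def plus_blinfun.rep_eq minus_blinfun.rep_eq scaleR_blinfun.rep_eq coord_blinfun.rep_eq
        c_def[symmetric] s_def[symmetric] d_def[symmetric] g_def[symmetric] q_def[symmetric] mult.assoc)
  qed
  then have "(\<Sum>z\<in>Pow {..<Suc N}. (dwave \<omega> (Suc N) z x u)\<^sup>2)
    = (\<Sum>z\<in>Pow {..<N}. (dwave \<omega> N z x u)\<^sup>2 + (\<omega> * apply_bcontfun u N)\<^sup>2 * (wave \<omega> N z x)\<^sup>2)"
    by (simp only: sum_Pow_lessThan_Suc cong: sum.cong)
  also have "\<dots> = (\<Sum>z\<in>Pow {..<N}. (dwave \<omega> N z x u)\<^sup>2) + (\<omega> * apply_bcontfun u N)\<^sup>2 * (\<Sum>z\<in>Pow {..<N}. (wave \<omega> N z x)\<^sup>2)"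
    by (simp add: sum.distrib sum_distrib_left)
  also have "\<dots> = \<omega>\<^sup>2 * dot (Suc N) (apply_bcontfun u) (apply_bcontfun u)"
    unfolding Suc sum_wave_squares dot_Suc by (simp add: power2_eq_square algebra_simps)
  finally show ?case .
qed

lemma strict_deriv_wave_square:
  "strict_deriv (\<lambda>x. (wave \<omega> N z x)\<^sup>2) (\<lambda>u. 2 * wave \<omega> N z p * dwave \<omega> N z p u) p UNIV"
proof -
  have "strict_deriv (\<lambda>x. (wave \<omega> N z x)\<^sup>2) (blinfun_apply ((2 * wave \<omega> N z p) *\<^sub>R dwave \<omega> N z p)) p UNIV"
  proof (rule strict_deriv_C1[where F="\<lambda>x. (2 * wave \<omega> N z x) *\<^sub>R dwave \<omega> N z x"])
    show "((\<lambda>x. (wave \<omega> N z x)\<^sup>2) has_derivative blinfun_apply ((2 * wave \<omega> N z x) *\<^sub>R dwave \<omega> N z x)) (at x)" for x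
      using has_derivative_power[OF has_derivative_wave[of \<omega> N z x], of 2]
      by (simp add: scaleR_blinfun.rep_eq algebra_simps)
  qed (auto intro!: continuous_intros continuous_on_dwave)
  then show ?thesis by (simp add: scaleR_blinfun.rep_eq)
qed

section \<open>Tangent frames and volume of a submanifold\<close>

text \<open>The vectors may be linearly dependent: a vanishing remainder is normalised, through
  division by zero, to the zero vector, whence squared length 0 or 1. Thus no rank has to be
  tracked.\<close>

lemma gram_schmidt:
  fixes b :: "nat \<Rightarrow> nat \<Rightarrow> real"
  shows "\<exists>u. (\<forall>i<n. \<forall>j<n. i \<noteq> j \<longrightarrow> dot N (u i) (u j) = 0) \<and> (\<forall>i<n. dot N (u i) (u i) \<in> {0, 1})
    \<and> (\<forall>i<n. \<forall>k<N. b i k = (\<Sum>l<n. dot N (b i) (u l) * u l k))"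
proof (induction n)
  case (Suc n)
  then obtain u where u: "(\<forall>i<n. \<forall>j<n. i \<noteq> j \<longrightarrow> dot N (u i) (u j) = 0) \<and> (\<forall>i<n. dot N (u i) (u i) \<in> {0, 1})
    \<and> (\<forall>i<n. \<forall>k<N. b i k = (\<Sum>l<n. dot N (b i) (u l) * u l k))" by (elim exE)
  note orth = u[THEN conjunct1, rule_format]
    and unit = u[THEN conjunct2, THEN conjunct1, rule_format]
    and span = u[THEN conjunct2, THEN conjunct2, rule_format]
  define r where "r = (\<lambda>k. b n k - (\<Sum>l<n. dot N (b n) (u l) * u l k))"
  define s where "s = sqrt (dot N r r)"
  define v where "v = (\<lambda>k. r k / s)"
  have dot_sum: "dot N (\<lambda>k. \<Sum>l<n. c l * u l k) y = (\<Sum>l<n. c l * dot N (u l) y)" for c y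
    unfolding dot_def by (simp add: sum_distrib_left sum_distrib_right mult.assoc) (rule sum.swap)
  have r_u: "dot N r (u j) = 0" if "j < n" for j
  proof -
    have "dot N r (u j) = dot N (b n) (u j) - dot N (\<lambda>k. \<Sum>l<n. dot N (b n) (u l) * u l k) (u j)"
      using dot_diff_left[of N "b n" 1 "\<lambda>k. \<Sum>l<n. dot N (b n) (u l) * u l k" "u j"] by (simp add: r_def)
    also have "\<dots> = dot N (b n) (u j) - (\<Sum>l<n. if l = j then dot N (b n) (u j) * dot N (u j) (u j) else 0)"
      unfolding dot_sum using orth that by (intro arg_cong2[where f="(-)"] refl sum.cong) auto
    also have "\<dots> = dot N (b n) (u j) * (1 - dot N (u j) (u j))"
      using that by (simp add: algebra_simps)
    also have "\<dots> = 0"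
    proof (cases "dot N (u j) (u j) = 0")
      case True
      then have "dot N (b n) (u j) = 0"
        using dot_self_eq_0[OF True] by (simp add: dot_def)
      then show ?thesis by simp
    qed (use unit[OF that] in auto)
    finally show ?thesis .
  qed
  have v_r: "v = (\<lambda>k. (1 / s) * r k)" by (simp add: v_def)
  have v_u: "dot N v (u j) = 0" if "j < n" for j
    using r_u[OF that] unfolding v_r dot_scale_left by simp
  then have u_v: "dot N (u j) v = 0" if "j < n" for j
    using that by (subst dot_commute)
  have r_s: "r k = s * v k" if "k < N" for k
  proof (cases "s = 0")
    case True
    then have "dot N r r = 0" by (simp add: s_def)
    then show ?thesis using dot_self_eq_0 that True by simp
  qed (simp add: v_def)
  have v_v: "dot N v v = (if s = 0 then 0 else 1)"
  proof -
    have "dot N v v = dot N r r / (s * s)"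
      by (simp add: dot_def v_def sum_divide_distrib)
    moreover have "s * s = dot N r r" by (simp add: s_def)
    ultimately show ?thesis by (cases "s = 0") auto
  qed
  have b_v: "s * v k = dot N (b n) v * v k" if "k < N" for k
  proof -
    have "dot N (b n) v = dot N r v + (\<Sum>l<n. dot N (b n) (u l) * dot N (u l) v)"
      unfolding dot_sum[symmetric]
      using dot_diff_left[of N "b n" 1 "\<lambda>k. \<Sum>l<n. dot N (b n) (u l) * u l k" v] by (simp add: r_def)
    also have "\<dots> = dot N r v" using u_v by simp
    also have "\<dots> = dot N (\<lambda>k. s * v k) v" by (rule dot_cong) (auto simp: r_s)
    also have "\<dots> = s" unfolding dot_scale_left v_v by simp
    finally show ?thesis by simp
  qed
  define u' where "u' = u(n := v)"
  show ?case
  proof (intro exI[of _ u'] conjI allI impI)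
    fix i j assume "i < Suc n" "j < Suc n" "i \<noteq> j"
    then show "dot N (u' i) (u' j) = 0"
      using orth v_u u_v by (auto simp: u'_def less_Suc_eq)
  next
    fix i assume "i < Suc n"
    then show "dot N (u' i) (u' i) \<in> {0, 1}"
      using unit v_v by (auto simp: u'_def less_Suc_eq)
  next
    fix i k assume i: "i < Suc n" and k: "k < N"
    have "(\<Sum>l<Suc n. dot N (b i) (u' l) * u' l k) = (\<Sum>l<n. dot N (b i) (u l) * u l k) + dot N (b i) v * v k"
      by (simp add: u'_def)
    also have "\<dots> = b i k"
    proof (cases "i = n")
      case True
      have "dot N (b n) v * v k = r k" by (simp only: b_v[OF k, symmetric] r_s[OF k])
      then show ?thesis using True by (simp add: r_def)
    next
      case False
      with i have "i < n" by simp
      have "dot N (b i) v = dot N (\<lambda>k. \<Sum>l<n. dot N (b i) (u l) * u l k) v"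
        by (rule dot_cong) (use span[OF \<open>i < n\<close>] in auto)
      also have "\<dots> = 0" unfolding dot_sum using u_v by simp
      finally show ?thesis using span[OF \<open>i < n\<close> k] by simp
    qed
    finally show "b i k = (\<Sum>l<Suc n. dot N (b i) (u' l) * u' l k)" by simp
  qed
qed simp

text \<open>A chart comes with continuous partial derivatives and, separately, with a derivative
  that is controlled on \<open>Rsp n\<close> only. The combination \<open>G\<close> of the partial
  derivatives agrees with it there, is bounded linear on the whole space and varies continuously
  with the base point; the mean value inequality on a small convex piece then yields strict
  differentiability.\<close>

lemma chart_strict_deriv:
  fixes \<phi> :: "pt \<Rightarrow> pt"
  assumes W: "openin (top_of_set (Rsp n)) W" and w0: "w0 \<in> W"
    and smooth: "smooth_on_sub (Rsp n) W \<phi>"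
    and diff: "\<And>w. w \<in> W \<Longrightarrow> \<exists>D. (\<phi> has_derivative D) (at w within Rsp n) \<and> inj_on D (Rsp n)"
  shows "\<exists>c b. c > 0 \<and> strict_deriv \<phi> (\<lambda>u. \<Sum>i<n. apply_bcontfun u i *\<^sub>R b i) w0 (Rsp n)
    \<and> (\<forall>u\<in>Rsp n. c * norm u \<le> norm (\<Sum>i<n. apply_bcontfun u i *\<^sub>R b i))"
proof -
  have unitR: "unit_pt i \<in> Rsp n" if "i < n" for i using that by (simp add: Rsp_def)
  have WR: "W \<subseteq> Rsp n" using W by (rule openin_imp_subset)
  have "\<exists>g. (\<forall>w\<in>W. ((\<lambda>t. \<phi> (w + t *\<^sub>R unit_pt i)) has_vector_derivative g w) (at 0)) \<and> continuous_on W g" if "i < n" for i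
  proof -
    have "smooth_dirs W \<phi> [unit_pt i]"
      using smooth[unfolded smooth_on_sub_def, rule_format, of "[unit_pt i]"] unitR[OF that] by simp
    then show ?thesis by auto
  qed
  then obtain g where g: "\<And>i w. i < n \<Longrightarrow> w \<in> W \<Longrightarrow> ((\<lambda>t. \<phi> (w + t *\<^sub>R unit_pt i)) has_vector_derivative g i w) (at 0)"
    and gc: "\<And>i. i < n \<Longrightarrow> continuous_on W (g i)" by metis
  define G where "G w u = (\<Sum>i<n. apply_bcontfun u i *\<^sub>R g i w)" for w and u :: pt
  have G_mat_vec: "bounded_linear (G w)" for w
    unfolding G_def by (intro bounded_linear_sum bounded_linear_scaleR_const bounded_linear_apply_bcontfun)
  \<comment> \<open>Along the lines w + t e_i, which stay in \<open>Rsp n\<close>, the derivative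
    must reproduce the partial derivatives; linearity does the rest.\<close>
  have D_eq: "D u = G w u" if D: "(\<phi> has_derivative D) (at w within Rsp n)" and w: "w \<in> W" and u: "u \<in> Rsp n" for D w u
  proof -
    interpret D: bounded_linear D using D by (rule has_derivative_bounded_linear)
    have "D (unit_pt i) = g i w" if i: "i < n" for i
    proof -
      have wi: "w + t *\<^sub>R unit_pt i \<in> Rsp n" for t
        using WR w unitR[OF i] by (intro subspace_add subspace_scale subspace_Rsp) auto
      have "((\<lambda>t. w + t *\<^sub>R unit_pt i) has_derivative (\<lambda>t. t *\<^sub>R unit_pt i)) (at 0)"
        by (auto intro!: derivative_eq_intros)
      moreover have "(\<phi> has_derivative D) (at (w + 0 *\<^sub>R unit_pt i) within range (\<lambda>t. w + t *\<^sub>R unit_pt i))"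
        using wi by (intro has_derivative_subset[OF _ image_subsetI]) (use D in auto)
      ultimately have "((\<lambda>t. \<phi> (w + t *\<^sub>R unit_pt i)) has_derivative (\<lambda>t. D (t *\<^sub>R unit_pt i))) (at 0)"
        by (rule has_derivative_in_compose)
      then have "((\<lambda>t. \<phi> (w + t *\<^sub>R unit_pt i)) has_vector_derivative D (unit_pt i)) (at 0)"
        by (simp add: has_vector_derivative_def D.scaleR)
      then show ?thesis using g[OF i w] by (rule vector_derivative_unique_at)
    qed
    then have "D (pt_of n (apply_bcontfun u)) = G w u"
      unfolding pt_of_def G_def by (simp add: D.sum D.scaleR)
    then show ?thesis by (simp add: pt_of_apply[OF u])
  qed
  have G_deriv: "(\<phi> has_derivative G w) (at w within Rsp n)" if w: "w \<in> W" for w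
  proof -
    from diff[OF w] obtain D where D: "(\<phi> has_derivative D) (at w within Rsp n)" by blast
    have "D (w' - w) = G w (w' - w)" if "w' \<in> Rsp n" for w'
      using D_eq[OF D w] Rsp_diff[OF that] w WR by blast
    with D G_mat_vec show ?thesis unfolding has_derivative_within' by (metis (no_types, lifting))
  qed
  obtain R where R: "R > 0" "ball w0 R \<inter> Rsp n \<subseteq> W"
    using W w0 by (auto simp: openin_contains_ball)
  have strict: "strict_deriv \<phi> (G w0) w0 (Rsp n)"
    unfolding strict_deriv_def
  proof (intro allI impI)
    fix \<epsilon> :: real assume "\<epsilon> > 0"
    define h where "h w = (\<Sum>i<n. norm (g i w - g i w0))" for w
    have "continuous_on W h" unfolding h_def using gc by (intro continuous_intros) auto
    moreover have "h w0 = 0" by (simp add: h_def)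
    ultimately obtain \<rho>' where \<rho>': "\<rho>' > 0" "\<And>w. w \<in> W \<Longrightarrow> dist w w0 < \<rho>' \<Longrightarrow> \<bar>h w\<bar> < \<epsilon>"
      using w0 \<open>\<epsilon> > 0\<close> unfolding continuous_on_iff dist_real_def by (metis diff_zero)
    define \<rho> where "\<rho> = min \<rho>' R"
    define S where "S = ball w0 \<rho> \<inter> Rsp n"
    have S: "S \<subseteq> W" "w0 \<in> S" "convex S"
      using R \<rho>' w0 WR by (auto simp: S_def \<rho>_def intro: convex_Int subspace_imp_convex subspace_Rsp)
    have "norm (\<phi> x - \<phi> y - G w0 (x - y)) \<le> norm (x - y) * \<epsilon>" if "x \<in> S" "y \<in> S" for x y
    proof (rule differentiable_bound_linearization[where S=S and f'=G])
      show "y + t *\<^sub>R (x - y) \<in> S" if "t \<in> {0..1}" for t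
      proof -
        have "y + t *\<^sub>R (x - y) = (1 - t) *\<^sub>R y + t *\<^sub>R x" by (simp add: algebra_simps)
        then show ?thesis using convexD[OF S(3) \<open>y \<in> S\<close> \<open>x \<in> S\<close>, of "1 - t" t] that by simp
      qed
      show "(\<phi> has_derivative G u) (at u within S)" if "u \<in> S" for u
        by (rule has_derivative_subset[OF G_deriv]) (use that S in \<open>auto simp: S_def\<close>)
      fix w assume w: "w \<in> S"
      have "norm ((G w - G w0) u) \<le> h w * norm u" for u
      proof -
        have "(G w - G w0) u = (\<Sum>i<n. apply_bcontfun u i *\<^sub>R (g i w - g i w0))"
          by (simp add: G_def sum_subtractf scaleR_diff_right)
        also have "norm \<dots> \<le> (\<Sum>i<n. norm u * norm (g i w - g i w0))"
          by (rule sum_norm_le) (simp add: mult_right_mono abs_coord_le_norm)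
        finally show ?thesis by (simp add: h_def sum_distrib_left mult.commute)
      qed
      then have "onorm (G w - G w0) \<le> h w"
        by (intro onorm_bound) (auto simp: h_def intro: sum_nonneg)
      moreover have "h w < \<epsilon>" using \<rho>'(2)[of w] w S by (auto simp: S_def \<rho>_def dist_commute)
      ultimately show "onorm (G w - G w0) \<le> \<epsilon>" by simp
    qed (use S in auto)
    then show "\<exists>\<rho>>0. \<forall>x\<in>ball w0 \<rho> \<inter> Rsp n. \<forall>y\<in>ball w0 \<rho> \<inter> Rsp n. norm (\<phi> x - \<phi> y - G w0 (x - y)) \<le> \<epsilon> * norm (x - y)"
      using R \<rho>' by (intro exI[of _ \<rho>]) (auto simp: S_def \<rho>_def mult.commute)
  qed
  have "\<exists>c>0. \<forall>u\<in>Rsp n. c * norm u \<le> norm (G w0 u)"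
  proof -
    \<comment> \<open>Unit sphere of \<open>Rsp n\<close>, obtained inside the compact image of a
      box because the ambient space is infinite-dimensional. Injectivity of the derivative makes the
      minimum over it positive.\<close>
    define Sp where "Sp = pt_of n ` nat_box n 1 \<inter> {v. norm v = 1}"
    have "compact Sp" unfolding Sp_def
      by (intro compact_Int_closed compact_continuous_image continuous_on_pt_of compact_nat_box closed_Collect_eq continuous_intros)
    have SpI: "u \<in> Sp" if "u \<in> Rsp n" "norm u = 1" for u
    proof -
      have "apply_bcontfun u \<in> nat_box n 1" using that abs_coord_le_norm[of u] by (auto simp: nat_box_def Rsp_def)
      then have "pt_of n (apply_bcontfun u) \<in> pt_of n ` nat_box n 1" by blast
      then show ?thesis using that by (simp add: Sp_def pt_of_apply)
    qed
    have pos: "norm (G w0 u) > 0" if "u \<in> Sp" for u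
    proof -
      from diff[OF w0] obtain D where D: "(\<phi> has_derivative D) (at w0 within Rsp n)" "inj_on D (Rsp n)" by blast
      have u: "u \<in> Rsp n" "norm u = 1" using that by (auto simp: Sp_def)
      have "0 \<in> Rsp n" by (simp add: Rsp_def)
      then have "D u \<noteq> D 0" using inj_onD[OF D(2), of u 0] u by auto
      moreover have "D 0 = 0" using has_derivative_bounded_linear[OF D(1)] by (simp add: bounded_linear.linear linear_0)
      ultimately show ?thesis using D_eq[OF D(1) w0 u(1)] by simp
    qed
    have "\<exists>c>0. \<forall>u\<in>Sp. c \<le> norm (G w0 u)"
    proof (cases "Sp = {}")
      case False
      have "continuous_on Sp (\<lambda>u. norm (G w0 u))"
        by (intro continuous_on_norm linear_continuous_on G_mat_vec)
      from continuous_attains_inf[OF \<open>compact Sp\<close> False this] obtain v where "v \<in> Sp" "\<forall>u\<in>Sp. norm (G w0 v) \<le> norm (G w0 u)" by blast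
      with pos show ?thesis by blast
    qed (auto intro: exI[of _ 1])
    then obtain c where c: "c > 0" "\<And>u. u \<in> Sp \<Longrightarrow> c \<le> norm (G w0 u)" by blast
    have "c * norm u \<le> norm (G w0 u)" if u: "u \<in> Rsp n" for u
    proof (cases "u = 0")
      case False
      interpret G: bounded_linear "G w0" by (rule G_mat_vec)
      have "(1 / norm u) *\<^sub>R u \<in> Sp"
        using u False by (intro SpI subspace_scale subspace_Rsp) auto
      from c(2)[OF this] show ?thesis using False by (simp add: G.scaleR field_simps)
    qed simp
    with c(1) show ?thesis by blast
  qed
  then obtain c where "c > 0" "\<And>u. u \<in> Rsp n \<Longrightarrow> c * norm u \<le> norm (G w0 u)" by blast
  with strict show ?thesis
    by (intro exI[of _ c] exI[of _ "\<lambda>i. g i w0"]) (auto simp: G_def[abs_def])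
qed

text \<open>Chords of \<open>M\<close> near \<open>p\<close> are almost tangent, with an error
  relative to the length of the chord: the lower bound on the derivative converts distances in the
  chart into distances in \<open>M\<close>. The Lipschitz parametrisation by a box serves the
  finiteness of the volume.\<close>

lemma submanifold_local:
  assumes M: "closed_submanifold n N M" and p: "p \<in> M"
  shows "\<exists>b :: nat \<Rightarrow> pt. \<forall>\<epsilon>>0. \<exists>U. open U \<and> p \<in> U \<and> (\<forall>x\<in>M \<inter> U. \<forall>y\<in>M \<inter> U. \<exists>v. norm (x - y - (\<Sum>i<n. v i *\<^sub>R b i)) \<le> \<epsilon> * norm (x - y))"
    (is "\<exists>b. ?A b")
    and "\<exists>U \<theta> R C. open U \<and> p \<in> U \<and> R > 0 \<and> C > 0 \<and> M \<inter> U \<subseteq> \<theta> ` nat_box n R \<and> \<theta> ` nat_box n R \<subseteq> Rsp N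
       \<and> (\<forall>h\<in>nat_box n R. \<forall>k\<in>nat_box n R. norm (\<theta> h - \<theta> k) \<le> C * norm (pt_of n (\<lambda>i. h i - k i)))" (is ?B)
proof -
  from M p obtain U W \<phi> \<psi> where U: "open U" "p \<in> U" and W: "openin (top_of_set (Rsp n)) W"
    and im: "\<phi> ` W \<subseteq> Rsp N" and smooth: "smooth_on_sub (Rsp n) W \<phi>" and hom: "homeomorphism W (M \<inter> U) \<phi> \<psi>"
    and diff: "\<And>w. w \<in> W \<Longrightarrow> \<exists>D. (\<phi> has_derivative D) (at w within Rsp n) \<and> inj_on D (Rsp n)"
    unfolding closed_submanifold_def by meson
  have WR: "W \<subseteq> Rsp n" using W by (rule openin_imp_subset)
  define w0 where "w0 = \<psi> p"
  have \<psi>W: "\<psi> x \<in> W" "\<phi> (\<psi> x) = x" if "x \<in> M \<inter> U" for x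
    using hom that by (auto simp: homeomorphism_def)
  have w0: "w0 \<in> W" "\<phi> w0 = p" using \<psi>W[of p] p U by (auto simp: w0_def)
  obtain c b where cb: "c > 0 \<and> strict_deriv \<phi> (\<lambda>u. \<Sum>i<n. apply_bcontfun u i *\<^sub>R b i) w0 (Rsp n)
    \<and> (\<forall>u\<in>Rsp n. c * norm u \<le> norm (\<Sum>i<n. apply_bcontfun u i *\<^sub>R b i))"
    using chart_strict_deriv[OF W w0(1) smooth] diff by blast
  note c = cb[THEN conjunct1] and strict = cb[THEN conjunct2, THEN conjunct1]
    and low = cb[THEN conjunct2, THEN conjunct2, rule_format]
  define G where "G u = (\<Sum>i<n. apply_bcontfun u i *\<^sub>R b i)" for u :: pt
  have near: "\<exists>V. open V \<and> p \<in> V \<and> V \<subseteq> U \<and> (\<forall>x\<in>M \<inter> V. \<psi> x \<in> ball w0 \<rho> \<inter> Rsp n)" if "\<rho> > 0" for \<rho>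
  proof -
    have "continuous_on (M \<inter> U) \<psi>" using hom by (simp add: homeomorphism_def)
    moreover have "p \<in> M \<inter> U" using p U by blast
    ultimately have "\<exists>\<delta>>0. \<forall>x\<in>M \<inter> U. dist x p < \<delta> \<longrightarrow> dist (\<psi> x) (\<psi> p) < \<rho>"
      using that unfolding continuous_on_iff by blast
    then obtain \<delta> where \<delta>: "\<delta> > 0" "\<And>x. x \<in> M \<inter> U \<Longrightarrow> dist x p < \<delta> \<Longrightarrow> dist (\<psi> x) w0 < \<rho>"
      unfolding w0_def by blast
    show ?thesis using \<delta> U \<psi>W(1) WR
      by (intro exI[of _ "U \<inter> ball p \<delta>"]) (auto simp: dist_commute)
  qed
  have "?A b"
  proof (intro allI impI)
    fix \<epsilon> :: real assume "\<epsilon> > 0"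
    \<comment> \<open>The bound c / 2 gives |\<psi> x - \<psi> y| \<le> (2 / c) |x - y|, and
      \<epsilon> c / 2 then makes the error at most \<epsilon> |x - y|.\<close>
    define \<epsilon>' where "\<epsilon>' = min (c / 2) (\<epsilon> * c / 2)"
    have \<epsilon>': "\<epsilon>' > 0" "\<epsilon>' \<le> c / 2" "\<epsilon>' \<le> \<epsilon> * c / 2" using c \<open>\<epsilon> > 0\<close> by (auto simp: \<epsilon>'_def)
    obtain \<rho> where \<rho>: "\<rho> > 0" "\<And>u v. u \<in> ball w0 \<rho> \<inter> Rsp n \<Longrightarrow> v \<in> ball w0 \<rho> \<inter> Rsp n \<Longrightarrow> norm (\<phi> u - \<phi> v - G (u - v)) \<le> \<epsilon>' * norm (u - v)"
      using strict \<epsilon>'(1) unfolding strict_deriv_def G_def by meson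
    obtain V where V: "open V" "p \<in> V" "V \<subseteq> U" "\<And>x. x \<in> M \<inter> V \<Longrightarrow> \<psi> x \<in> ball w0 \<rho> \<inter> Rsp n"
      using near[OF \<rho>(1)] by blast
    have "norm (x - y - (\<Sum>i<n. apply_bcontfun (\<psi> x - \<psi> y) i *\<^sub>R b i)) \<le> \<epsilon> * norm (x - y)" if xy: "x \<in> M \<inter> V" "y \<in> M \<inter> V" for x y
    proof -
      define d where "d = norm (\<psi> x - \<psi> y)"
      have 1: "norm (x - y - G (\<psi> x - \<psi> y)) \<le> \<epsilon>' * d"
        using \<rho>(2)[OF V(4)[OF xy(1)] V(4)[OF xy(2)]] \<psi>W(2)[of x] \<psi>W(2)[of y] xy V(3)
        by (simp add: d_def subset_iff)
      have "c * d \<le> norm (G (\<psi> x - \<psi> y))"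
        using low[of "\<psi> x - \<psi> y"] Rsp_diff V(4) xy by (auto simp: G_def d_def)
      also have "\<dots> \<le> norm (x - y) + norm (x - y - G (\<psi> x - \<psi> y))"
        using norm_triangle_sub[of "G (\<psi> x - \<psi> y)" "x - y"] by (simp add: norm_minus_commute)
      also have "\<dots> \<le> norm (x - y) + c / 2 * d"
        using 1 mult_right_mono[OF \<epsilon>'(2), of d] by (simp add: d_def)
      finally have 2: "c / 2 * d \<le> norm (x - y)" by simp
      have "\<epsilon>' * d \<le> \<epsilon> * c / 2 * d" using \<epsilon>'(3) by (intro mult_right_mono) (auto simp: d_def)
      also have "\<dots> \<le> \<epsilon> * norm (x - y)" using mult_left_mono[OF 2, of \<epsilon>] \<open>\<epsilon> > 0\<close> by simp
      finally show ?thesis using 1 by (simp add: G_def)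
    qed
    then show "\<exists>U. open U \<and> p \<in> U \<and> (\<forall>x\<in>M \<inter> U. \<forall>y\<in>M \<inter> U. \<exists>v. norm (x - y - (\<Sum>i<n. v i *\<^sub>R b i)) \<le> \<epsilon> * norm (x - y))"
      using V by blast
  qed
  then show "\<exists>b. ?A b" by (rule exI[where P="?A" and x=b])
  show ?B
  proof -
    obtain \<rho>' where \<rho>': "\<rho>' > 0" "\<And>u v. u \<in> ball w0 \<rho>' \<inter> Rsp n \<Longrightarrow> v \<in> ball w0 \<rho>' \<inter> Rsp n \<Longrightarrow> norm (\<phi> u - \<phi> v - G (u - v)) \<le> 1 * norm (u - v)"
      using strict zero_less_one[where 'a=real] unfolding strict_deriv_def G_def by meson
    obtain R where R: "R > 0" "ball w0 R \<inter> Rsp n \<subseteq> W"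
      using W w0 by (auto simp: openin_contains_ball)
    \<comment> \<open>Halving keeps the closed box of radius \<rho> inside both open balls.\<close>
    define \<rho> where "\<rho> = min \<rho>' R / 2"
    have \<rho>: "\<rho> > 0" "\<rho> < \<rho>'" "\<rho> < R" using R \<rho>' by (auto simp: \<rho>_def)
    define B where "B = (\<Sum>i<n. norm (b i))"
    have GB: "norm (G u) \<le> B * norm u" for u
    proof -
      have "norm (G u) \<le> (\<Sum>i<n. norm u * norm (b i))"
        unfolding G_def by (rule sum_norm_le) (simp add: mult_right_mono abs_coord_le_norm)
      then show ?thesis by (simp add: B_def sum_distrib_left mult.commute)
    qed
    define \<theta> where "\<theta> h = \<phi> (w0 + pt_of n h)" for h
    have inball: "w0 + pt_of n h \<in> ball w0 \<rho>' \<inter> ball w0 R \<inter> Rsp n" if "h \<in> nat_box n \<rho>" for h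
    proof -
      have "norm (pt_of n h) \<le> \<rho>" using that \<rho> by (intro norm_le_coord) (auto simp: nat_box_def)
      moreover have "w0 + pt_of n h \<in> Rsp n" using w0 WR by (intro subspace_add subspace_Rsp) auto
      ultimately show ?thesis using \<rho> by (simp add: dist_norm)
    qed
    have pt_of_diff: "(w0 + pt_of n h) - (w0 + pt_of n k) = pt_of n (\<lambda>i. h i - k i)" for h k
      by (intro bcontfun_eqI) auto
    have lip: "norm (\<theta> h - \<theta> k) \<le> (1 + B) * norm (pt_of n (\<lambda>i. h i - k i))" if "h \<in> nat_box n \<rho>" "k \<in> nat_box n \<rho>" for h k
    proof -
      have "norm (\<theta> h - \<theta> k - G (pt_of n (\<lambda>i. h i - k i))) \<le> norm (pt_of n (\<lambda>i. h i - k i))"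
        using \<rho>'(2)[of "w0 + pt_of n h" "w0 + pt_of n k"] inball[OF that(1)] inball[OF that(2)]
        unfolding \<theta>_def pt_of_diff by simp
      then have "norm (\<theta> h - \<theta> k) \<le> norm (pt_of n (\<lambda>i. h i - k i)) + norm (G (pt_of n (\<lambda>i. h i - k i)))"
        using norm_triangle_sub[of "\<theta> h - \<theta> k" "G (pt_of n (\<lambda>i. h i - k i))"] by linarith
      then show ?thesis using GB[of "pt_of n (\<lambda>i. h i - k i)"] by (simp add: algebra_simps)
    qed
    obtain V where V: "open V" "p \<in> V" "V \<subseteq> U" "\<And>x. x \<in> M \<inter> V \<Longrightarrow> \<psi> x \<in> ball w0 \<rho> \<inter> Rsp n"
      using near[OF \<rho>(1)] by blast
    have "M \<inter> V \<subseteq> \<theta> ` nat_box n \<rho>"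
    proof
      fix x assume x: "x \<in> M \<inter> V"
      define h where "h = apply_bcontfun (\<psi> x - w0)"
      have d: "\<psi> x - w0 \<in> Rsp n" using V(4)[OF x] w0 WR by (intro Rsp_diff) auto
      have "norm (\<psi> x - w0) < \<rho>" using V(4)[OF x] by (simp add: dist_norm norm_minus_commute)
      then have "\<bar>h i\<bar> \<le> \<rho>" for i
        using abs_coord_le_norm[of "\<psi> x - w0" i] unfolding h_def by linarith
      then have "h \<in> nat_box n \<rho>"
        using d by (simp add: nat_box_def Rsp_def h_def)
      moreover have "pt_of n h = \<psi> x - w0" unfolding h_def by (rule pt_of_apply[OF d])
      then have "\<theta> h = x"
        using \<psi>W(2)[of x] x V(3) by (auto simp: \<theta>_def)
      ultimately show "x \<in> \<theta> ` nat_box n \<rho>" by blast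
    qed
    moreover have "\<theta> ` nat_box n \<rho> \<subseteq> Rsp N"
    proof
      fix y assume "y \<in> \<theta> ` nat_box n \<rho>"
      then obtain h where h: "h \<in> nat_box n \<rho>" "y = \<phi> (w0 + pt_of n h)" by (auto simp: \<theta>_def)
      then have "w0 + pt_of n h \<in> W" using inball[OF h(1)] R(2) by blast
      then show "y \<in> Rsp N" using im h(2) by blast
    qed
    moreover have "1 + B > 0" by (simp add: B_def add_pos_nonneg sum_nonneg)
    ultimately show "\<exists>U \<theta> R C. open U \<and> p \<in> U \<and> R > 0 \<and> C > 0 \<and> M \<inter> U \<subseteq> \<theta> ` nat_box n R \<and> \<theta> ` nat_box n R \<subseteq> Rsp N
       \<and> (\<forall>h\<in>nat_box n R. \<forall>k\<in>nat_box n R. norm (\<theta> h - \<theta> k) \<le> C * norm (pt_of n (\<lambda>i. h i - k i)))"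
      using V(1,2) \<rho>(1) lip by (intro exI[of _ V] exI[of _ \<theta>] exI[of _ \<rho>] exI[of _ "1 + B"] conjI ballI)
  qed
qed

section \<open>Orthonormal tangent frames\<close>

lemma dot_sum_left:
  fixes u :: "nat \<Rightarrow> nat \<Rightarrow> real"
  shows "dot N (\<lambda>k. \<Sum>l<n. c l * u l k) y = (\<Sum>l<n. c l * dot N (u l) y)"
  unfolding dot_def by (simp add: sum_distrib_left sum_distrib_right mult.assoc) (rule sum.swap)

lemma dot_orthonormal_sum:
  fixes u :: "nat \<Rightarrow> nat \<Rightarrow> real"
  assumes "\<And>i j. i < n \<Longrightarrow> j < n \<Longrightarrow> i \<noteq> j \<Longrightarrow> dot N (u i) (u j) = 0"
  shows "dot N (\<lambda>k. \<Sum>l<n. t l * u l k) (\<lambda>k. \<Sum>l<n. t l * u l k) = (\<Sum>l<n. (t l)\<^sup>2 * dot N (u l) (u l))"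
proof -
  have "dot N (u l) (\<lambda>k. \<Sum>l<n. t l * u l k) = t l * dot N (u l) (u l)" if l: "l < n" for l
  proof -
    have "dot N (u l) (\<lambda>k. \<Sum>l<n. t l * u l k) = (\<Sum>j<n. t j * dot N (u j) (u l))"
      by (subst dot_commute) (rule dot_sum_left)
    also have "\<dots> = (\<Sum>j<n. if j = l then t l * dot N (u l) (u l) else 0)"
      using assms l by (intro sum.cong) auto
    also have "\<dots> = t l * dot N (u l) (u l)" using l by (subst sum.delta) auto
    finally show ?thesis .
  qed
  then show ?thesis unfolding dot_sum_left by (simp add: power2_eq_square mult.assoc)
qed

lemma sqrt_dot_triangle: "sqrt (dot N (\<lambda>k. x k + y k) (\<lambda>k. x k + y k)) \<le> sqrt (dot N x x) + sqrt (dot N y y)"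
  using L2_set_triangle_ineq[of x y "{..<N}"] by (simp add: L2_set_def dot_def power2_eq_square)

text \<open>\<open>wave \<omega> N z p * a z\<close> is the gradient of the squared wave at
  \<open>p\<close> in a tangent frame that is orthonormal up to zero vectors. The factors are kept
  apart because they enter Cauchy-Schwarz separately: the waves are weights of square sum 1, the
  \<open>a z\<close> satisfy the frame bound. Its constant 2 \<omega> has the 2 from differentiating
  a square.\<close>

lemma tangent_frame:
  assumes M: "closed_submanifold n N M" and p: "p \<in> M"
  obtains a :: "nat set \<Rightarrow> nat \<Rightarrow> real" where
    "\<And>t. (\<Sum>z\<in>Pow {..<N}. (dot n (a z) t)\<^sup>2) \<le> (2 * \<omega>)\<^sup>2 * dot n t t"
    "\<And>\<epsilon>. \<epsilon> > 0 \<Longrightarrow> \<exists>U. open U \<and> p \<in> U \<and> (\<forall>x\<in>M \<inter> U. \<forall>y\<in>M \<inter> U. \<exists>t. dot n t t \<le> ((1 + \<epsilon>) * eucl_norm N (x - y))\<^sup>2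
       \<and> (\<forall>z\<in>Pow {..<N}. \<bar>(wave \<omega> N z x)\<^sup>2 - (wave \<omega> N z y)\<^sup>2 - dot n (\<lambda>i. wave \<omega> N z p * a z i) t\<bar> \<le> \<epsilon> * eucl_norm N (x - y)))"
proof -
  obtain b :: "nat \<Rightarrow> pt" where b: "\<forall>\<epsilon>>0. \<exists>U. open U \<and> p \<in> U \<and> (\<forall>x\<in>M \<inter> U. \<forall>y\<in>M \<inter> U. \<exists>v. norm (x - y - (\<Sum>i<n. v i *\<^sub>R b i)) \<le> \<epsilon> * norm (x - y))"
    using submanifold_local(1)[OF M p] by (elim exE)
  obtain u where u: "(\<forall>i<n. \<forall>j<n. i \<noteq> j \<longrightarrow> dot N (u i) (u j) = 0) \<and> (\<forall>i<n. dot N (u i) (u i) \<in> {0, 1})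
    \<and> (\<forall>i<n. \<forall>k<N. apply_bcontfun (b i) k = (\<Sum>l<n. dot N (apply_bcontfun (b i)) (u l) * u l k))"
    using gram_schmidt[of n N "\<lambda>i. apply_bcontfun (b i)"] by (elim exE)
  note orth = u[THEN conjunct1, rule_format]
    and unit = u[THEN conjunct2, THEN conjunct1, rule_format]
    and span = u[THEN conjunct2, THEN conjunct2, rule_format]
  define s where "s t = (\<lambda>k. \<Sum>l<n. t l * u l k)" for t :: "nat \<Rightarrow> real"
  have s_dot: "dot N (s t) (s t) = (\<Sum>l<n. (t l)\<^sup>2 * dot N (u l) (u l))" for t
    unfolding s_def by (rule dot_orthonormal_sum) (rule orth)
  define a where "a z l = 2 * dwave \<omega> N z p (pt_of N (u l))" for z l
  have pt_of_s: "pt_of N (s t) = (\<Sum>l<n. t l *\<^sub>R pt_of N (u l))" for t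
    by (intro bcontfun_eqI) (simp add: apply_sum_pt s_def)
  have a_dot: "dot n (a z) t = 2 * dwave \<omega> N z p (pt_of N (s t))" for z t
    by (simp add: pt_of_s a_def dot_def blinfun.sum_right blinfun.scaleR_right sum_distrib_left mult_ac)
  have MR: "M \<subseteq> Rsp N" using M by (simp add: closed_submanifold_def)
  show ?thesis
  proof (rule that[of a])
    fix t
    have "(\<Sum>z\<in>Pow {..<N}. (dot n (a z) t)\<^sup>2) = 4 * (\<Sum>z\<in>Pow {..<N}. (dwave \<omega> N z p (pt_of N (s t)))\<^sup>2)"
      by (simp add: a_dot power_mult_distrib sum_distrib_left)
    also have "\<dots> = (2 * \<omega>)\<^sup>2 * dot N (apply_bcontfun (pt_of N (s t))) (apply_bcontfun (pt_of N (s t)))"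
      unfolding sum_dwave_squares by (simp add: power_mult_distrib)
    also have "dot N (apply_bcontfun (pt_of N (s t))) (apply_bcontfun (pt_of N (s t))) = dot N (s t) (s t)"
      by (rule dot_cong) auto
    also have "\<dots> \<le> dot n t t"
      unfolding s_dot dot_def[of n] power2_eq_square[symmetric] using unit
      by (intro sum_mono) (force simp: mult_le_cancel_left1 intro: mult_left_le)
    finally show "(\<Sum>z\<in>Pow {..<N}. (dot n (a z) t)\<^sup>2) \<le> (2 * \<omega>)\<^sup>2 * dot n t t"
      by (simp add: mult_left_mono)
  next
    fix \<epsilon> :: real assume "\<epsilon> > 0"
    define B where "B = (\<Sum>z\<in>Pow {..<N}. \<bar>2 * wave \<omega> N z p\<bar> * norm (dwave \<omega> N z p))"
    have B: "B \<ge> 0" by (simp add: B_def sum_nonneg)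
    have Bz: "\<bar>2 * wave \<omega> N z p\<bar> * norm (dwave \<omega> N z p) \<le> B" if "z \<in> Pow {..<N}" for z
      unfolding B_def using that by (intro member_le_sum) auto
    \<comment> \<open>Divides \<epsilon> among the nonlinearity of the squared waves, the deviation
      of the chord from the tangent space, seen through derivatives of norm at most
      \<open>B\<close>, and the passage from the sup norm to the Euclidean norm.\<close>
    define e where "e = \<epsilon> / (1 + B + sqrt (real N))"
    have den: "1 + B + sqrt (real N) > 0" using B by (simp add: add_pos_nonneg)
    have e: "e > 0" using \<open>\<epsilon> > 0\<close> den by (simp add: e_def)
    have e1: "e * (1 + B + sqrt (real N)) = \<epsilon>" using den by (simp add: e_def)
    have e2: "e * (1 + B) \<le> \<epsilon>" "sqrt (real N) * e \<le> \<epsilon>"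
      unfolding e1[symmetric] using e B by (auto simp: algebra_simps)
    obtain U where U: "open U" "p \<in> U" "\<And>x y. x \<in> M \<inter> U \<Longrightarrow> y \<in> M \<inter> U \<Longrightarrow> \<exists>v. norm (x - y - (\<Sum>i<n. v i *\<^sub>R b i)) \<le> e * norm (x - y)"
      using b[rule_format, OF e] by blast
    have "\<forall>z. \<exists>\<rho>>0. \<forall>x\<in>ball p \<rho> \<inter> UNIV. \<forall>y\<in>ball p \<rho> \<inter> UNIV.
      norm ((wave \<omega> N z x)\<^sup>2 - (wave \<omega> N z y)\<^sup>2 - 2 * wave \<omega> N z p * dwave \<omega> N z p (x - y)) \<le> e * norm (x - y)"
      using strict_deriv_wave_square[of \<omega> N _ p] e unfolding strict_deriv_def by blast
    then obtain \<rho> where \<rho>: "\<And>z. \<rho> z > 0" "\<And>z x y. x \<in> ball p (\<rho> z) \<Longrightarrow> y \<in> ball p (\<rho> z) \<Longrightarrow>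
       \<bar>(wave \<omega> N z x)\<^sup>2 - (wave \<omega> N z y)\<^sup>2 - 2 * wave \<omega> N z p * dwave \<omega> N z p (x - y)\<bar> \<le> e * norm (x - y)"
      by (metis Int_UNIV_right real_norm_def)
    define V where "V = U \<inter> (\<Inter>z\<in>Pow {..<N}. ball p (\<rho> z))"
    have V: "open V" "p \<in> V" using U \<rho>(1) by (auto simp: V_def)
    have main: "\<exists>t. dot n t t \<le> ((1 + \<epsilon>) * eucl_norm N (x - y))\<^sup>2
       \<and> (\<forall>z\<in>Pow {..<N}. \<bar>(wave \<omega> N z x)\<^sup>2 - (wave \<omega> N z y)\<^sup>2 - dot n (\<lambda>i. wave \<omega> N z p * a z i) t\<bar> \<le> \<epsilon> * eucl_norm N (x - y))"
      if xy: "x \<in> M \<inter> V" "y \<in> M \<inter> V" for x y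
    proof -
      have xyR: "x - y \<in> Rsp N" using xy MR by (intro Rsp_diff) auto
      obtain v where v: "norm (x - y - (\<Sum>i<n. v i *\<^sub>R b i)) \<le> e * norm (x - y)"
        using U(3)[of x y] xy unfolding V_def by blast
      define E where "E = x - y - (\<Sum>i<n. v i *\<^sub>R b i)"
      define t where "t l = (\<Sum>i<n. v i * dot N (apply_bcontfun (b i)) (u l))" for l
      \<comment> \<open>The vectors \<open>b i\<close> are not known to lie in \<open>Rsp N\<close>,
        so the tangent vector is cut to the first \<open>N\<close> coordinates; this does not
        enlarge the sup norm of the error.\<close>
      define E' where "E' = x - y - pt_of N (s t)"
      have sk: "s t k = apply_bcontfun (\<Sum>i<n. v i *\<^sub>R b i) k" if "k < N" for k
      proof -
        have "s t k = (\<Sum>l<n. \<Sum>i<n. v i * (dot N (apply_bcontfun (b i)) (u l) * u l k))"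
          by (simp add: s_def t_def sum_distrib_right mult.assoc)
        also have "\<dots> = (\<Sum>i<n. \<Sum>l<n. v i * (dot N (apply_bcontfun (b i)) (u l) * u l k))"
          by (rule sum.swap)
        also have "\<dots> = (\<Sum>i<n. v i * apply_bcontfun (b i) k)"
          using span[OF _ that] by (simp add: sum_distrib_left[symmetric])
        finally show ?thesis by (simp add: apply_sum_pt)
      qed
      have E'k: "apply_bcontfun E' k = (if k < N then apply_bcontfun E k else 0)" for k
        using xyR sk[of k] by (auto simp: E'_def E_def Rsp_def)
      have E'R: "E' \<in> Rsp N" by (simp add: Rsp_def E'k)
      have nE': "norm E' \<le> e * norm (x - y)"
      proof (rule order_trans[OF norm_le_coord])
        show "\<bar>apply_bcontfun E' k\<bar> \<le> norm E" for k
          using abs_coord_le_norm[of E k] by (simp add: E'k)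
        show "norm E \<le> e * norm (x - y)" using v by (simp add: E_def)
      qed
      have nxy: "norm (x - y) \<le> eucl_norm N (x - y)" by (rule norm_le_eucl[OF xyR])
      \<comment> \<open>A zero frame vector forces \<open>t l = 0\<close>, so \<open>t\<close> has
        exactly the length of the tangent vector.\<close>
      have tt: "dot n t t = dot N (s t) (s t)"
      proof -
        have "t l * t l = (t l)\<^sup>2 * dot N (u l) (u l)" if l: "l < n" for l
        proof (cases "dot N (u l) (u l) = 0")
          case True
          then have "dot N x (u l) = 0" for x using dot_self_eq_0[OF True] by (simp add: dot_def)
          then show ?thesis by (simp add: t_def)
        next
          case False
          then show ?thesis using unit[OF l] by (simp add: power2_eq_square)
        qed
        then show ?thesis unfolding s_dot by (simp add: dot_def)
      qed
      have "sqrt (dot n t t) \<le> (1 + \<epsilon>) * eucl_norm N (x - y)"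
      proof -
        have "dot N (s t) (s t) = dot N (\<lambda>k. apply_bcontfun (x - y) k + apply_bcontfun (- E') k) (\<lambda>k. apply_bcontfun (x - y) k + apply_bcontfun (- E') k)"
          by (rule dot_cong) (auto simp: E'_def)
        then have "sqrt (dot n t t) \<le> eucl_norm N (x - y) + eucl_norm N (- E')"
          unfolding tt eucl_norm_dot by (simp only: sqrt_dot_triangle)
        also have "eucl_norm N (- E') \<le> sqrt (real N) * norm E'"
          using eucl_le_norm[of N "- E'"] by simp
        also have "\<dots> \<le> sqrt (real N) * (e * norm (x - y))" using nE' by (intro mult_left_mono) auto
        also have "\<dots> \<le> \<epsilon> * norm (x - y)" using mult_right_mono[OF e2(2), of "norm (x - y)"] by (simp add: mult.assoc)
        also have "\<dots> \<le> \<epsilon> * eucl_norm N (x - y)" using nxy \<open>\<epsilon> > 0\<close> by (intro mult_left_mono) auto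
        finally show ?thesis by (simp add: algebra_simps)
      qed
      then have 1: "dot n t t \<le> ((1 + \<epsilon>) * eucl_norm N (x - y))\<^sup>2"
        using power_mono[of "sqrt (dot n t t)" _ 2] by simp
      have 2: "\<bar>(wave \<omega> N z x)\<^sup>2 - (wave \<omega> N z y)\<^sup>2 - dot n (\<lambda>i. wave \<omega> N z p * a z i) t\<bar> \<le> \<epsilon> * eucl_norm N (x - y)" if z: "z \<in> Pow {..<N}" for z
      proof -
        define w where "w = 2 * wave \<omega> N z p"
        have A: "\<bar>(wave \<omega> N z x)\<^sup>2 - (wave \<omega> N z y)\<^sup>2 - w * dwave \<omega> N z p (x - y)\<bar> \<le> e * norm (x - y)"
          unfolding w_def by (rule \<rho>(2)) (use xy z in \<open>auto simp: V_def\<close>)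
        have B': "dot n (\<lambda>i. wave \<omega> N z p * a z i) t = w * dwave \<omega> N z p (pt_of N (s t))"
          unfolding dot_scale_left a_dot by (simp add: w_def)
        have "w * dwave \<omega> N z p (x - y) - w * dwave \<omega> N z p (pt_of N (s t)) = w * dwave \<omega> N z p E'"
          by (simp add: E'_def blinfun.diff_right right_diff_distrib)
        moreover have "\<bar>w * dwave \<omega> N z p E'\<bar> \<le> B * (e * norm (x - y))"
        proof -
          have "\<bar>w * dwave \<omega> N z p E'\<bar> \<le> \<bar>w\<bar> * (norm (dwave \<omega> N z p) * norm E')"
            using norm_blinfun[of "dwave \<omega> N z p" E'] by (simp add: abs_mult mult_left_mono)
          also have "\<dots> = (\<bar>w\<bar> * norm (dwave \<omega> N z p)) * norm E'" by (simp only: mult.assoc)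
          also have "\<dots> \<le> B * (e * norm (x - y))"
            using Bz[OF z] nE' B unfolding w_def by (intro mult_mono) auto
          finally show ?thesis .
        qed
        ultimately have "\<bar>(wave \<omega> N z x)\<^sup>2 - (wave \<omega> N z y)\<^sup>2 - dot n (\<lambda>i. wave \<omega> N z p * a z i) t\<bar> \<le> e * (1 + B) * norm (x - y)"
          using A unfolding B' by (simp add: algebra_simps)
        also have "\<dots> \<le> \<epsilon> * norm (x - y)" using e2(1) by (intro mult_right_mono) auto
        also have "\<dots> \<le> \<epsilon> * eucl_norm N (x - y)" using nxy \<open>\<epsilon> > 0\<close> by (intro mult_left_mono) auto
        finally show ?thesis .
      qed
      from 1 2 show ?thesis by blast
    qed
    show "\<exists>U. open U \<and> p \<in> U \<and> (\<forall>x\<in>M \<inter> U. \<forall>y\<in>M \<inter> U. \<exists>t. dot n t t \<le> ((1 + \<epsilon>) * eucl_norm N (x - y))\<^sup>2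
       \<and> (\<forall>z\<in>Pow {..<N}. \<bar>(wave \<omega> N z x)\<^sup>2 - (wave \<omega> N z y)\<^sup>2 - dot n (\<lambda>i. wave \<omega> N z p * a z i) t\<bar> \<le> \<epsilon> * eucl_norm N (x - y)))"
      by (intro exI[of _ V] conjI[OF V(1)] conjI[OF V(2)] ballI main)
  qed
qed

section \<open>Finiteness of the Hausdorff measure of a submanifold\<close>

lemma eucl_diam_le: "(\<And>x y. x \<in> S \<Longrightarrow> y \<in> S \<Longrightarrow> eucl_norm N (x - y) \<le> d) \<Longrightarrow> eucl_diam N S \<le> ennreal d"
  unfolding eucl_diam_def by (intro SUP_least ennreal_leI)

text \<open>A finite cover is padded with empty sets to a sequence; n \<ge> 1 makes their terms 0^n
  vanish.\<close>

lemma hausdorff_pre_finite_le: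
  assumes n: "n \<ge> 1" and I: "finite I" and cover: "A \<subseteq> (\<Union>i\<in>I. S i)"
    and S: "\<And>i. i \<in> I \<Longrightarrow> S i \<subseteq> Rsp N" "\<And>i. i \<in> I \<Longrightarrow> eucl_diam N (S i) \<le> ennreal (d i)"
      "\<And>i. i \<in> I \<Longrightarrow> d i < \<delta>" "\<And>i. i \<in> I \<Longrightarrow> d i \<ge> 0" and \<delta>: "\<delta> > 0"
  shows "hausdorff_pre n N \<delta> A \<le> ennreal (\<Sum>i\<in>I. unit_ball_vol (real n) * (d i / 2) ^ n)"
proof -
  obtain f where f: "bij_betw f {..<card I} I"
    using ex_bij_betw_nat_finite[OF I] by (auto simp: atLeast0LessThan)
  define C where "C k = (if k < card I then S (f k) else {})" for k
  have fI: "f k \<in> I" if "k < card I" for k using f that by (auto simp: bij_betw_def)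
  have e0: "eucl_diam N {} = 0" by (simp add: eucl_diam_def bot_ennreal)
  have "eucl_diam N (C k) < ennreal \<delta>" for k
  proof (cases "k < card I")
    case True
    then show ?thesis using S(2,3)[OF fI[OF True]] \<delta> by (auto simp: C_def ennreal_lessI intro: le_less_trans)
  qed (use \<delta> e0 in \<open>simp add: C_def\<close>)
  moreover have "A \<subseteq> \<Union> (range C)"
  proof
    fix x assume "x \<in> A"
    then obtain i where "i \<in> I" "x \<in> S i" using cover by blast
    from f \<open>i \<in> I\<close> have "i \<in> f ` {..<card I}" by (simp add: bij_betw_def)
    then obtain k where "k < card I" "f k = i" by auto
    then show "x \<in> \<Union> (range C)" using \<open>x \<in> S i\<close> by (auto simp: C_def intro!: exI[of _ k])
  qed
  moreover have "C k \<subseteq> Rsp N" for k using S(1) fI by (auto simp: C_def)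
  ultimately have "hausdorff_pre n N \<delta> A \<le> (\<Sum>k. ennreal (unit_ball_vol (real n)) * (eucl_diam N (C k) / 2) ^ n)"
    unfolding hausdorff_pre_def by (intro INF_lower) auto
  also have "\<dots> = (\<Sum>k<card I. ennreal (unit_ball_vol (real n)) * (eucl_diam N (C k) / 2) ^ n)"
    using n e0 by (intro suminf_finite) (auto simp: C_def)
  also have "\<dots> \<le> (\<Sum>k<card I. ennreal (unit_ball_vol (real n) * (d (f k) / 2) ^ n))"
  proof (rule sum_mono)
    fix k assume "k \<in> {..<card I}"
    then have k: "f k \<in> I" "C k = S (f k)" using fI by (auto simp: C_def)
    have "eucl_diam N (C k) / 2 \<le> ennreal (d (f k)) / ennreal 2"
      using S(2)[OF k(1)] k by (simp add: divide_right_mono_ennreal)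
    also have "\<dots> = ennreal (d (f k) / 2)" using S(4)[OF k(1)] by (subst divide_ennreal) auto
    finally have "(eucl_diam N (C k) / 2) ^ n \<le> ennreal (d (f k) / 2) ^ n" by (intro power_mono) auto
    also have "\<dots> = ennreal ((d (f k) / 2) ^ n)" using S(4)[OF k(1)] by (simp add: ennreal_power)
    finally show "ennreal (unit_ball_vol (real n)) * (eucl_diam N (C k) / 2) ^ n \<le> ennreal (unit_ball_vol (real n) * (d (f k) / 2) ^ n)"
      using S(4)[OF k(1)] by (subst ennreal_mult) (auto intro: mult_left_mono)
  qed
  also have "\<dots> = (\<Sum>i\<in>I. ennreal (unit_ball_vol (real n) * (d i / 2) ^ n))"
    by (rule sum.reindex_bij_betw[OF f])
  also have "\<dots> = ennreal (\<Sum>i\<in>I. unit_ball_vol (real n) * (d i / 2) ^ n)"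
    using S(4) by (intro sum_ennreal) auto
  finally show ?thesis .
qed

lemma grid_cell:
  fixes t R :: real
  assumes "R > 0" "m > 0" "\<bar>t\<bar> \<le> R"
  shows "\<exists>k<m. - R + 2 * R * real k / real m \<le> t \<and> t \<le> - R + 2 * R * (real k + 1) / real m"
proof -
  define s where "s = (t + R) * real m / (2 * R)"
  have tR: "0 \<le> t + R" "t + R \<le> 2 * R" using assms by auto
  have "0 \<le> s" unfolding s_def using tR assms by (intro divide_nonneg_pos mult_nonneg_nonneg) auto
  moreover have "(t + R) * real m \<le> 2 * R * real m" using tR by (intro mult_right_mono) auto
  then have "s \<le> real m" using assms by (simp add: s_def pos_divide_le_eq mult.commute)
  ultimately have s: "0 \<le> s" "s \<le> real m" by auto
  have t: "t = - R + 2 * R * s / real m" using assms by (simp add: s_def)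
  have "\<exists>k<m. real k \<le> s \<and> s \<le> real k + 1"
  proof (cases "s = real m")
    case True
    \<comment> \<open>The right end point t = R is assigned to the last cell.\<close>
    then show ?thesis using assms by (intro exI[of _ "m - 1"]) (auto simp: of_nat_diff)
  next
    case False
    then have "nat \<lfloor>s\<rfloor> < m" using s by linarith
    moreover have "real (nat \<lfloor>s\<rfloor>) \<le> s" "s \<le> real (nat \<lfloor>s\<rfloor>) + 1" using s by linarith+
    ultimately show ?thesis by blast
  qed
  then obtain k where "k < m" "real k \<le> s" "s \<le> real k + 1" by blast
  then show ?thesis using assms
    by (intro exI[of _ k]) (auto simp: t intro!: divide_right_mono mult_left_mono)
qed

text \<open>\<open>vol\<close> would read 0 if the Hausdorff measure were infinite, so finiteness
  must be known before \<open>vol\<close> bounds anything. Finitely many Lipschitz boxes are each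
  cut into m^n cells whose images have diameter at most K p / m; the powers of \<open>m\<close>
  cancel, and the bound does not depend on \<delta>.\<close>

lemma hausdorff_submanifold_finite:
  assumes M: "closed_submanifold n N M" and n: "n \<ge> 1"
  shows "hausdorff n N M < top"
proof -
  define Q where "Q p U \<theta> R C \<longleftrightarrow> open U \<and> p \<in> U \<and> R > 0 \<and> C > 0 \<and> M \<inter> U \<subseteq> \<theta> ` nat_box n R \<and> \<theta> ` nat_box n R \<subseteq> Rsp N
       \<and> (\<forall>h\<in>nat_box n R. \<forall>k\<in>nat_box n R. norm (\<theta> h - \<theta> k) \<le> C * norm (pt_of n (\<lambda>i. h i - k i)))" for p U \<theta> R C
  have "\<forall>p\<in>M. \<exists>X. Q p (fst X) (fst (snd X)) (fst (snd (snd X))) (snd (snd (snd X)))"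
  proof
    fix p assume "p \<in> M"
    from submanifold_local(2)[OF M this] obtain U \<theta> R C where "Q p U \<theta> R C"
      unfolding Q_def by (elim exE)
    then show "\<exists>X. Q p (fst X) (fst (snd X)) (fst (snd (snd X))) (snd (snd (snd X)))"
      by (intro exI[of _ "(U, \<theta>, R, C)"]) simp
  qed
  from bchoice[OF this] obtain X where X: "\<And>p. p \<in> M \<Longrightarrow> Q p (fst (X p)) (fst (snd (X p))) (fst (snd (snd (X p)))) (snd (snd (snd (X p))))"
    by blast
  define U \<theta> R C where "U p = fst (X p)" and "\<theta> p = fst (snd (X p))" and "R p = fst (snd (snd (X p)))" and "C p = snd (snd (snd (X p)))" for p
  have Qp: "Q p (U p) (\<theta> p) (R p) (C p)" if "p \<in> M" for p
    using X[OF that] by (simp add: U_def \<theta>_def R_def C_def)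
  have U: "open (U p)" "p \<in> U p" and RC: "R p > 0" "C p > 0" and cov: "M \<inter> U p \<subseteq> \<theta> p ` nat_box n (R p)"
    and im: "\<theta> p ` nat_box n (R p) \<subseteq> Rsp N" if "p \<in> M" for p
    using Qp[OF that] unfolding Q_def by auto
  have lip: "norm (\<theta> p h - \<theta> p k) \<le> C p * norm (pt_of n (\<lambda>i. h i - k i))" if "p \<in> M" "h \<in> nat_box n (R p)" "k \<in> nat_box n (R p)" for p h k
    using Qp[OF that(1)] that(2,3) unfolding Q_def by blast
  have "compact M" using M by (simp add: closed_submanifold_def)
  then obtain P where P: "P \<subseteq> M" "finite P" "M \<subseteq> (\<Union>p\<in>P. U p)"
    using U by (elim compactE_image[of M M U]) auto
  define K where "K p = sqrt (real N) * C p * (2 * R p)" for p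
  have K0: "K p \<ge> 0" if "p \<in> P" for p
    using RC[of p] P that unfolding K_def by (intro mult_nonneg_nonneg) (auto simp: less_imp_le)
  define B where "B = (\<Sum>p\<in>P. unit_ball_vol (real n) * (K p / 2) ^ n)"
  have "hausdorff_pre n N \<delta> M \<le> ennreal B" if \<delta>: "\<delta> > 0" for \<delta>
  proof -
    obtain m :: nat where m: "real m > (\<Sum>p\<in>P. K p) / \<delta>" using reals_Archimedean2 by blast
    moreover have "(\<Sum>p\<in>P. K p) / \<delta> \<ge> 0" using K0 \<delta> by (simp add: sum_nonneg)
    ultimately have m0: "m > 0" by (metis of_nat_0_less_iff le_less_trans)
    define I where "I = P \<times> tuples n {..<m}"
    define S where "S = (\<lambda>(p,\<kappa>). \<theta> p ` {h \<in> nat_box n (R p). \<forall>i<n. - R p + 2 * R p * real (\<kappa> i) / real m \<le> h i \<and> h i \<le> - R p + 2 * R p * (real (\<kappa> i) + 1) / real m})"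
    define d where "d = (\<lambda>(p, \<kappa>::nat\<Rightarrow>nat). K p / real m)"
    have "hausdorff_pre n N \<delta> M \<le> ennreal (\<Sum>i\<in>I. unit_ball_vol (real n) * (d i / 2) ^ n)"
    proof (rule hausdorff_pre_finite_le[OF n, where S=S])
      show "finite I" using P by (auto simp: I_def intro!: finite_PiE)
      show "M \<subseteq> (\<Union>i\<in>I. S i)"
      proof
        fix x assume x: "x \<in> M"
        then obtain p where p: "p \<in> P" "x \<in> U p" using P by blast
        then obtain h where h: "h \<in> nat_box n (R p)" "x = \<theta> p h" using cov[of p] P x by blast
        have "\<forall>i. \<exists>k. i < n \<longrightarrow> k < m \<and> - R p + 2 * R p * real k / real m \<le> h i \<and> h i \<le> - R p + 2 * R p * (real k + 1) / real m"
          using grid_cell[OF _ m0] RC(1)[of p] p P h(1) by (force simp: nat_box_def)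
        then obtain \<kappa> where \<kappa>: "\<And>i. i < n \<Longrightarrow> \<kappa> i < m \<and> - R p + 2 * R p * real (\<kappa> i) / real m \<le> h i \<and> h i \<le> - R p + 2 * R p * (real (\<kappa> i) + 1) / real m"
          by metis
        have "(p, restrict \<kappa> {..<n}) \<in> I" using p \<kappa> by (auto simp: I_def)
        moreover have "x \<in> S (p, restrict \<kappa> {..<n})" using h \<kappa> by (auto simp: S_def)
        ultimately show "x \<in> (\<Union>i\<in>I. S i)" by blast
      qed
      fix i assume i: "i \<in> I"
      obtain p \<kappa> where pk: "i = (p, \<kappa>)" by (cases i)
      with i have p: "p \<in> P" "p \<in> M" using P by (auto simp: I_def)
      show "S i \<subseteq> Rsp N" using im[OF p(2)] by (auto simp: S_def pk)
      show "d i \<ge> 0" using K0[OF p(1)] by (simp add: d_def pk)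
      have "K p \<le> (\<Sum>p\<in>P. K p)" using K0 P p by (intro member_le_sum) auto
      also have "\<dots> < \<delta> * real m" using m \<delta> by (simp add: pos_divide_less_eq mult.commute)
      finally show "d i < \<delta>" using m0 by (simp add: d_def pk pos_divide_less_eq)
      show "eucl_diam N (S i) \<le> ennreal (d i)"
      proof (rule eucl_diam_le)
        fix x y assume "x \<in> S i" "y \<in> S i"
        then obtain h k where hk: "h \<in> nat_box n (R p)" "k \<in> nat_box n (R p)" "x = \<theta> p h" "y = \<theta> p k"
          "\<And>i. i < n \<Longrightarrow> - R p + 2 * R p * real (\<kappa> i) / real m \<le> h i \<and> h i \<le> - R p + 2 * R p * (real (\<kappa> i) + 1) / real m"
          "\<And>i. i < n \<Longrightarrow> - R p + 2 * R p * real (\<kappa> i) / real m \<le> k i \<and> k i \<le> - R p + 2 * R p * (real (\<kappa> i) + 1) / real m"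
          by (auto simp: S_def pk)
        have "norm (pt_of n (\<lambda>i. h i - k i)) \<le> 2 * R p / real m"
        proof (rule norm_le_coord)
          fix i
          have "\<bar>h i - k i\<bar> \<le> 2 * R p / real m" if "i < n"
          proof -
            have "2 * R p * (real (\<kappa> i) + 1) / real m = 2 * R p * real (\<kappa> i) / real m + 2 * R p / real m"
              by (simp add: field_simps add_divide_distrib)
            then show ?thesis using hk(5)[OF that] hk(6)[OF that] by linarith
          qed
          then show "\<bar>apply_bcontfun (pt_of n (\<lambda>i. h i - k i)) i\<bar> \<le> 2 * R p / real m"
            using RC(1)[OF p(2)] by simp
        qed
        then have "norm (x - y) \<le> C p * (2 * R p / real m)"
          using lip[OF p(2) hk(1,2)] RC(2)[OF p(2)] hk(3,4) by (meson mult_left_mono order_trans less_imp_le)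
        then have "sqrt (real N) * norm (x - y) \<le> sqrt (real N) * (C p * (2 * R p / real m))"
          by (intro mult_left_mono) auto
        then show "eucl_norm N (x - y) \<le> d i"
          using eucl_le_norm[of N "x - y"] by (simp add: d_def pk K_def mult.assoc)
      qed
    qed (rule \<delta>)
    also have "(\<Sum>i\<in>I. unit_ball_vol (real n) * (d i / 2) ^ n) = B"
    proof -
      have "(\<Sum>i\<in>I. unit_ball_vol (real n) * (d i / 2) ^ n) = (\<Sum>p\<in>P. \<Sum>\<kappa>\<in>tuples n {..<m}. unit_ball_vol (real n) * (K p / real m / 2) ^ n)"
        unfolding I_def d_def by (subst sum.cartesian_product) (simp add: case_prod_beta)
      also have "\<dots> = (\<Sum>p\<in>P. unit_ball_vol (real n) * (K p / 2) ^ n)"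
        using m0 by (intro sum.cong) (auto simp: card_PiE power_divide field_simps)
      finally show ?thesis by (simp add: B_def)
    qed
    finally show ?thesis .
  qed
  then have "hausdorff n N M \<le> ennreal B"
    unfolding hausdorff_def by (intro SUP_least) auto
  then show ?thesis by (meson ennreal_less_top le_less_trans)
qed

section \<open>The nerve map\<close>

text \<open>Caratheodory's reduction: a subset of least cardinality that still represents
  \<open>y\<close> is affinely independent. It is wanted because a polyhedron consists of
  nondegenerate simplices, whereas the cube centres at a point may be affinely dependent.\<close>

lemma convex_hull_affine_independent_subset:
  fixes S :: "'a::real_vector set"
  assumes "finite S" "y \<in> convex hull S"
  shows "\<exists>T\<subseteq>S. \<not> affine_dependent T \<and> y \<in> convex hull T"
proof -
  define P where "P T \<longleftrightarrow> T \<subseteq> S \<and> y \<in> convex hull T" for T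
  have "P S" using assms by (simp add: P_def)
  from ex_has_least_nat[of P, OF this, of card] obtain T where T: "P T" and min: "\<And>T'. P T' \<Longrightarrow> card T \<le> card T'"
    by blast
  have fT: "finite T" using T assms(1) by (auto simp: P_def intro: finite_subset)
  have "\<not> affine_dependent T"
  proof
    assume "affine_dependent T"
    then obtain U0 where U0: "sum U0 T = 0" "\<exists>v\<in>T. U0 v \<noteq> 0" "(\<Sum>v\<in>T. U0 v *\<^sub>R v) = 0"
      using affine_dependent_explicit_finite[OF fT] by auto
    have "\<exists>v\<in>T. U0 v > 0"
    proof (rule ccontr)
      assume "\<not> (\<exists>v\<in>T. U0 v > 0)"
      then have "\<forall>v\<in>T. - U0 v \<ge> 0" by auto
      moreover have "(\<Sum>v\<in>T. - U0 v) = 0" using U0(1) by (simp add: sum_negf)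
      ultimately have "\<forall>v\<in>T. U0 v = 0" using sum_nonneg_eq_0_iff[OF fT, of "\<lambda>v. - U0 v"] by auto
      then show False using U0(2) by auto
    qed
    then obtain v0 where v0: "v0 \<in> T" "U0 v0 > 0" by blast
    obtain u where u: "\<forall>v\<in>T. u v \<ge> 0" "sum u T = 1" "(\<Sum>v\<in>T. u v *\<^sub>R v) = y"
      using T by (auto simp: P_def convex_hull_finite[OF fT])
    define V where "V = {v\<in>T. U0 v > 0}"
    have V: "finite V" "V \<noteq> {}" using fT v0 by (auto simp: V_def)
    \<comment> \<open>Largest multiple of the affine relation that can be subtracted with all
      coefficients staying nonnegative; the coefficient at the minimiser \<open>w\<close> becomes
      0.\<close>
    define s where "s = Min ((\<lambda>v. u v / U0 v) ` V)"
    have "s \<in> (\<lambda>v. u v / U0 v) ` V" unfolding s_def using V by (intro Min_in) auto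
    then obtain w where w: "w \<in> V" "s = u w / U0 w" by blast
    have s_le: "s \<le> u v / U0 v" if "v \<in> V" for v using V that by (simp add: s_def)
    have s0: "s \<ge> 0" using w u(1) by (auto simp: V_def intro!: divide_nonneg_nonneg)
    define u' where "u' v = u v - s * U0 v" for v
    have nn: "u' v \<ge> 0" if "v \<in> T" for v
    proof (cases "U0 v > 0")
      case True
      then have "s * U0 v \<le> u v" using s_le[of v] that by (simp add: V_def pos_le_divide_eq)
      then show ?thesis by (simp add: u'_def)
    next
      case False
      then have "s * U0 v \<le> 0" using s0 by (simp add: mult_nonneg_nonpos)
      moreover have "u v \<ge> 0" using u(1) that by auto
      ultimately show ?thesis by (simp add: u'_def)
    qed
    have w0: "u' w = 0" "w \<in> T" using w by (auto simp: u'_def V_def)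
    have s1: "sum u' (T - {w}) = 1" "(\<Sum>v\<in>T - {w}. u' v *\<^sub>R v) = y"
    proof -
      have "sum u' T = 1" using u U0 by (simp add: u'_def sum_subtractf sum_distrib_left[symmetric])
      then show "sum u' (T - {w}) = 1" using w0 fT by (simp add: sum_diff1)
      have "(\<Sum>v\<in>T. u' v *\<^sub>R v) = (\<Sum>v\<in>T. u v *\<^sub>R v) - s *\<^sub>R (\<Sum>v\<in>T. U0 v *\<^sub>R v)"
        by (simp add: u'_def scaleR_diff_left sum_subtractf scaleR_sum_right)
      then have "(\<Sum>v\<in>T. u' v *\<^sub>R v) = y" using u U0 by simp
      then show "(\<Sum>v\<in>T - {w}. u' v *\<^sub>R v) = y" using w0 fT by (simp add: sum_diff1)
    qed
    have "y \<in> convex hull (T - {w})"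
      using nn s1 fT by (subst convex_hull_finite) (auto intro!: exI[of _ u'])
    then have "P (T - {w})" using T by (auto simp: P_def)
    then have "card T \<le> card (T - {w})" by (rule min)
    moreover have "card (T - {w}) < card T" by (rule card_Diff1_less[OF fT w0(2)])
    ultimately show False by linarith
  qed
  then show ?thesis using T by (auto simp: P_def)
qed

section \<open>The cubes and their centres\<close>

text \<open>Sine factors vanish at the integers, so their cubes are centred at the half-integers.\<close>

definition half_shift :: "nat set \<Rightarrow> nat \<Rightarrow> real" where
  "half_shift z i = (if i \<in> z then 1/2 else 0)"

text \<open>Defined for every \<open>x\<close>, although it jumps between cubes; jumps occur only at
  zeros of the wave, where the weights of the nerve map vanish.\<close>

definition cube_centre :: "real \<Rightarrow> nat \<Rightarrow> nat set \<Rightarrow> pt \<Rightarrow> pt" where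
  "cube_centre L N z x = pt_of N (\<lambda>i. L * (of_int (round (apply_bcontfun x i / L - half_shift z i)) + half_shift z i))"

lemma norm_diff_cube_centre:
  assumes "L > 0" "x \<in> Rsp N"
  shows "norm (x - cube_centre L N z x) \<le> L / 2"
proof (rule norm_le_coord)
  fix i
  let ?u = "apply_bcontfun x i / L - half_shift z i"
  have "apply_bcontfun x i - L * (of_int (round ?u) + half_shift z i) = L * (?u - of_int (round ?u))"
    using assms by (simp add: field_simps)
  moreover have "\<bar>?u - of_int (round ?u)\<bar> \<le> 1/2"
    using of_int_round_abs_le[of ?u] by (simp add: abs_minus_commute)
  ultimately have "\<bar>apply_bcontfun x i - L * (of_int (round ?u) + half_shift z i)\<bar> \<le> L * (1/2)"
    using assms by (simp add: abs_mult mult_left_mono)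
  then show "\<bar>apply_bcontfun (x - cube_centre L N z x) i\<bar> \<le> L / 2"
    using assms by (auto simp: cube_centre_def Rsp_def)
qed

lemma trig_factor_eq_cos: "L > 0 \<Longrightarrow> trig_factor z i (pi / L * t) = cos (pi * (t / L - half_shift z i))"
proof -
  assume "L > 0"
  have "cos (pi * (t / L) - pi / 2) = sin (pi * (t / L))"
    by (simp add: cos_diff)
  then show ?thesis
    by (simp add: trig_factor_def half_shift_def algebra_simps)
qed

text \<open>Rounding jumps only at half-integers, and these are zeros of cos(pi u).\<close>

lemma round_locally_constant:
  assumes "cos (pi * u) \<noteq> 0"
  shows "\<exists>\<delta>>0. \<forall>u'. \<bar>u' - u\<bar> < \<delta> \<longrightarrow> round u' = round u"
proof -
  have "\<bar>u - of_int (round u)\<bar> \<le> 1/2"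
    using of_int_round_abs_le[of u] by (simp add: abs_minus_commute)
  moreover have "\<bar>u - of_int (round u)\<bar> \<noteq> 1/2"
  proof
    assume "\<bar>u - of_int (round u)\<bar> = 1/2"
    then have "u = of_int (round u) + 1/2 \<or> u = of_int (round u - 1) + 1/2" by (auto simp: abs_if split: if_splits)
    then obtain m where "u = of_int m + 1/2" by blast
    then have "cos (pi * u) = cos (of_int m * pi + pi / 2)" by (simp add: algebra_simps)
    also have "\<dots> = - sin (of_int m * pi)" by (simp add: cos_add)
    also have "\<dots> = 0" using sin_zero_iff_int2[of "of_int m * pi"] by auto
    finally show False using assms by simp
  qed
  ultimately have lt: "\<bar>u - of_int (round u)\<bar> < 1/2" by simp
  show ?thesis
  proof (intro exI[of _ "1/2 - \<bar>u - of_int (round u)\<bar>"] conjI allI impI)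
    fix u' assume "\<bar>u' - u\<bar> < 1/2 - \<bar>u - of_int (round u)\<bar>"
    then have "\<bar>u' - of_int (round u)\<bar> < 1/2" by linarith
    then show "round u' = round u" by (rule round_unique')
  qed (use lt in simp)
qed

lemma cube_centre_locally_constant:
  assumes L: "L > 0" and x: "wave (pi / L) N z x \<noteq> 0"
  shows "eventually (\<lambda>y. cube_centre L N z y = cube_centre L N z x) (nhds x)"
proof -
  let ?u = "\<lambda>y i. apply_bcontfun y i / L - half_shift z i"
  have "eventually (\<lambda>y. round (?u y i) = round (?u x i)) (nhds x)" if i: "i < N" for i
  proof -
    have "trig_factor z i (pi / L * apply_bcontfun x i) \<noteq> 0" using x i by (auto simp: wave_def)
    then have "cos (pi * ?u x i) \<noteq> 0" using trig_factor_eq_cos[OF L] by simp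
    then obtain \<delta> where \<delta>: "\<delta> > 0" "\<And>u'. \<bar>u' - ?u x i\<bar> < \<delta> \<Longrightarrow> round u' = round (?u x i)"
      using round_locally_constant by blast
    have "((\<lambda>y::pt. apply_bcontfun y i) \<longlongrightarrow> apply_bcontfun x i) (nhds x)"
      by (rule bounded_linear.tendsto[OF bounded_linear_apply_bcontfun filterlim_ident])
    then have "((\<lambda>y. ?u y i) \<longlongrightarrow> ?u x i) (nhds x)"
      using L by (intro tendsto_diff tendsto_divide tendsto_const) auto
    from tendstoD[OF this \<delta>(1)] show ?thesis
      by (rule eventually_mono) (rule \<delta>(2), simp only: dist_real_def)
  qed
  then have "eventually (\<lambda>y. \<forall>i\<in>{..<N}. round (?u y i) = round (?u x i)) (nhds x)"
    by (intro eventually_ball_finite) auto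
  then show ?thesis
    by (rule eventually_mono) (auto simp: cube_centre_def intro!: bcontfun_eqI)
qed

lemma finite_cube_centres:
  assumes L: "L > 0" and M: "bounded M"
  shows "finite (cube_centre L N z ` M)"
proof -
  obtain B where B: "\<And>x. x \<in> M \<Longrightarrow> norm x \<le> B" using M by (auto simp: bounded_iff)
  obtain b :: int where b: "of_int b \<ge> B / L + 2" using ex_le_of_int by blast
  define F where "F g = pt_of N (\<lambda>i. L * (of_int (g i) + half_shift z i))" for g :: "nat \<Rightarrow> int"
  have "cube_centre L N z x \<in> F ` Pi\<^sub>E {..<N} (\<lambda>_. {-b..b})" if x: "x \<in> M" for x
  proof -
    define g where "g = (\<lambda>i\<in>{..<N}. round (apply_bcontfun x i / L - half_shift z i))"
    have "g i \<in> {-b..b}" if "i < N" for i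
    proof -
      have "\<bar>apply_bcontfun x i\<bar> \<le> B" using abs_coord_le_norm[of x i] B[OF x] by linarith
      then have "\<bar>apply_bcontfun x i / L\<bar> \<le> B / L" using L by (simp add: abs_divide divide_right_mono)
      moreover have "\<bar>half_shift z i\<bar> \<le> 1/2" by (simp add: half_shift_def)
      moreover have "\<bar>of_int (g i) - (apply_bcontfun x i / L - half_shift z i)\<bar> \<le> 1/2"
        using of_int_round_abs_le that by (simp add: g_def)
      ultimately have "\<bar>of_int (g i)\<bar> \<le> (of_int b :: real)" using b by linarith
      then have "\<bar>g i\<bar> \<le> b" by linarith
      then show ?thesis by (auto simp: abs_le_iff)
    qed
    then have "g \<in> Pi\<^sub>E {..<N} (\<lambda>_. {-b..b})" by (auto simp: g_def)
    moreover have "cube_centre L N z x = F g"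
      by (intro bcontfun_eqI) (simp add: cube_centre_def F_def g_def)
    ultimately show ?thesis by blast
  qed
  then have "cube_centre L N z ` M \<subseteq> F ` Pi\<^sub>E {..<N} (\<lambda>_. {-b..b})" by blast
  then show ?thesis by (rule finite_subset) (auto intro!: finite_imageI finite_PiE)
qed

text \<open>Where the wave is nonzero, the centre is locally constant. Where it vanishes, the weight
  tends to 0 and the centre stays bounded, so its jumps are invisible.\<close>

lemma continuous_on_weighted_centre:
  assumes L: "L > 0" and M: "bounded M" "M \<subseteq> Rsp N" and \<sigma>: "continuous_on M \<sigma>"
    and zero: "\<And>x. x \<in> M \<Longrightarrow> wave (pi / L) N z x = 0 \<Longrightarrow> \<sigma> x = (0::real)"
  shows "continuous_on M (\<lambda>x. \<sigma> x *\<^sub>R cube_centre L N z x)"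
  unfolding continuous_on_def
proof
  fix x assume x: "x \<in> M"
  have \<sigma>x: "(\<sigma> \<longlongrightarrow> \<sigma> x) (at x within M)" using \<sigma> x by (simp add: continuous_on_def)
  show "((\<lambda>x. \<sigma> x *\<^sub>R cube_centre L N z x) \<longlongrightarrow> \<sigma> x *\<^sub>R cube_centre L N z x) (at x within M)"
  proof (cases "wave (pi / L) N z x = 0")
    case False
    have "eventually (\<lambda>y. cube_centre L N z y = cube_centre L N z x) (at x within M)"
      using cube_centre_locally_constant[OF L False] by (simp add: eventually_at_filter eventually_mono)
    then have "eventually (\<lambda>y. \<sigma> y *\<^sub>R cube_centre L N z x = \<sigma> y *\<^sub>R cube_centre L N z y) (at x within M)"
      by (rule eventually_mono) simp
    moreover have "((\<lambda>y. \<sigma> y *\<^sub>R cube_centre L N z x) \<longlongrightarrow> \<sigma> x *\<^sub>R cube_centre L N z x) (at x within M)"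
      using \<sigma>x by (intro tendsto_intros)
    ultimately show ?thesis by (rule Lim_transform_eventually[rotated])
  next
    case True
    then have \<sigma>0: "\<sigma> x = 0" using zero x by simp
    obtain B where B: "\<And>x. x \<in> M \<Longrightarrow> norm x \<le> B" using M by (auto simp: bounded_iff)
    have bd: "norm (cube_centre L N z y) \<le> B + L / 2" if "y \<in> M" for y
    proof -
      have "norm (cube_centre L N z y) \<le> norm y + norm (cube_centre L N z y - y)" by (rule norm_triangle_sub)
      also have "norm (cube_centre L N z y - y) \<le> L / 2"
        using norm_diff_cube_centre[OF L, of y N z] that M(2) by (simp add: norm_minus_commute subset_iff)
      finally show ?thesis using B[OF that] by linarith
    qed
    have "((\<lambda>y. \<sigma> y *\<^sub>R cube_centre L N z y) \<longlongrightarrow> 0) (at x within M)"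
    proof (rule Lim_null_comparison)
      show "eventually (\<lambda>y. norm (\<sigma> y *\<^sub>R cube_centre L N z y) \<le> \<bar>\<sigma> y\<bar> * (B + L / 2)) (at x within M)"
        using bd by (auto simp: eventually_at_filter intro!: always_eventually mult_left_mono)
      have "((\<lambda>y. \<bar>\<sigma> y\<bar> * (B + L / 2)) \<longlongrightarrow> \<bar>0\<bar> * (B + L / 2)) (at x within M)"
        using \<sigma>x unfolding \<sigma>0 by (intro tendsto_intros)
      then show "((\<lambda>y. \<bar>\<sigma> y\<bar> * (B + L / 2)) \<longlongrightarrow> 0) (at x within M)" by simp
    qed
    then show ?thesis using \<sigma>0 by simp
  qed
qed

text \<open>Capture and the earlier failures are asked for with strict inequalities, so that the
  cells are open. A point on a boundary of one colour has only to lie in a cell of another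
  colour.\<close>

proposition linf_width_le_of_colouring:
  fixes \<zeta> :: "nat \<times> nat \<Rightarrow> nat set" and h :: "nat \<times> nat \<Rightarrow> real"
  assumes L: "L > 0" and n: "n \<ge> 1" and M: "compact M" "M \<noteq> {}" "M \<subseteq> Rsp N"
  defines "f \<equiv> \<lambda>z x. (wave (pi / L) N z x)\<^sup>2"
  assumes h: "\<And>j k. j < n \<Longrightarrow> k < K \<Longrightarrow> h (j, k) \<ge> 0"
    and cover: "\<And>x. x \<in> M \<Longrightarrow> \<exists>j<n. \<exists>k<K. f (\<zeta> (j, k)) x > h (j, k) \<and> (\<forall>l<k. f (\<zeta> (j, l)) x < h (j, l))"
  shows "linf_width n N M \<le> L / 2"
proof -
  define I where "I = {..<n} \<times> {..<K}"
  have I: "finite I" by (simp add: I_def)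
  \<comment> \<open>Positive exactly on the open cell of draw \<open>k\<close> of colour
    \<open>j\<close>; the product over the earlier draws lets the weight fade out continuously at
    the boundary with earlier cells.\<close>
  define \<sigma> where "\<sigma> = (\<lambda>(j,k) x. max 0 (f (\<zeta> (j,k)) x - h (j,k)) * (\<Prod>l<k. max 0 (h (j,l) - f (\<zeta> (j,l)) x)))"
  define v where "v = (\<lambda>i x. cube_centre L N (\<zeta> i) x)"
  have f_cont: "continuous_on S (f z)" for S z unfolding f_def by (intro continuous_intros)
  have \<sigma>_cont: "continuous_on S (\<sigma> i)" for S i
  proof (cases i)
    case (Pair j k)
    then show ?thesis unfolding \<sigma>_def
      by (auto intro!: continuous_on_mult continuous_on_max continuous_on_prod continuous_on_diff continuous_on_const f_cont)
  qed
  have \<sigma>_nn: "\<sigma> i x \<ge> 0" for i x by (cases i) (auto simp: \<sigma>_def intro!: mult_nonneg_nonneg prod_nonneg)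
  have \<sigma>_pos: "\<sigma> (j,k) x > 0 \<longleftrightarrow> f (\<zeta> (j,k)) x > h (j,k) \<and> (\<forall>l<k. f (\<zeta> (j,l)) x < h (j,l))" for j k x
  proof -
    have m: "max 0 a \<noteq> 0 \<longleftrightarrow> a > 0" for a :: real by (auto simp: max_def)
    have "\<sigma> (j,k) x > 0 \<longleftrightarrow> max 0 (f (\<zeta> (j,k)) x - h (j,k)) \<noteq> 0 \<and> (\<Prod>l<k. max 0 (h (j,l) - f (\<zeta> (j,l)) x)) \<noteq> 0"
      using \<sigma>_nn[of "(j,k)" x] by (auto simp: \<sigma>_def less_le)
    also have "\<dots> \<longleftrightarrow> f (\<zeta> (j,k)) x > h (j,k) \<and> (\<forall>l<k. f (\<zeta> (j,l)) x < h (j,l))"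
      by (simp add: m Ball_def)
    finally show ?thesis .
  qed
  define T where "T x = (\<Sum>i\<in>I. \<sigma> i x)" for x
  have T_cont: "continuous_on M T" unfolding T_def by (intro continuous_on_sum \<sigma>_cont)
  have T_pos: "T x > 0" if x: "x \<in> M" for x
  proof -
    obtain j k where "j < n" "k < K" "\<sigma> (j,k) x > 0" using cover[OF x] \<sigma>_pos by blast
    then show ?thesis unfolding T_def using I \<sigma>_nn
      by (intro sum_pos2[of _ "(j,k)"]) (auto simp: I_def)
  qed
  define \<phi> where "\<phi> x = (\<Sum>i\<in>I. (\<sigma> i x / T x) *\<^sub>R v i x)" for x
  have bM: "bounded M" by (rule compact_imp_bounded[OF M(1)])
  have \<phi>_cont: "continuous_on M \<phi>"
    unfolding \<phi>_def v_def
  proof (intro continuous_on_sum continuous_on_weighted_centre L bM M(3))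
    fix i assume i: "i \<in> I"
    have "\<forall>x\<in>M. T x \<noteq> 0" using T_pos by force
    then show "continuous_on M (\<lambda>x. \<sigma> i x / T x)"
      by (intro continuous_on_divide \<sigma>_cont T_cont)
    fix x assume "x \<in> M" "wave (pi / L) N (\<zeta> i) x = 0"
    \<comment> \<open>Thresholds are nonnegative: where the wave vanishes, f = 0 \<le> h, so the
      point is outside the cell.\<close>
    then have "\<not> \<sigma> i x > 0" using h i \<sigma>_pos by (cases i) (auto simp: I_def f_def not_less)
    then have "\<sigma> i x = 0" using \<sigma>_nn[of i x] by simp
    then show "\<sigma> i x / T x = 0" by simp
  qed
  define A where "A x = {i\<in>I. \<sigma> i x > 0}" for x
  have A_card: "card ((\<lambda>i. v i x) ` A x) \<le> n" for x
  proof -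
    \<comment> \<open>Two cells of one colour exclude each other, since the later one demands that
      the earlier draw fail.\<close>
    have "inj_on fst (A x)"
    proof (rule inj_onI)
      fix i i' assume i: "i \<in> A x" "i' \<in> A x" "fst i = fst i'"
      obtain j k k' where jk: "i = (j, k)" "i' = (j, k')" using i(3) by (metis prod.collapse)
      have "\<not> k < k'" "\<not> k' < k" using i(1,2) \<sigma>_pos unfolding A_def jk by (auto dest: less_asym)
      then show "i = i'" by (simp add: jk)
    qed
    moreover have "fst ` A x \<subseteq> {..<n}" by (auto simp: A_def I_def)
    ultimately have "card (A x) \<le> card {..<n}" by (intro card_inj_on_le[of fst]) auto
    moreover have "finite (A x)" using I by (simp add: A_def)
    ultimately show ?thesis using card_image_le[of "A x" "\<lambda>i. v i x"] by simp
  qed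
  have \<phi>_hull: "\<phi> x \<in> convex hull ((\<lambda>i. v i x) ` A x)" if x: "x \<in> M" for x
  proof -
    have "\<phi> x = (\<Sum>i\<in>A x. (\<sigma> i x / T x) *\<^sub>R v i x)"
      unfolding \<phi>_def using I \<sigma>_nn by (intro sum.mono_neutral_right) (auto simp: A_def less_le)
    moreover have "(\<Sum>i\<in>A x. \<sigma> i x / T x) = 1"
    proof -
      have "(\<Sum>i\<in>A x. \<sigma> i x) = T x"
        unfolding T_def using I \<sigma>_nn by (intro sum.mono_neutral_left) (auto simp: A_def less_le)
      then show ?thesis using T_pos[OF x] by (simp add: sum_divide_distrib[symmetric])
    qed
    moreover have "(\<Sum>i\<in>A x. (\<sigma> i x / T x) *\<^sub>R v i x) \<in> convex hull ((\<lambda>i. v i x) ` A x)" if "(\<Sum>i\<in>A x. \<sigma> i x / T x) = 1"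
      using that I \<sigma>_nn T_pos[OF x]
      by (intro convex_sum[OF _ convex_convex_hull]) (auto simp: A_def less_imp_le intro!: hull_inc)
    ultimately show ?thesis by simp
  qed
  have \<phi>_dist: "norm (x - \<phi> x) \<le> L / 2" if x: "x \<in> M" for x
  proof -
    have "(\<lambda>i. v i x) ` A x \<subseteq> cball x (L / 2)"
      using norm_diff_cube_centre[OF L, of x N] x M(3) by (auto simp: v_def dist_norm)
    then have "convex hull ((\<lambda>i. v i x) ` A x) \<subseteq> cball x (L / 2)"
      by (rule hull_minimal) simp
    then show ?thesis using \<phi>_hull[OF x] by (auto simp: dist_norm)
  qed
  define V where "V = (\<Union>i\<in>I. v i ` M)"
  have V: "finite V" "V \<subseteq> Rsp N"
    using I finite_cube_centres[OF L bM] by (auto simp: V_def v_def cube_centre_def)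
  \<comment> \<open>All nondegenerate simplices on at most \<open>n\<close> = (n - 1) + 1 of the
    centres; the family is finite because a bounded set meets only finitely many cubes.\<close>
  define \<S> where "\<S> = {S. S \<subseteq> V \<and> S \<noteq> {} \<and> \<not> affine_dependent S \<and> card S \<le> n}"
  define KK where "KK = (\<Union>S\<in>\<S>. convex hull S)"
  have "finite \<S>" using V(1) by (intro finite_subset[of \<S> "Pow V"]) (auto simp: \<S>_def)
  moreover have "\<forall>S\<in>\<S>. finite S \<and> S \<noteq> {} \<and> S \<subseteq> Rsp N \<and> \<not> affine_dependent S \<and> card S \<le> (n - 1) + 1"
    using V n by (auto simp: \<S>_def intro: finite_subset)
  ultimately have poly: "polyhedron_dim (n - 1) N KK"
    unfolding polyhedron_dim_def KK_def by blast
  have \<phi>_KK: "\<phi> ` M \<subseteq> KK"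
  proof
    fix y assume "y \<in> \<phi> ` M"
    then obtain x where x: "x \<in> M" "y = \<phi> x" by blast
    have fin: "finite ((\<lambda>i. v i x) ` A x)" using I by (simp add: A_def)
    obtain S where S: "S \<subseteq> (\<lambda>i. v i x) ` A x" "\<not> affine_dependent S" "y \<in> convex hull S"
      using convex_hull_affine_independent_subset[OF fin \<phi>_hull[OF x(1)]] x(2) by blast
    have "card S \<le> n" using card_mono[OF fin S(1)] A_card[of x] by linarith
    moreover have "S \<subseteq> V" using S(1) x(1) unfolding V_def A_def by blast
    moreover have "S \<noteq> {}" using S(3) by auto
    ultimately have "S \<in> \<S>" using S(2) by (simp add: \<S>_def)
    then show "y \<in> KK" using S(3) by (auto simp: KK_def)
  qed
  let ?E = "{e. \<exists>K \<phi>. polyhedron_dim (n - 1) N K \<and> continuous_on M \<phi> \<and> \<phi> ` M \<subseteq> K \<and> e = (SUP x\<in>M. norm (x - \<phi> x))}"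
  \<comment> \<open>Real infima and suprema are meaningful for bounded sets only: continuity on the
    compact \<open>M\<close> bounds each displacement, so every candidate is a genuine supremum and
    nonnegative.\<close>
  have "bdd_below ?E"
  proof (rule bdd_belowI[of _ 0])
    fix e assume "e \<in> ?E"
    then obtain \<phi>' where c: "continuous_on M \<phi>'" and e: "e = (SUP x\<in>M. norm (x - \<phi>' x))" by blast
    have "compact ((\<lambda>x. norm (x - \<phi>' x)) ` M)"
      by (intro compact_continuous_image M(1) continuous_intros c)
    then have bd: "bdd_above ((\<lambda>x. norm (x - \<phi>' x)) ` M)" by (intro bounded_imp_bdd_above compact_imp_bounded)
    obtain x where x: "x \<in> M" using M(2) by blast
    have "0 \<le> norm (x - \<phi>' x)" by simp
    also have "\<dots> \<le> e" unfolding e by (rule cSUP_upper[OF x bd])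
    finally show "0 \<le> e" .
  qed
  moreover have "(SUP x\<in>M. norm (x - \<phi> x)) \<in> ?E" using poly \<phi>_cont \<phi>_KK by blast
  ultimately have "linf_width n N M \<le> (SUP x\<in>M. norm (x - \<phi> x))"
    unfolding linf_width_def by (rule cInf_lower[rotated])
  also have "\<dots> \<le> L / 2" using M(2) \<phi>_dist by (rule cSUP_least)
  finally show ?thesis .
qed

section \<open>Probability estimates for tuples of draws\<close>

lemma emeasure_threshold_tuple_le:
  fixes T :: "(nat \<Rightarrow> 'z) \<Rightarrow> (nat \<Rightarrow> real) set"
  assumes Z: "finite Z" "Z \<noteq> {}" and T: "\<And>\<zeta>. \<zeta> \<in> tuples n Z \<Longrightarrow> T \<zeta> \<in> sets (leb n)"
  defines "S \<equiv> {\<omega> \<in> space (iid {..<n} (threshold_measure Z)). \<exists>\<zeta>\<in>tuples n Z.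
     (\<forall>j<n. fst (\<omega> j) = \<zeta> j) \<and> (\<lambda>j\<in>{..<n}. snd (\<omega> j)) \<in> T \<zeta>}"
  shows "S \<in> sets (iid {..<n} (threshold_measure Z))"
    and "emeasure (iid {..<n} (threshold_measure Z)) S \<le> ennreal ((1 / card Z) ^ n) * (\<Sum>\<zeta>\<in>tuples n Z. emeasure (leb n) (T \<zeta>))"
proof -
  let ?P = "tuples n Z"
  let ?Q = "count_space (UNIV::'z set) \<Otimes>\<^sub>M (borel::real measure)"
  have P: "finite ?P" using Z by (auto intro!: finite_PiE)
  have seq: "sets (iid {..<n} (threshold_measure Z)) = sets (iid {..<n} ?Q)"
    by (intro sets_PiM_cong) (auto simp: sets_threshold_measure)
  have speq: "space (iid {..<n} (threshold_measure Z)) = space (iid {..<n} ?Q)"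
    by (rule sets_eq_imp_space_eq[OF seq])
  define A where "A \<zeta> = {\<omega> \<in> space (iid {..<n} ?Q). (\<forall>j\<in>{..<n}. fst (\<omega> j) = \<zeta> j)} \<inter>
    ((\<lambda>\<omega>. \<lambda>j\<in>{..<n}. snd (\<omega> j)) -` T \<zeta> \<inter> space (iid {..<n} ?Q))" for \<zeta> :: "nat \<Rightarrow> 'z"
  have A: "A \<zeta> \<in> sets (iid {..<n} ?Q)" if \<zeta>: "\<zeta> \<in> ?P" for \<zeta>
    unfolding A_def
  proof (rule sets.Int, rule sets.sets_Collect_finite_All)
    fix j assume j: "j \<in> {..<n}"
    have "(\<lambda>\<omega>. fst (\<omega> j)) \<in> measurable (iid {..<n} ?Q) (count_space UNIV)"
      by (rule measurable_compose[OF measurable_component_singleton[OF j] measurable_fst])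
    from measurable_sets[OF this, of "{\<zeta> j}"]
    show "{\<omega> \<in> space (iid {..<n} ?Q). fst (\<omega> j) = \<zeta> j} \<in> sets (iid {..<n} ?Q)"
      by (simp add: vimage_def Int_def conj_commute)
  next
    have "(\<lambda>\<omega>. \<lambda>j\<in>{..<n}. snd (\<omega> j)) \<in> measurable (iid {..<n} ?Q) (leb n)"
    proof (rule measurable_restrict)
      fix j assume j: "j \<in> {..<n}"
      show "(\<lambda>\<omega>. snd (\<omega> j)) \<in> measurable (iid {..<n} ?Q) lborel"
        using measurable_compose[OF measurable_component_singleton[OF j, of "\<lambda>_. ?Q"] measurable_snd] by simp
    qed
    then show "(\<lambda>\<omega>. \<lambda>j\<in>{..<n}. snd (\<omega> j)) -` T \<zeta> \<inter> space (iid {..<n} ?Q) \<in> sets (iid {..<n} ?Q)"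
      by (rule measurable_sets[OF _ T[OF \<zeta>]])
  qed simp
  have S: "S = (\<Union>\<zeta>\<in>?P. A \<zeta>)" unfolding S_def speq A_def by auto
  have SQ: "S \<in> sets (iid {..<n} ?Q)" unfolding S using P A by (intro sets.finite_UN) auto
  then show S': "S \<in> sets (iid {..<n} (threshold_measure Z))" by (simp add: seq)
  have "emeasure (iid {..<n} (threshold_measure Z)) S = (\<integral>\<^sup>+ \<omega>. indicator S \<omega> \<partial>iid {..<n} (threshold_measure Z))"
    using S' by simp
  also have "\<dots> \<le> ennreal ((1 / card Z) ^ n) * (\<Sum>\<zeta>\<in>?P. \<integral>\<^sup>+ h. indicator S (\<lambda>j\<in>{..<n}. (\<zeta> j, h j)) \<partial>leb n)"
    using Z SQ by (intro nn_integral_PiM_threshold_le) auto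
  also have "\<dots> \<le> ennreal ((1 / card Z) ^ n) * (\<Sum>\<zeta>\<in>?P. \<integral>\<^sup>+ h. indicator (T \<zeta>) h \<partial>leb n)"
  proof (intro mult_left_mono sum_mono nn_integral_mono)
    fix \<zeta> h assume \<zeta>: "\<zeta> \<in> ?P" and h: "h \<in> space (leb n)"
    show "indicator S (\<lambda>j\<in>{..<n}. (\<zeta> j, h j)) \<le> (indicator (T \<zeta>) h :: ennreal)"
    proof (cases "(\<lambda>j\<in>{..<n}. (\<zeta> j, h j)) \<in> S")
      case True
      then obtain \<zeta>' where \<zeta>': "\<zeta>' \<in> ?P" "\<forall>j<n. \<zeta> j = \<zeta>' j" "(\<lambda>j\<in>{..<n}. snd ((\<lambda>j\<in>{..<n}. (\<zeta> j, h j)) j)) \<in> T \<zeta>'"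
        by (auto simp: S_def)
      \<comment> \<open>The discrete parts determine the tuple, so only one member of the union over
        all tuples is concerned.\<close>
      have "\<zeta>' = \<zeta>" using \<zeta>'(2) by (intro PiE_ext[OF \<zeta>'(1) \<zeta>]) auto
      moreover have "(\<lambda>j\<in>{..<n}. snd ((\<lambda>j\<in>{..<n}. (\<zeta> j, h j)) j)) = h"
        using h by (auto simp: space_PiM PiE_def extensional_def)
      ultimately have "h \<in> T \<zeta>" using \<zeta>'(3) by simp
      then show ?thesis by (simp add: indicator_def)
    qed simp
  qed auto
  also have "\<dots> = ennreal ((1 / card Z) ^ n) * (\<Sum>\<zeta>\<in>?P. emeasure (leb n) (T \<zeta>))"
    using T by simp
  finally show "emeasure (iid {..<n} (threshold_measure Z)) S \<le> ennreal ((1 / card Z) ^ n) * (\<Sum>\<zeta>\<in>?P. emeasure (leb n) (T \<zeta>))" .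
qed

lemma emeasure_PiM_all_in:
  assumes Q: "prob_space Q" and I: "finite I" "J \<subseteq> I" and U: "U \<in> sets Q" and u: "emeasure Q U \<le> ennreal u" "0 \<le> u"
  defines "B \<equiv> {\<omega> \<in> space (iid I Q). \<forall>i\<in>J. \<omega> i \<in> U}"
  shows "B \<in> sets (iid I Q)" "emeasure (iid I Q) B \<le> ennreal (u ^ card J)"
proof -
  interpret Q: prob_space Q by fact
  interpret product_sigma_finite "\<lambda>_. Q"
    by (intro product_sigma_finite.intro Q.sigma_finite_measure_axioms)
  define X where "X i = (if i \<in> J then U else space Q)" for i
  have B: "B = Pi\<^sub>E I X"
  proof (intro set_eqI iffI)
    fix \<omega> assume "\<omega> \<in> B"
    then show "\<omega> \<in> Pi\<^sub>E I X" by (auto simp: B_def X_def space_PiM PiE_iff)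
  next
    fix \<omega> assume \<omega>: "\<omega> \<in> Pi\<^sub>E I X"
    have "\<omega> i \<in> space Q" if "i \<in> I" for i
      using PiE_mem[OF \<omega> that] sets.sets_into_space[OF U] by (auto simp: X_def split: if_splits)
    moreover have "\<omega> i \<in> U" if "i \<in> J" for i
      using PiE_mem[OF \<omega>, of i] that I by (auto simp: X_def)
    ultimately show "\<omega> \<in> B" using \<omega> by (auto simp: B_def space_PiM PiE_iff)
  qed
  have X: "X i \<in> sets Q" for i using U by (simp add: X_def)
  then show "B \<in> sets (iid I Q)"
    unfolding B using I by (intro sets_PiM_I_finite) auto
  have "emeasure (iid I Q) B = (\<Prod>i\<in>I. emeasure Q (X i))"
    unfolding B using I X by (intro emeasure_PiM) auto
  also have "\<dots> = (\<Prod>i\<in>J. emeasure Q (X i))"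
    by (rule prod.mono_neutral_right) (use I in \<open>auto simp: X_def Q.emeasure_space_1\<close>)
  also have "\<dots> = (\<Prod>i\<in>J. emeasure Q U)" by (intro prod.cong) (auto simp: X_def)
  also have "\<dots> = emeasure Q U ^ card J" by simp
  also have "\<dots> \<le> ennreal (u ^ card J)"
    using power_mono[OF u(1), of "card J"] u(2) by (simp add: ennreal_power)
  finally show "emeasure (iid I Q) B \<le> ennreal (u ^ card J)" .
qed

text \<open>Draws range over the whole type, while a usable outcome may contain only functions from
  \<open>Z\<close> and nonnegative thresholds.\<close>

lemma emeasure_threshold_null:
  assumes Z: "finite Z" "Z \<noteq> {}"
  shows "{q. fst q \<notin> Z \<or> snd q < 0} \<in> sets (threshold_measure Z)"
    and "emeasure (threshold_measure Z) {q. fst q \<notin> Z \<or> snd q < 0} = 0"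
proof -
  let ?A = "{q :: 'a \<times> real. fst q \<notin> Z \<or> snd q < 0}"
  have m: "?A \<in> sets (count_space UNIV \<Otimes>\<^sub>M (borel :: real measure))"
  proof -
    have "?A = (- Z) \<times> UNIV \<union> UNIV \<times> {..<0}" by auto
    then show ?thesis by (auto intro!: sets.Un pair_measureI)
  qed
  then show m': "?A \<in> sets (threshold_measure Z)" by (simp add: sets_threshold_measure)
  have "emeasure (threshold_measure Z) ?A = (\<integral>\<^sup>+ q. indicator ?A q \<partial>threshold_measure Z)"
    using m' by simp
  also have "\<dots> = ennreal (1 / card Z) * (\<Sum>z\<in>Z. \<integral>\<^sup>+ h. indicator ?A (z, h) * indicator {0..1} h \<partial>lborel)"
    using Z m by (intro nn_integral_threshold_measure) auto
  also have "(\<Sum>z\<in>Z. \<integral>\<^sup>+ h. indicator ?A (z, h) * indicator {0..1} h \<partial>lborel) = 0"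
  proof (intro sum.neutral ballI)
    fix z assume "z \<in> Z"
    then have e: "indicator ?A (z, h) * indicator {0..1} h = (0::ennreal)" for h
      by (auto simp: indicator_def)
    show "(\<integral>\<^sup>+ h. indicator ?A (z, h) * indicator {0..1} h \<partial>lborel) = 0"
      unfolding e by simp
  qed
  finally show "emeasure (threshold_measure Z) ?A = 0" by simp
qed

section \<open>Avoiding all boundaries\<close>

text \<open>\<open>T \<zeta>\<close> is a translated slab scaled by (1 + \<epsilon>) r that contains
  the value vectors of all points of \<open>S\<close>. Only thresholds in it can put a point of
  \<open>S\<close> on a boundary in every colour. One neighbourhood works for all \<open>S\<close>
  and \<open>r\<close>, so that compactness of \<open>M\<close> can be applied.\<close>

lemma submanifold_hit_sets:
  assumes M: "closed_submanifold n N M" and p: "p \<in> M" and L: "L > 0" and \<epsilon>: "\<epsilon> > 0"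
  defines "f \<equiv> \<lambda>z x. (wave (pi / L) N z x)\<^sup>2"
  shows "\<exists>U. open U \<and> p \<in> U \<and> (\<forall>S y r. S \<subseteq> M \<inter> U \<longrightarrow> y \<in> S \<longrightarrow> r > 0 \<longrightarrow> (\<forall>x\<in>S. eucl_norm N (x - y) \<le> r) \<longrightarrow>
    (\<exists>T. (\<forall>\<zeta>\<in>tuples n (Pow {..<N}). T \<zeta> \<in> sets (leb n) \<and> (\<forall>x\<in>S. (\<lambda>j\<in>{..<n}. f (\<zeta> j) x) \<in> T \<zeta>))
      \<and> (\<Sum>\<zeta>\<in>tuples n (Pow {..<N}). emeasure (leb n) (T \<zeta>))
         \<le> ennreal (((1 + \<epsilon>) * r) ^ n * (unit_ball_vol (real n) * ((2 * pi / L) ^ n * sqrt (fact n) + \<epsilon>)))))"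
proof -
  let ?Z = "Pow {..<N}"
  let ?P = "tuples n ?Z"
  define g where "g z = wave (pi / L) N z p" for z
  obtain a where fr: "\<And>t. (\<Sum>z\<in>?Z. (dot n (a z) t)\<^sup>2) \<le> (2 * (pi / L))\<^sup>2 * dot n t t"
    and loc: "\<And>\<epsilon>. \<epsilon> > 0 \<Longrightarrow> \<exists>U. open U \<and> p \<in> U \<and> (\<forall>x\<in>M \<inter> U. \<forall>y\<in>M \<inter> U. \<exists>t. dot n t t \<le> ((1 + \<epsilon>) * eucl_norm N (x - y))\<^sup>2
       \<and> (\<forall>z\<in>?Z. \<bar>f z x - f z y - dot n (\<lambda>i. g z * a z i) t\<bar> \<le> \<epsilon> * eucl_norm N (x - y)))"
    unfolding f_def g_def using tangent_frame[OF M p, of "pi / L"] by blast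
  define W where "W \<zeta> = (\<lambda>j i. g (\<zeta> j) * a (\<zeta> j) i)" for \<zeta> :: "nat \<Rightarrow> nat set"
  \<comment> \<open>An excess proportional to the ball volume lets the ball volume factor out of the
    bound.\<close>
  have "\<epsilon> * unit_ball_vol (real n) > 0" using \<epsilon> by simp
  from sum_emeasure_thick_slab_le[of ?Z g "2 * (pi / L)" n a, OF _ _ _ fr this]
  obtain \<eta> where \<eta>: "\<eta> > 0" "(\<Sum>\<zeta>\<in>?P. emeasure (leb n) (slab n (W \<zeta>) 1 \<eta>))
     \<le> ennreal ((2 * (pi / L)) ^ n * sqrt (fact n) * unit_ball_vol (real n) + \<epsilon> * unit_ball_vol (real n))"
    using L unfolding W_def g_def by (auto simp: sum_wave_squares)
  \<comment> \<open>\<epsilon> limits the length of the tangent vector, \<eta> the deviation that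
    the slab tolerates.\<close>
  define e where "e = min \<epsilon> \<eta>"
  have e: "e > 0" "e \<le> \<epsilon>" "e \<le> \<eta>" using \<epsilon> \<eta> by (auto simp: e_def)
  obtain U where U0: "open U \<and> p \<in> U \<and> (\<forall>x\<in>M \<inter> U. \<forall>y\<in>M \<inter> U. \<exists>t. dot n t t \<le> ((1 + e) * eucl_norm N (x - y))\<^sup>2
       \<and> (\<forall>z\<in>?Z. \<bar>f z x - f z y - dot n (\<lambda>i. g z * a z i) t\<bar> \<le> e * eucl_norm N (x - y)))"
    using loc[OF e(1)] by (elim exE)
  note U = U0[THEN conjunct1] U0[THEN conjunct2, THEN conjunct1] U0[THEN conjunct2, THEN conjunct2, rule_format]
  have main: "\<exists>T. (\<forall>\<zeta>\<in>?P. T \<zeta> \<in> sets (leb n) \<and> (\<forall>x\<in>S. (\<lambda>j\<in>{..<n}. f (\<zeta> j) x) \<in> T \<zeta>))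
      \<and> (\<Sum>\<zeta>\<in>?P. emeasure (leb n) (T \<zeta>))
         \<le> ennreal (((1 + \<epsilon>) * r) ^ n * (unit_ball_vol (real n) * ((2 * pi / L) ^ n * sqrt (fact n) + \<epsilon>)))"
    if S: "S \<subseteq> M \<inter> U" "y \<in> S" "r > 0" "\<forall>x\<in>S. eucl_norm N (x - y) \<le> r" for S y r
  proof -
    define R where "R = (1 + \<epsilon>) * r"
    have R: "R > 0" "r \<le> R" using \<epsilon> S(3) by (auto simp: R_def)
    define T where "T \<zeta> = {h \<in> space (leb n). (\<lambda>j\<in>{..<n}. (h j - f (\<zeta> j) y) / R) \<in> slab n (W \<zeta>) 1 \<eta>}" for \<zeta>
    have Tm: "T \<zeta> \<in> sets (leb n)" for \<zeta>
    proof -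
      have "(\<lambda>h. \<lambda>j\<in>{..<n}. (h j - f (\<zeta> j) y) / R) \<in> measurable (leb n) (leb n)" by measurable
      from measurable_sets[OF this slab_measurable] show ?thesis
        by (simp add: T_def vimage_def Int_def conj_commute)
    qed
    have Te: "emeasure (leb n) (T \<zeta>) = ennreal (R ^ n) * emeasure (leb n) (slab n (W \<zeta>) 1 \<eta>)" for \<zeta>
      unfolding T_def by (rule emeasure_affine_vimage[OF R(1) slab_measurable])
    have in_T: "(\<lambda>j\<in>{..<n}. f (\<zeta> j) x) \<in> T \<zeta>" if \<zeta>: "\<zeta> \<in> ?P" and x: "x \<in> S" for \<zeta> x
    proof -
      obtain t where t: "dot n t t \<le> ((1 + e) * eucl_norm N (x - y))\<^sup>2"
        "\<And>z. z \<in> ?Z \<Longrightarrow> \<bar>f z x - f z y - dot n (\<lambda>i. g z * a z i) t\<bar> \<le> e * eucl_norm N (x - y)"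
        using U(3)[of x y] S x by blast
      define t' where "t' = (\<lambda>i. if i < n then t i / R else 0)"
      have dot_t': "dot n w t' = dot n w t / R" for w
        by (simp add: dot_def t'_def sum_divide_distrib)
      have "dot n t' t' = dot n t t / R / R"
        unfolding dot_t' by (simp add: dot_commute[of n t' t] dot_t')
      also have "\<dots> \<le> 1\<^sup>2"
      proof -
        have "(1 + e) * eucl_norm N (x - y) \<le> R"
          unfolding R_def using e \<epsilon> S(4)[rule_format, OF x] by (intro mult_mono) auto
        then have "((1 + e) * eucl_norm N (x - y))\<^sup>2 \<le> R\<^sup>2" using e by (intro power_mono) auto
        then have "dot n t t \<le> R * R" using t(1) by (simp add: power2_eq_square)
        then show ?thesis using R(1) by (simp add: pos_divide_le_eq)
      qed
      finally have "t' \<in> nat_cball n 1" by (simp add: nat_cball_def t'_def)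
      moreover have "\<bar>(f (\<zeta> j) x - f (\<zeta> j) y) / R - dot n (W \<zeta> j) t'\<bar> \<le> \<eta>" if j: "j < n" for j
      proof -
        have "\<bar>f (\<zeta> j) x - f (\<zeta> j) y - dot n (W \<zeta> j) t\<bar> \<le> e * eucl_norm N (x - y)"
          unfolding W_def by (rule t(2)) (use \<zeta> j in auto)
        also have "\<dots> \<le> \<eta> * R" using e \<eta> S(4)[rule_format, OF x] R by (intro mult_mono) auto
        finally have "\<bar>f (\<zeta> j) x - f (\<zeta> j) y - dot n (W \<zeta> j) t\<bar> / R \<le> \<eta>"
          using R by (simp add: pos_divide_le_eq)
        then show ?thesis using R unfolding dot_t'
          by (simp add: diff_divide_distrib[symmetric] abs_divide)
      qed
      ultimately show ?thesis
        by (auto simp: T_def slab_def space_PiM)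
    qed
    have "(\<Sum>\<zeta>\<in>?P. emeasure (leb n) (T \<zeta>)) = ennreal (R ^ n) * (\<Sum>\<zeta>\<in>?P. emeasure (leb n) (slab n (W \<zeta>) 1 \<eta>))"
      by (simp add: Te sum_distrib_left)
    also have "\<dots> \<le> ennreal (R ^ n) * ennreal ((2 * (pi / L)) ^ n * sqrt (fact n) * unit_ball_vol (real n) + \<epsilon> * unit_ball_vol (real n))"
      by (intro mult_left_mono \<eta>(2)) auto
    also have "\<dots> = ennreal (R ^ n * (unit_ball_vol (real n) * ((2 * pi / L) ^ n * sqrt (fact n) + \<epsilon>)))"
      using R by (subst ennreal_mult'[symmetric]) (auto simp: algebra_simps)
    finally show ?thesis using Tm in_T unfolding R_def by (intro exI[of _ T]) blast
  qed
  show ?thesis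
    by (intro exI[of _ U] conjI[OF U(1)] conjI[OF U(2)] allI impI) (rule main)
qed

text \<open>If a draw fails to capture any point whose values are within \<theta> of those at
  \<open>y\<close>, it lies in \<open>U\<close>; the slack replaces all these points by
  \<open>y\<close>. Its price shows in 1 / (1 - u) = card Z / (1 - card Z * \<theta>).\<close>

lemma unhit_event:
  fixes f :: "'z \<Rightarrow> 'a \<Rightarrow> real" and \<theta> :: real
  assumes Z: "finite Z" "Z \<noteq> {}" and f1: "\<And>z. z \<in> Z \<Longrightarrow> f z y \<le> 1" "(\<Sum>z\<in>Z. f z y) = 1" and \<theta>: "0 \<le> \<theta>" "card Z * \<theta> < 1"
  defines "U \<equiv> {q. f (fst q) y - \<theta> \<le> snd q}"
  defines "u \<equiv> 1 - (1 - card Z * \<theta>) / card Z"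
  shows "U \<in> sets (threshold_measure Z)" "emeasure (threshold_measure Z) U \<le> ennreal u" "0 \<le> u" "u < 1"
proof -
  have c: "card Z > 0" using Z by (simp add: card_gt_0_iff)
  have le: "f z y - \<theta> \<le> 1" if "z \<in> Z" for z using f1(1)[OF that] \<theta> by simp
  show "U \<in> sets (threshold_measure Z)" unfolding U_def by (rule emeasure_threshold_ge_le(1)[OF Z le])
  have "(\<Sum>z\<in>Z. f z y - \<theta>) = 1 - card Z * \<theta>" using f1(2) by (simp add: sum_subtractf)
  then show "emeasure (threshold_measure Z) U \<le> ennreal u"
    unfolding U_def u_def using emeasure_threshold_ge_le(2)[where b="\<lambda>z. f z y - \<theta>", OF Z le] by simp
  show "u < 1" using c \<theta> by (simp add: u_def)
  have "real (card Z) \<ge> 1" using c by simp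
  moreover have "card Z * \<theta> \<ge> 0" using \<theta>(1) by simp
  ultimately have "1 - card Z * \<theta> \<le> card Z" by linarith
  then have "(1 - card Z * \<theta>) / card Z \<le> 1" using c by (simp add: pos_divide_le_eq)
  then show "0 \<le> u" by (simp add: u_def)
qed

text \<open>One event serves all points of \<open>S\<close>: the thresholds at the first captures
  lie in some \<open>T \<zeta>\<close>, and the earlier draws lie in the failure event with slack.
  The factor (1 / card Z)^n from choosing the functions is cancelled by (card Z)^n from the waiting
  times, so \<open>N\<close> disappears.\<close>

lemma hit_event:
  fixes f :: "'z \<Rightarrow> 'a \<Rightarrow> real" and n K :: nat and \<theta> :: real
  assumes Z: "finite Z" "Z \<noteq> {}" and f1: "\<And>z. z \<in> Z \<Longrightarrow> f z y \<le> 1" "(\<Sum>z\<in>Z. f z y) = 1" and \<theta>: "0 \<le> \<theta>" "card Z * \<theta> < 1"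
    and close: "\<And>x z. x \<in> S \<Longrightarrow> z \<in> Z \<Longrightarrow> \<bar>f z x - f z y\<bar> \<le> \<theta>"
    and T: "\<And>\<zeta>. \<zeta> \<in> tuples n Z \<Longrightarrow> T \<zeta> \<in> sets (leb n)"
      "\<And>\<zeta> x. \<zeta> \<in> tuples n Z \<Longrightarrow> x \<in> S \<Longrightarrow> (\<lambda>j\<in>{..<n}. f (\<zeta> j) x) \<in> T \<zeta>"
      "(\<Sum>\<zeta>\<in>tuples n Z. emeasure (leb n) (T \<zeta>)) \<le> ennreal t" and t: "t \<ge> 0"
  defines "I \<equiv> {..<n} \<times> {..<K}"
  shows "\<exists>B\<in>sets (iid I (threshold_measure Z)). emeasure (iid I (threshold_measure Z)) B \<le> ennreal (t * (1 / (1 - card Z * \<theta>)) ^ n)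
    \<and> (\<forall>\<omega>\<in>space (iid I (threshold_measure Z)). (\<forall>i\<in>I. fst (\<omega> i) \<in> Z) \<longrightarrow> \<omega> \<notin> B \<longrightarrow>
       \<not> (\<exists>x\<in>S. \<exists>\<kappa>\<in>tuples n {..<K}. \<forall>j<n. f (fst (\<omega> (j, \<kappa> j))) x = snd (\<omega> (j, \<kappa> j)) \<and> (\<forall>l<\<kappa> j. f (fst (\<omega> (j, l))) x < snd (\<omega> (j, l)))))"
proof -
  let ?Q = "threshold_measure Z"
  have c: "card Z > 0" using Z by (simp add: card_gt_0_iff)
  define U where "U = {q. f (fst q) y - \<theta> \<le> snd q}"
  define u where "u = 1 - (1 - card Z * \<theta>) / card Z"
  note U = unhit_event[of Z f y \<theta>, OF Z f1 \<theta>, folded U_def u_def]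
  define A where "A = {\<omega> \<in> space (iid {..<n} ?Q). \<exists>\<zeta>\<in>tuples n Z. (\<forall>j<n. fst (\<omega> j) = \<zeta> j) \<and> (\<lambda>j\<in>{..<n}. snd (\<omega> j)) \<in> T \<zeta>}"
  note A = emeasure_threshold_tuple_le[where T=T and n=n, OF Z T(1), folded A_def]
  define B where "B = {\<omega> \<in> space (iid I ?Q). \<exists>\<kappa>\<in>tuples n {..<K}. (\<lambda>j\<in>{..<n}. \<omega> (j, \<kappa> j)) \<in> A \<and> (\<forall>j<n. \<forall>l<\<kappa> j. \<omega> (j, l) \<in> U)}"
  note B = emeasure_first_hits_le[OF prob_space_threshold_measure A(1) U(1-4), of K, folded I_def, folded B_def]
  have "emeasure (iid I ?Q) B \<le> emeasure (iid {..<n} ?Q) A * ennreal ((1 / (1 - u)) ^ n)" by (rule B(2))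
  also have "\<dots> \<le> (ennreal ((1 / card Z) ^ n) * ennreal t) * ennreal ((1 / (1 - u)) ^ n)"
    by (intro mult_right_mono order_trans[OF A(2)] mult_left_mono T(3)) auto
  also have "\<dots> = ennreal ((1 / card Z) ^ n * t * (1 / (1 - u)) ^ n)"
    using t U(4) by (simp add: ennreal_mult'[symmetric])
  also have "(1 / card Z) ^ n * t * (1 / (1 - u)) ^ n = t * (1 / (1 - card Z * \<theta>)) ^ n"
  proof -
    have e: "1 / (1 - u) = card Z * (1 / (1 - card Z * \<theta>))" by (simp add: u_def)
    have "(1 / (1 - u)) ^ n = real (card Z) ^ n * (1 / (1 - card Z * \<theta>)) ^ n" by (simp only: e power_mult_distrib)
    then show ?thesis using c by (simp add: power_one_over)
  qed
  finally have Bm: "emeasure (iid I ?Q) B \<le> ennreal (t * (1 / (1 - card Z * \<theta>)) ^ n)" .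
  have "\<omega> \<in> B" if \<omega>: "\<omega> \<in> space (iid I ?Q)" "\<forall>i\<in>I. fst (\<omega> i) \<in> Z" and x: "x \<in> S" and \<kappa>: "\<kappa> \<in> tuples n {..<K}"
    and hit: "\<forall>j<n. f (fst (\<omega> (j, \<kappa> j))) x = snd (\<omega> (j, \<kappa> j)) \<and> (\<forall>l<\<kappa> j. f (fst (\<omega> (j, l))) x < snd (\<omega> (j, l)))" for \<omega> x \<kappa>
  proof -
    have \<kappa>I: "(j, l) \<in> I" if "j < n" "l \<le> \<kappa> j" for j l
      using PiE_mem[OF \<kappa>, of j] that by (auto simp: I_def)
    define \<zeta> where "\<zeta> = (\<lambda>j\<in>{..<n}. fst (\<omega> (j, \<kappa> j)))"
    have \<zeta>: "\<zeta> \<in> tuples n Z" using \<omega>(2) \<kappa>I by (auto simp: \<zeta>_def)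
    have "(\<lambda>j\<in>{..<n}. snd ((\<lambda>j\<in>{..<n}. \<omega> (j, \<kappa> j)) j)) = (\<lambda>j\<in>{..<n}. f (\<zeta> j) x)"
      using hit by (auto simp: \<zeta>_def)
    then have "(\<lambda>j\<in>{..<n}. snd ((\<lambda>j\<in>{..<n}. \<omega> (j, \<kappa> j)) j)) \<in> T \<zeta>"
      using T(2)[OF \<zeta> x] by (simp only:)
    moreover have "fst ((\<lambda>j\<in>{..<n}. \<omega> (j, \<kappa> j)) j) = \<zeta> j" if "j < n" for j
      using that by (simp add: \<zeta>_def)
    moreover have "(\<lambda>j\<in>{..<n}. \<omega> (j, \<kappa> j)) \<in> space (iid {..<n} ?Q)"
      by (simp add: space_PiM)
    ultimately have "(\<lambda>j\<in>{..<n}. \<omega> (j, \<kappa> j)) \<in> A"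
      unfolding A_def using \<zeta> by blast
    moreover have "\<omega> (j, l) \<in> U" if "j < n" "l < \<kappa> j" for j l
    proof -
      have "fst (\<omega> (j, l)) \<in> Z" using \<omega>(2) \<kappa>I[of j l] that by auto
      from close[OF x this] hit that show ?thesis by (force simp: U_def abs_le_iff)
    qed
    ultimately show ?thesis using \<omega>(1) \<kappa> by (auto simp: B_def)
  qed
  with B(1) Bm show ?thesis by (intro bexI[of _ B]) blast+
qed

text \<open>With \<open>K\<close> draws for a colour, a point may remain uncaptured. The probability
  decays geometrically in \<open>K\<close>, uniformly over a small piece of
  \<open>M\<close>.\<close>

lemma missed_event:
  fixes f :: "'z \<Rightarrow> 'a \<Rightarrow> real" and n K :: nat and \<theta> :: real
  assumes Z: "finite Z" "Z \<noteq> {}" and f1: "\<And>z. z \<in> Z \<Longrightarrow> f z y \<le> 1" "(\<Sum>z\<in>Z. f z y) = 1" and \<theta>: "0 \<le> \<theta>" "card Z * \<theta> < 1"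
    and close: "\<And>x z. x \<in> S \<Longrightarrow> z \<in> Z \<Longrightarrow> \<bar>f z x - f z y\<bar> \<le> \<theta>" and j: "j < n"
  defines "I \<equiv> {..<n} \<times> {..<K}"
  shows "\<exists>B\<in>sets (iid I (threshold_measure Z)). emeasure (iid I (threshold_measure Z)) B \<le> ennreal ((1 - (1 - card Z * \<theta>) / card Z) ^ K)
    \<and> (\<forall>\<omega>\<in>space (iid I (threshold_measure Z)). (\<forall>i\<in>I. fst (\<omega> i) \<in> Z) \<longrightarrow> \<omega> \<notin> B \<longrightarrow>
       (\<forall>x\<in>S. \<exists>l<K. snd (\<omega> (j, l)) \<le> f (fst (\<omega> (j, l))) x))"
proof -
  let ?Q = "threshold_measure Z"
  define U where "U = {q. f (fst q) y - \<theta> \<le> snd q}"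
  define u where "u = 1 - (1 - card Z * \<theta>) / card Z"
  note U = unhit_event[of Z f y \<theta>, OF Z f1 \<theta>, folded U_def u_def]
  have I: "finite I" "{j} \<times> {..<K} \<subseteq> I" using j by (auto simp: I_def)
  define B where "B = {\<omega> \<in> space (iid I ?Q). \<forall>i\<in>{j} \<times> {..<K}. \<omega> i \<in> U}"
  note B = emeasure_PiM_all_in[OF prob_space_threshold_measure I U(1-3), folded B_def]
  have inB: "\<omega> \<in> B" if \<omega>: "\<omega> \<in> space (iid I ?Q)" "\<forall>i\<in>I. fst (\<omega> i) \<in> Z" and x: "x \<in> S" and m: "\<not> (\<exists>l<K. snd (\<omega> (j, l)) \<le> f (fst (\<omega> (j, l))) x)" for \<omega> x
  proof -
    have "\<omega> (j, l) \<in> U" if l: "l < K" for l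
    proof -
      have "(j, l) \<in> I" using j l by (simp add: I_def)
      then have "fst (\<omega> (j, l)) \<in> Z" using \<omega>(2) by blast
      from close[OF x this] m l show ?thesis by (force simp: U_def abs_le_iff)
    qed
    with \<omega>(1) show ?thesis by (auto simp: B_def)
  qed
  have "\<forall>\<omega>\<in>space (iid I ?Q). (\<forall>i\<in>I. fst (\<omega> i) \<in> Z) \<longrightarrow> \<omega> \<notin> B \<longrightarrow>
       (\<forall>x\<in>S. \<exists>l<K. snd (\<omega> (j, l)) \<le> f (fst (\<omega> (j, l))) x)"
    using inB by blast
  moreover have "emeasure (iid I ?Q) B \<le> ennreal (u ^ K)"
    using B(2) by (simp add: card_cartesian_product_singleton)
  ultimately show ?thesis using B(1) unfolding u_def by blast
qed

text \<open>Continuity at \<epsilon> = 0. The factors belong, in order, to the radius of the tangent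
  ball, the replacement of a diameter by a radius, the thickness of the slabs, the slack in the
  failure events and the excess of the cover.\<close>

lemma small_parameter_exists:
  fixes A H :: real
  assumes "2 ^ n * A * H < 1" "H \<ge> 0"
  shows "\<exists>\<epsilon>>0. \<epsilon> < 1 \<and> (1 + \<epsilon>) ^ n * 2 ^ n * (A + \<epsilon>) * (1 / (1 - \<epsilon>)) ^ n * (H + 2 * \<epsilon>) < 1"
proof -
  have "((\<lambda>\<epsilon>. (1 + \<epsilon>) ^ n * 2 ^ n * (A + \<epsilon>) * (1 / (1 - \<epsilon>)) ^ n * (H + 2 * \<epsilon>))
     \<longlongrightarrow> (1 + 0) ^ n * 2 ^ n * (A + 0) * (1 / (1 - 0)) ^ n * (H + 2 * 0)) (at_right 0)"
    by (intro tendsto_intros) auto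
  moreover have "(1 + 0) ^ n * 2 ^ n * (A + 0) * (1 / (1 - 0)) ^ n * (H + 2 * 0) < 1"
    using assms by simp
  ultimately have "eventually (\<lambda>\<epsilon>. (1 + \<epsilon>) ^ n * 2 ^ n * (A + \<epsilon>) * (1 / (1 - \<epsilon>)) ^ n * (H + 2 * \<epsilon>) < 1) (at_right (0::real))"
    by (rule order_tendstoD(2))
  moreover have "eventually (\<lambda>\<epsilon>. 0 < \<epsilon> \<and> \<epsilon> < 1) (at_right (0::real))"
    by (auto simp: eventually_at_right_field intro: exI[of _ 1])
  ultimately have "eventually (\<lambda>\<epsilon>. 0 < \<epsilon> \<and> \<epsilon> < 1 \<and> (1 + \<epsilon>) ^ n * 2 ^ n * (A + \<epsilon>) * (1 / (1 - \<epsilon>)) ^ n * (H + 2 * \<epsilon>) < 1) (at_right (0::real))"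
    by eventually_elim simp
  from eventually_happens[OF this] show ?thesis by (auto simp: trivial_limit_at_right_real)
qed

text \<open>A covering set may have diameter 0, while the later scaling needs a positive radius; so
  each diameter is enlarged, the \<open>i\<close>-th at cost at most \<epsilon> / 2^(i+1). One
  \<epsilon> pays for this, the other for choosing a nearly optimal cover.\<close>

lemma hausdorff_cover:
  assumes n: "n \<ge> 1" and fin: "hausdorff n N M < top" and \<delta>: "\<delta> > 0" and \<epsilon>: "\<epsilon> > 0"
  obtains C :: "nat \<Rightarrow> pt set" and r :: "nat \<Rightarrow> real" where "M \<subseteq> (\<Union>i. C i)" "\<And>i. r i > 0"
    "\<And>i x y. x \<in> C i \<Longrightarrow> y \<in> C i \<Longrightarrow> eucl_norm N (x - y) \<le> r i"
    "\<And>i x y. x \<in> C i \<Longrightarrow> y \<in> C i \<Longrightarrow> eucl_norm N (x - y) < \<delta>"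
    "(\<Sum>i. ennreal (unit_ball_vol (real n) * (r i / 2) ^ n)) \<le> ennreal (vol n N M + 2 * \<epsilon>)"
proof -
  have "hausdorff_pre n N \<delta> M \<le> hausdorff n N M"
    unfolding hausdorff_def using \<delta> by (intro SUP_upper) auto
  also have "\<dots> = ennreal (vol n N M)" using fin by (simp add: vol_def)
  also have "\<dots> < ennreal (vol n N M + \<epsilon>)" using \<epsilon> by (intro ennreal_lessI add_nonneg_pos) (auto simp: vol_def)
  finally obtain C where C: "M \<subseteq> \<Union> (range C)" "\<And>i. eucl_diam N (C i) < ennreal \<delta>"
    and sum: "(\<Sum>i. ennreal (unit_ball_vol (real n)) * (eucl_diam N (C i) / 2) ^ n) < ennreal (vol n N M + \<epsilon>)"
    unfolding hausdorff_pre_def by (auto simp: INF_less_iff)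
  define d where "d i = enn2real (eucl_diam N (C i))" for i
  have d: "eucl_diam N (C i) = ennreal (d i)" for i
    using C(2)[of i] by (simp add: d_def less_top[symmetric] top.extremum_strict) (metis ennreal_enn2real_if not_less_iff_gr_or_eq top.not_eq_extremum less_trans ennreal_less_top)
  have d0: "d i \<ge> 0" for i by (simp add: d_def)
  have dist: "eucl_norm N (x - y) \<le> d i" if "x \<in> C i" "y \<in> C i" for x y i
  proof -
    have "ennreal (eucl_norm N (x - y)) \<le> eucl_diam N (C i)"
      unfolding eucl_diam_def using that by (meson SUP_upper SUP_upper2)
    then show ?thesis using d d0 by (simp add: ennreal_le_iff)
  qed
  have d\<delta>: "d i < \<delta>" for i using C(2)[of i] d0[of i] unfolding d by (simp add: ennreal_less_iff)
  define \<beta> where "\<beta> = unit_ball_vol (real n)"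
  have "\<exists>r>d i. \<beta> * (r / 2) ^ n < \<beta> * (d i / 2) ^ n + \<epsilon> * (1/2) ^ Suc i" for i
  proof -
    have "((\<lambda>r. \<beta> * (r / 2) ^ n) \<longlongrightarrow> \<beta> * (d i / 2) ^ n) (at_right (d i))"
      by (intro tendsto_intros) auto
    moreover have "\<beta> * (d i / 2) ^ n < \<beta> * (d i / 2) ^ n + \<epsilon> * (1/2) ^ Suc i" using \<epsilon> by simp
    ultimately have "eventually (\<lambda>r. \<beta> * (r / 2) ^ n < \<beta> * (d i / 2) ^ n + \<epsilon> * (1/2) ^ Suc i) (at_right (d i))"
      by (rule order_tendstoD(2))
    moreover have "eventually (\<lambda>r. d i < r) (at_right (d i))"
      by (auto simp: eventually_at_filter)
    ultimately have "eventually (\<lambda>r. d i < r \<and> \<beta> * (r / 2) ^ n < \<beta> * (d i / 2) ^ n + \<epsilon> * (1/2) ^ Suc i) (at_right (d i))"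
      by eventually_elim simp
    from eventually_happens[OF this] show ?thesis by (auto simp: trivial_limit_at_right_real)
  qed
  then obtain r where r: "\<And>i. r i > d i" "\<And>i. \<beta> * (r i / 2) ^ n < \<beta> * (d i / 2) ^ n + \<epsilon> * (1/2) ^ Suc i"
    by metis
  have "(\<Sum>i. ennreal (\<beta> * (r i / 2) ^ n)) \<le> (\<Sum>i. ennreal (\<beta> * (d i / 2) ^ n) + ennreal (\<epsilon> * (1/2) ^ Suc i))"
  proof (intro suminf_le)
    fix i
    have "ennreal (\<beta> * (r i / 2) ^ n) \<le> ennreal (\<beta> * (d i / 2) ^ n + \<epsilon> * (1/2) ^ Suc i)"
      using r(2)[of i] by (intro ennreal_leI) simp
    then show "ennreal (\<beta> * (r i / 2) ^ n) \<le> ennreal (\<beta> * (d i / 2) ^ n) + ennreal (\<epsilon> * (1/2) ^ Suc i)"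
      using \<epsilon> d0 by (subst ennreal_plus[symmetric]) (auto simp: \<beta>_def)
  qed auto
  also have "\<dots> = (\<Sum>i. ennreal (\<beta> * (d i / 2) ^ n)) + (\<Sum>i. ennreal (\<epsilon> * (1/2) ^ Suc i))"
    by (intro suminf_add[symmetric]) auto
  also have "(\<Sum>i. ennreal (\<epsilon> * (1/2) ^ Suc i)) = ennreal \<epsilon>"
  proof -
    have "(\<lambda>i. \<epsilon> * (1/2) ^ Suc i) sums (\<epsilon> * 1)" by (intro sums_mult power_half_series)
    then show ?thesis using \<epsilon> by (intro suminf_ennreal_eq) auto
  qed
  also have "(\<Sum>i. ennreal (\<beta> * (d i / 2) ^ n)) = (\<Sum>i. ennreal \<beta> * (eucl_diam N (C i) / 2) ^ n)"
  proof (rule suminf_cong)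
    fix i
    have "eucl_diam N (C i) / 2 = ennreal (d i / 2)"
      using d[of i] d0[of i] divide_ennreal[of "d i" 2] by simp
    then show "ennreal (\<beta> * (d i / 2) ^ n) = ennreal \<beta> * (eucl_diam N (C i) / 2) ^ n"
      using d0[of i] by (simp add: ennreal_power ennreal_mult \<beta>_def)
  qed
  also have "\<dots> \<le> ennreal (vol n N M + \<epsilon>)" using sum unfolding \<beta>_def by simp
  also have "ennreal (vol n N M + \<epsilon>) + ennreal \<epsilon> = ennreal (vol n N M + 2 * \<epsilon>)"
    using \<epsilon> by (subst ennreal_plus[symmetric]) (auto simp: vol_def)
  finally have "(\<Sum>i. ennreal (unit_ball_vol (real n) * (r i / 2) ^ n)) \<le> ennreal (vol n N M + 2 * \<epsilon>)"
    by (simp add: \<beta>_def add_right_mono)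
  moreover have "r i > 0" for i using r(1)[of i] d0[of i] by linarith
  moreover have "eucl_norm N (x - y) \<le> r i" "eucl_norm N (x - y) < \<delta>" if "x \<in> C i" "y \<in> C i" for x y i
    using dist[OF that] r(1)[of i] d\<delta>[of i] by linarith+
  ultimately show ?thesis using C(1) by (intro that[of C r]) auto
qed

text \<open>First moment method: the bad outcomes have total probability below 1, so some outcome
  avoids them. Bad are the hits of a covering set in all colours at once, the colours that leave a
  point uncaptured, and the null set of unusable draws.\<close>

proposition linf_width_le_half_side:
  assumes M: "closed_submanifold n N M" and n: "n \<ge> 1" and L: "L > 0"
    and small: "2 ^ n * ((2 * pi / L) ^ n * sqrt (fact n)) * vol n N M < 1"
  shows "linf_width n N M \<le> L / 2"
proof -
  define f where "f = (\<lambda>z x. (wave (pi / L) N z x)\<^sup>2)"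
  define Z where "Z = Pow {..<N}"
  define A where "A = (2 * pi / L) ^ n * sqrt (fact n)"
  have A0: "A \<ge> 0" using L by (simp add: A_def)
  have vol0: "vol n N M \<ge> 0" by (simp add: vol_def)
  obtain \<epsilon> where \<epsilon>: "0 < \<epsilon>" "\<epsilon> < 1" and \<epsilon>_small: "(1 + \<epsilon>) ^ n * 2 ^ n * (A + \<epsilon>) * (1 / (1 - \<epsilon>)) ^ n * (vol n N M + 2 * \<epsilon>) < 1"
    using small_parameter_exists[of n A "vol n N M"] small vol0 by (auto simp: A_def)
  have Z: "finite Z" "Z \<noteq> {}" by (auto simp: Z_def)
  have cZ: "card Z > 0" using Z by (simp add: card_gt_0_iff)
  have f_sum: "(\<Sum>z\<in>Z. f z x) = 1" for x unfolding f_def Z_def by (rule sum_wave_squares)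
  have f_le: "f z x \<le> 1" if "z \<in> Z" for z x
    unfolding f_sum[of x, symmetric] using Z that by (intro member_le_sum) (auto simp: f_def)
  have MR: "M \<subseteq> Rsp N" and cM: "compact M" "M \<noteq> {}" using M by (auto simp: closed_submanifold_def)
  \<comment> \<open>Slack whose total over the card Z functions is \<epsilon>.\<close>
  define \<theta> where "\<theta> = \<epsilon> / card Z"
  have \<theta>: "\<theta> > 0" "card Z * \<theta> = \<epsilon>" using cZ \<epsilon> by (auto simp: \<theta>_def)
  define PU where "PU p U \<longleftrightarrow> open U \<and> p \<in> U \<and> (\<forall>S y r. S \<subseteq> M \<inter> U \<longrightarrow> y \<in> S \<longrightarrow> r > 0 \<longrightarrow> (\<forall>x\<in>S. eucl_norm N (x - y) \<le> r) \<longrightarrow>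
    (\<exists>T. (\<forall>\<zeta>\<in>tuples n Z. T \<zeta> \<in> sets (leb n) \<and> (\<forall>x\<in>S. (\<lambda>j\<in>{..<n}. f (\<zeta> j) x) \<in> T \<zeta>))
      \<and> (\<Sum>\<zeta>\<in>tuples n Z. emeasure (leb n) (T \<zeta>))
         \<le> ennreal (((1 + \<epsilon>) * r) ^ n * (unit_ball_vol (real n) * (A + \<epsilon>)))))" for p U
  have "\<forall>p\<in>M. \<exists>U. PU p U"
    unfolding PU_def A_def Z_def f_def using submanifold_hit_sets[OF M _ L \<epsilon>(1)] by simp
  from bchoice[OF this] obtain U where U: "\<And>p. p \<in> M \<Longrightarrow> PU p (U p)" by blast
  have "M \<subseteq> \<Union> (U ` M)" "\<And>B. B \<in> U ` M \<Longrightarrow> open B" using U by (auto simp: PU_def)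
  \<comment> \<open>Lebesgue number: the part in \<open>M\<close> of a covering set of smaller
    diameter lies in a single neighbourhood \<open>U p\<close>.\<close>
  then obtain \<delta>1 where \<delta>1: "\<delta>1 > 0" "\<And>y. y \<in> M \<Longrightarrow> \<exists>B\<in>U ` M. ball y \<delta>1 \<subseteq> B"
    using Heine_Borel_lemma[OF cM(1), of "U ` M"] by blast
  have "\<exists>\<delta>>0. \<forall>x\<in>M. \<forall>y\<in>M. dist x y < \<delta> \<longrightarrow> \<bar>f z x - f z y\<bar> \<le> \<theta>" for z
  proof -
    have "continuous_on M (f z)" unfolding f_def by (intro continuous_intros)
    from compact_uniformly_continuous[OF this cM(1)] \<theta>(1) show ?thesis
      unfolding uniformly_continuous_on_def dist_real_def by (metis less_imp_le)
  qed
  then obtain \<Delta> where \<Delta>: "\<And>z. \<Delta> z > 0" "\<And>z x y. x \<in> M \<Longrightarrow> y \<in> M \<Longrightarrow> dist x y < \<Delta> z \<Longrightarrow> \<bar>f z x - f z y\<bar> \<le> \<theta>"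
    by metis
  define \<delta> where "\<delta> = Min (insert \<delta>1 (\<Delta> ` Z))"
  have \<delta>: "\<delta> > 0" "\<delta> \<le> \<delta>1" "\<And>z. z \<in> Z \<Longrightarrow> \<delta> \<le> \<Delta> z"
    unfolding \<delta>_def using Z \<delta>1(1) \<Delta>(1) by (auto simp: Min_gr_iff simp del: Min_insert intro!: Min_le)
  have close: "\<bar>f z x - f z y\<bar> \<le> \<theta>" if "x \<in> M" "y \<in> M" "dist x y < \<delta>" "z \<in> Z" for x y z
    using \<Delta>(2)[OF that(1,2), of z] \<delta>(3)[OF that(4)] that(3) by linarith
  obtain C r where C: "M \<subseteq> (\<Union>i. C i)" and r: "\<And>i. r i > 0"
    and Cr: "\<And>i x y. x \<in> C i \<Longrightarrow> y \<in> C i \<Longrightarrow> eucl_norm N (x - y) \<le> r i"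
    and C\<delta>: "\<And>i x y. x \<in> C i \<Longrightarrow> y \<in> C i \<Longrightarrow> eucl_norm N (x - y) < \<delta>"
    and Csum: "(\<Sum>i. ennreal (unit_ball_vol (real n) * (r i / 2) ^ n)) \<le> ennreal (vol n N M + 2 * \<epsilon>)"
    using hausdorff_cover[OF n hausdorff_submanifold_finite[OF M n] \<delta>(1) \<epsilon>(1)] by metis
  have dist_le: "dist x y \<le> eucl_norm N (x - y)" if "x \<in> M" "y \<in> M" for x y
    unfolding dist_norm using that MR by (intro norm_le_eucl Rsp_diff) auto
  define F where "F = (1 + \<epsilon>) ^ n * 2 ^ n * (A + \<epsilon>) * (1 / (1 - \<epsilon>)) ^ n"
  have F0: "F \<ge> 0" using \<epsilon> A0 by (simp add: F_def)
  define u where "u = 1 - (1 - \<epsilon>) / card Z"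
  have u: "0 \<le> u" "u < 1"
    using unhit_event(3,4)[where Z=Z and f=f and y=undefined and \<theta>=\<theta>, OF Z f_le f_sum] \<theta> \<epsilon> by (auto simp: u_def)
  obtain P where P: "P \<subseteq> M" "finite P" "M \<subseteq> (\<Union>y\<in>P. ball y \<delta>)"
    using cM(1) \<delta>(1) by (elim compactE_image[of M M "\<lambda>y. ball y \<delta>"]) auto
  \<comment> \<open>Probability left over by the boundary hits. \<open>K\<close> can be chosen
    against it, since neither this bound nor the finite set \<open>P\<close> depends on
    \<open>K\<close>.\<close>
  define \<tau> where "\<tau> = 1 - F * (vol n N M + 2 * \<epsilon>)"
  have \<tau>: "\<tau> > 0" using \<epsilon>_small by (simp add: \<tau>_def F_def)
  have "(\<lambda>K. real n * real (card P) * u ^ K) \<longlonglongrightarrow> real n * real (card P) * 0"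
    using u by (intro tendsto_intros LIMSEQ_realpow_zero)
  from order_tendstoD(2)[OF this, of \<tau>] \<tau>
  have "eventually (\<lambda>K. real n * real (card P) * u ^ K < \<tau>) sequentially" by simp
  then obtain K where K: "real n * real (card P) * u ^ K < \<tau>" by (auto simp: eventually_sequentially)
  define I where "I = {..<n} \<times> {..<K}"
  have I: "finite I" by (simp add: I_def)
  define \<Omega> where "\<Omega> = iid I (threshold_measure Z)"
  interpret \<Omega>: prob_space \<Omega>
    unfolding \<Omega>_def by (intro prob_space_PiM prob_space_threshold_measure)
  define ok where "ok \<omega> \<longleftrightarrow> (\<forall>i\<in>I. fst (\<omega> i) \<in> Z)" for \<omega> :: "nat \<times> nat \<Rightarrow> nat set \<times> real"
  define hit where "hit x \<omega> \<longleftrightarrow> (\<exists>\<kappa>\<in>tuples n {..<K}. \<forall>j<n. f (fst (\<omega> (j, \<kappa> j))) x = snd (\<omega> (j, \<kappa> j)) \<and> (\<forall>l<\<kappa> j. f (fst (\<omega> (j, l))) x < snd (\<omega> (j, l))))"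
    for x and \<omega> :: "nat \<times> nat \<Rightarrow> nat set \<times> real"
  have "\<exists>B\<in>sets \<Omega>. emeasure \<Omega> B \<le> ennreal (F * (unit_ball_vol (real n) * (r i / 2) ^ n)) \<and> (\<forall>\<omega>\<in>space \<Omega>. ok \<omega> \<longrightarrow> \<omega> \<notin> B \<longrightarrow> \<not> (\<exists>x\<in>C i \<inter> M. hit x \<omega>))" for i
  proof (cases "C i \<inter> M = {}")
    case True
    then show ?thesis by (intro bexI[of _ "{}"]) auto
  next
    case False
    then obtain y where y: "y \<in> C i" "y \<in> M" by blast
    obtain p where p: "p \<in> M" "ball y \<delta>1 \<subseteq> U p" using \<delta>1(2)[OF y(2)] by blast
    have near: "dist x y < \<delta>" if "x \<in> C i \<inter> M" for x
      using dist_le[of x y] C\<delta>[of x i y] that y by auto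
    have sub: "C i \<inter> M \<subseteq> M \<inter> U p"
      using near p(2) \<delta>(2) by (force simp: dist_commute)
    define t where "t = ((1 + \<epsilon>) * r i) ^ n * (unit_ball_vol (real n) * (A + \<epsilon>))"
    have "\<exists>T. (\<forall>\<zeta>\<in>tuples n Z. T \<zeta> \<in> sets (leb n) \<and> (\<forall>x\<in>C i \<inter> M. (\<lambda>j\<in>{..<n}. f (\<zeta> j) x) \<in> T \<zeta>))
      \<and> (\<Sum>\<zeta>\<in>tuples n Z. emeasure (leb n) (T \<zeta>)) \<le> ennreal t"
      unfolding t_def
      by (rule U[OF p(1), unfolded PU_def, THEN conjunct2, THEN conjunct2, THEN spec, THEN spec, THEN spec, THEN mp, THEN mp, THEN mp, THEN mp])
        (use sub y r Cr in auto)
    then obtain T where T: "\<And>\<zeta>. \<zeta> \<in> tuples n Z \<Longrightarrow> T \<zeta> \<in> sets (leb n)"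
      "\<And>\<zeta> x. \<zeta> \<in> tuples n Z \<Longrightarrow> x \<in> C i \<inter> M \<Longrightarrow> (\<lambda>j\<in>{..<n}. f (\<zeta> j) x) \<in> T \<zeta>"
      "(\<Sum>\<zeta>\<in>tuples n Z. emeasure (leb n) (T \<zeta>)) \<le> ennreal t"
      by blast
    have t0: "t \<ge> 0" using \<epsilon> A0 r[of i] by (simp add: t_def)
    \<comment> \<open>Writing r = 2 (r / 2) to reach the Hausdorff summand produces the factor 2^n
      in \<open>F\<close>.\<close>
    have "t * (1 / (1 - card Z * \<theta>)) ^ n = F * (unit_ball_vol (real n) * (r i / 2) ^ n)"
      unfolding t_def F_def \<theta>(2) by (simp add: power_mult_distrib power_divide)
    with hit_event[where Z=Z and f=f and y=y and \<theta>=\<theta> and S="C i \<inter> M" and n=n and T=T and t=t and K=K, OF Z f_le f_sum _ _ _ T t0]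
    show ?thesis
      using \<theta> \<epsilon> near close y by (simp add: \<Omega>_def I_def hit_def ok_def less_imp_le)
  qed
  then obtain B where B: "\<And>i. B i \<in> sets \<Omega>" "\<And>i. emeasure \<Omega> (B i) \<le> ennreal (F * (unit_ball_vol (real n) * (r i / 2) ^ n))"
    "\<And>i \<omega> x. \<omega> \<in> space \<Omega> \<Longrightarrow> ok \<omega> \<Longrightarrow> \<omega> \<notin> B i \<Longrightarrow> x \<in> C i \<inter> M \<Longrightarrow> \<not> hit x \<omega>"
    by metis
  have "\<exists>G\<in>sets \<Omega>. emeasure \<Omega> G \<le> ennreal (u ^ K) \<and> (\<forall>\<omega>\<in>space \<Omega>. ok \<omega> \<longrightarrow> \<omega> \<notin> G \<longrightarrow> (\<forall>x\<in>M \<inter> ball y \<delta>. \<exists>l<K. snd (\<omega> (j, l)) \<le> f (fst (\<omega> (j, l))) x))"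
    if "y \<in> P" "j < n" for y j
  proof -
    have y: "y \<in> M" using that P by auto
    show ?thesis
      using missed_event[where Z=Z and f=f and y=y and \<theta>=\<theta> and S="M \<inter> ball y \<delta>" and n=n and K=K and j=j, OF Z f_le f_sum]
        \<theta> \<epsilon> close y \<open>j < n\<close> by (simp add: \<Omega>_def I_def ok_def u_def less_imp_le dist_commute)
  qed
  then have "\<exists>G\<in>sets \<Omega>. i \<in> P \<times> {..<n} \<longrightarrow> emeasure \<Omega> G \<le> ennreal (u ^ K) \<and> (\<forall>\<omega>\<in>space \<Omega>. ok \<omega> \<longrightarrow> \<omega> \<notin> G \<longrightarrow> (\<forall>x\<in>M \<inter> ball (fst i) \<delta>. \<exists>l<K. snd (\<omega> (snd i, l)) \<le> f (fst (\<omega> (snd i, l))) x))" for i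
    by (cases "i \<in> P \<times> {..<n}") auto
  then obtain G where G: "\<And>i. G i \<in> sets \<Omega>" "\<And>i. i \<in> P \<times> {..<n} \<Longrightarrow> emeasure \<Omega> (G i) \<le> ennreal (u ^ K)"
    "\<And>i \<omega> x. i \<in> P \<times> {..<n} \<Longrightarrow> \<omega> \<in> space \<Omega> \<Longrightarrow> ok \<omega> \<Longrightarrow> \<omega> \<notin> G i \<Longrightarrow> x \<in> M \<inter> ball (fst i) \<delta> \<Longrightarrow> \<exists>l<K. snd (\<omega> (snd i, l)) \<le> f (fst (\<omega> (snd i, l))) x"
    by metis
  define Nn where "Nn i = {\<omega> \<in> space \<Omega>. \<omega> i \<in> {q. fst q \<notin> Z \<or> snd q < 0}}" for i
  have Nn: "Nn i \<in> sets \<Omega>" "emeasure \<Omega> (Nn i) = 0" if "i \<in> I" for i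
    using emeasure_PiM_all_in[of "threshold_measure Z" I "{i}" "{q. fst q \<notin> Z \<or> snd q < 0}" 0]
      prob_space_threshold_measure I that emeasure_threshold_null[OF Z] by (auto simp: Nn_def \<Omega>_def)
  define Bad where "Bad = (\<Union>i. B i) \<union> (\<Union>i\<in>P \<times> {..<n}. G i) \<union> (\<Union>i\<in>I. Nn i)"
  have finPn: "finite (P \<times> {..<n})" using P by auto
  have m1: "(\<Union>i. B i) \<in> sets \<Omega>" "(\<Union>i\<in>P \<times> {..<n}. G i) \<in> sets \<Omega>" "(\<Union>i\<in>I. Nn i) \<in> sets \<Omega>"
    using B(1) G(1) Nn(1) I finPn by (auto intro!: sets.finite_UN)
  have e1: "emeasure \<Omega> (\<Union>i. B i) \<le> ennreal (F * (vol n N M + 2 * \<epsilon>))"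
  proof -
    have "emeasure \<Omega> (\<Union>i. B i) \<le> (\<Sum>i. emeasure \<Omega> (B i))"
      using B(1) by (intro emeasure_subadditive_countably) auto
    also have "\<dots> \<le> (\<Sum>i. ennreal F * ennreal (unit_ball_vol (real n) * (r i / 2) ^ n))"
      using B(2) F0 r by (intro suminf_le) (auto simp: ennreal_mult'[symmetric])
    also have "\<dots> = ennreal F * (\<Sum>i. ennreal (unit_ball_vol (real n) * (r i / 2) ^ n))"
      by (rule ennreal_suminf_cmult)
    also have "\<dots> \<le> ennreal F * ennreal (vol n N M + 2 * \<epsilon>)" by (intro mult_left_mono Csum) auto
    also have "\<dots> = ennreal (F * (vol n N M + 2 * \<epsilon>))" using F0 by (simp add: ennreal_mult')
    finally show ?thesis .
  qed
  have e2: "emeasure \<Omega> (\<Union>i\<in>P \<times> {..<n}. G i) \<le> ennreal (real n * real (card P) * u ^ K)"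
  proof -
    have "emeasure \<Omega> (\<Union>i\<in>P \<times> {..<n}. G i) \<le> (\<Sum>i\<in>P \<times> {..<n}. emeasure \<Omega> (G i))"
      using G(1) finPn by (intro emeasure_subadditive_finite) auto
    also have "\<dots> \<le> (\<Sum>i\<in>P \<times> {..<n}. ennreal (u ^ K))" by (intro sum_mono G(2))
    also have "\<dots> = ennreal (real n * real (card P) * u ^ K)"
      using u by (simp add: card_cartesian_product ennreal_of_nat_eq_real_of_nat ennreal_mult'[symmetric] mult_ac)
    finally show ?thesis .
  qed
  have e3: "emeasure \<Omega> (\<Union>i\<in>I. Nn i) = 0"
  proof -
    have "emeasure \<Omega> (\<Union>i\<in>I. Nn i) \<le> (\<Sum>i\<in>I. emeasure \<Omega> (Nn i))"
      using Nn(1) I by (intro emeasure_subadditive_finite) auto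
    then show ?thesis using Nn(2) by simp
  qed
  have "emeasure \<Omega> Bad \<le> emeasure \<Omega> (\<Union>i. B i) + emeasure \<Omega> (\<Union>i\<in>P \<times> {..<n}. G i) + emeasure \<Omega> (\<Union>i\<in>I. Nn i)"
    unfolding Bad_def using m1
    by (meson add_right_mono emeasure_subadditive order_trans sets.Un)
  also have "\<dots> \<le> ennreal (F * (vol n N M + 2 * \<epsilon>)) + ennreal (real n * real (card P) * u ^ K)"
    unfolding e3 using e1 e2 by (simp add: add_mono)
  also have "\<dots> = ennreal (F * (vol n N M + 2 * \<epsilon>) + real n * real (card P) * u ^ K)"
    using F0 vol0 \<epsilon> u by (subst ennreal_plus) auto
  also have "\<dots> < 1" using K F0 vol0 \<epsilon> u unfolding \<tau>_def by (subst ennreal_1[symmetric], intro ennreal_lessI) auto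
  finally have "emeasure \<Omega> Bad < emeasure \<Omega> (space \<Omega>)" by (simp add: \<Omega>.emeasure_space_1)
  then have "\<not> space \<Omega> \<subseteq> Bad" using m1 emeasure_mono[of "space \<Omega>" Bad \<Omega>] by (auto simp: Bad_def not_le[symmetric])
  then obtain \<omega> where \<omega>: "\<omega> \<in> space \<Omega>" "\<omega> \<notin> Bad" by blast
  have \<omega>I: "fst (\<omega> i) \<in> Z \<and> snd (\<omega> i) \<ge> 0" if "i \<in> I" for i
    using \<omega> that by (auto simp: Bad_def Nn_def not_less)
  then have ok: "ok \<omega>" by (simp add: ok_def)
  show ?thesis
  proof (rule linf_width_le_of_colouring[OF L n cM MR, where \<zeta>="\<lambda>i. fst (\<omega> i)" and h="\<lambda>i. snd (\<omega> i)" and K=K])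
    fix j k assume "j < n" "k < K"
    then show "0 \<le> snd (\<omega> (j, k))" using \<omega>I[of "(j, k)"] by (simp add: I_def)
  next
    fix x assume x: "x \<in> M"
    show "\<exists>j<n. \<exists>k<K. snd (\<omega> (j, k)) < (wave (pi / L) N (fst (\<omega> (j, k))) x)\<^sup>2 \<and> (\<forall>l<k. (wave (pi / L) N (fst (\<omega> (j, l))) x)\<^sup>2 < snd (\<omega> (j, l)))"
    proof (rule ccontr)
      assume not: "\<not> ?thesis"
      obtain y where y: "y \<in> P" "x \<in> ball y \<delta>" using P(3) x by blast
      \<comment> \<open>First draw of each colour that captures \<open>x\<close> weakly. If no
        colour captures \<open>x\<close> strictly, equality holds at all these draws, and that is a
        hit.\<close>
      define \<kappa> where "\<kappa> = (\<lambda>j\<in>{..<n}. LEAST l. l < K \<and> snd (\<omega> (j, l)) \<le> f (fst (\<omega> (j, l))) x)"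
      have \<kappa>: "\<kappa> j < K \<and> f (fst (\<omega> (j, \<kappa> j))) x = snd (\<omega> (j, \<kappa> j)) \<and> (\<forall>l<\<kappa> j. f (fst (\<omega> (j, l))) x < snd (\<omega> (j, l)))" if j: "j < n" for j
      proof -
        have "\<omega> \<notin> G (y, j)" using \<omega>(2) y(1) j by (auto simp: Bad_def)
        then have ex: "\<exists>l. l < K \<and> snd (\<omega> (j, l)) \<le> f (fst (\<omega> (j, l))) x"
          using G(3)[of "(y, j)" \<omega> x] y x j \<omega>(1) ok by auto
        have \<kappa>j: "\<kappa> j = (LEAST l. l < K \<and> snd (\<omega> (j, l)) \<le> f (fst (\<omega> (j, l))) x)" using j by (simp add: \<kappa>_def)
        have 1: "\<kappa> j < K" "snd (\<omega> (j, \<kappa> j)) \<le> f (fst (\<omega> (j, \<kappa> j))) x"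
          using LeastI_ex[OF ex] unfolding \<kappa>j by auto
        have 2: "f (fst (\<omega> (j, l))) x < snd (\<omega> (j, l))" if "l < \<kappa> j" for l
        proof -
          have "l < K" using that 1 by simp
          then show ?thesis using not_less_Least[of l "\<lambda>l. l < K \<and> snd (\<omega> (j, l)) \<le> f (fst (\<omega> (j, l))) x"] that unfolding \<kappa>j by auto
        qed
        have "\<not> snd (\<omega> (j, \<kappa> j)) < f (fst (\<omega> (j, \<kappa> j))) x"
          using not j 1(1) 2 unfolding f_def by blast
        with 1 2 show ?thesis by auto
      qed
      have "\<kappa> \<in> tuples n {..<K}" using \<kappa> by (auto simp: \<kappa>_def)
      then have "hit x \<omega>" using \<kappa> unfolding hit_def by blast
      moreover obtain i where "x \<in> C i" using C x by blast
      moreover have "\<omega> \<notin> B i" using \<omega>(2) by (auto simp: Bad_def)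
      ultimately show False using B(3)[OF \<omega>(1) ok, of i x] x by blast
    qed
  qed
qed

section \<open>Asymptotics of the constant\<close>

text \<open>n^n / n! is a single term of the exponential series for exp n.\<close>

lemma fact_ge_power_exp: "(real n / exp 1) ^ n \<le> fact n"
proof -
  have "real n ^ n / fact n \<le> exp (real n)"
  proof -
    have "(\<lambda>k. real n ^ k / fact k) sums exp (real n)"
      using exp_converges[of "real n"] by (simp add: divide_inverse mult.commute)
    then have "(\<Sum>k\<in>{n}. real n ^ k / fact k) \<le> exp (real n)"
      using sum_le_suminf[of "\<lambda>k. real n ^ k / fact k" "{n}"] by (auto simp: sums_iff)
    then show ?thesis by simp
  qed
  then show ?thesis
    by (simp add: power_divide exp_of_nat_mult[symmetric] field_simps)
qed

text \<open>The induction step is (1 + 1/n)^(n+1) \<ge> e, which comes from ln x \<le> x - 1 at x =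
  n / (n + 1). The polynomial factor tends to 1 under the \<open>n\<close>-th root.\<close>

lemma fact_le_power_exp:
  assumes "n \<ge> 1"
  shows "fact n \<le> exp 1 * real n * (real n / exp 1) ^ n"
  using assms
proof (induction n rule: dec_induct)
  case (step n)
  have n: "real n > 0" using step by simp
  have "exp 1 \<le> ((real n + 1) / real n) ^ (n + 1)"
  proof -
    have "ln (real n / (real n + 1)) \<le> real n / (real n + 1) - 1" using n by (intro ln_le_minus_one) auto
    also have "\<dots> = - 1 / (real n + 1)" by (simp add: field_simps)
    finally have "1 / (real n + 1) \<le> ln ((real n + 1) / real n)"
      using n by (simp add: ln_div)
    then have "1 \<le> (real n + 1) * ln ((real n + 1) / real n)" using n by (simp add: field_simps)
    also have "\<dots> = ln (((real n + 1) / real n) ^ (n + 1))"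
      using n by (subst ln_realpow) auto
    finally show ?thesis using n by (subst (asm) ln_ge_iff) auto
  qed
  then have "exp 1 * real n ^ (n + 1) \<le> (real n + 1) ^ (n + 1)"
    using n by (simp add: power_divide pos_le_divide_eq)
  then have "exp 1 * real n ^ (n + 1) / exp 1 ^ n \<le> (real n + 1) ^ (n + 1) / exp 1 ^ n"
    by (intro divide_right_mono) auto
  moreover have "exp 1 * real n ^ (n + 1) / exp 1 ^ n = exp 1 * real n * (real n / exp 1) ^ n"
    by (simp add: power_divide)
  moreover have "(real n + 1) ^ (n + 1) / exp 1 ^ n = exp 1 * ((real n + 1) / exp 1) ^ (n + 1)"
    by (simp add: power_divide)
  ultimately have "exp 1 * real n * (real n / exp 1) ^ n \<le> exp 1 * ((real n + 1) / exp 1) ^ (n + 1)"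
    by linarith
  then have "fact n \<le> exp 1 * ((real n + 1) / exp 1) ^ (n + 1)"
    using step.IH by linarith
  then have "(real n + 1) * fact n \<le> (real n + 1) * (exp 1 * ((real n + 1) / exp 1) ^ (n + 1))"
    by (intro mult_left_mono) auto
  then show ?case by (simp add: algebra_simps)
qed simp

lemma powr_inverse_power: "x \<ge> 0 \<Longrightarrow> n \<ge> 1 \<Longrightarrow> (x powr (1 / real n)) ^ n = (x::real)"
  by (cases "x = 0") (auto simp: powr_power)

lemma fact_root_limit: "(\<lambda>n. fact n powr (1 / real n) / real n) \<longlonglongrightarrow> 1 / exp 1"
proof (rule tendsto_sandwich)
  have root: "((real n / exp 1) ^ n) powr (1 / real n) = real n / exp 1" if "n \<ge> 1" for n
    using that by (simp add: powr_realpow[symmetric] powr_powr)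
  show "eventually (\<lambda>n. 1 / exp 1 \<le> fact n powr (1 / real n) / real n) sequentially"
    using eventually_ge_at_top[of 1]
  proof eventually_elim
    case (elim n)
    have "((real n / exp 1) ^ n) powr (1 / real n) \<le> fact n powr (1 / real n)"
      by (intro powr_mono2 fact_ge_power_exp) auto
    then have "real n / exp 1 \<le> fact n powr (1 / real n)" by (simp only: root[OF elim])
    then show ?case using elim by (simp add: field_simps)
  qed
  show "eventually (\<lambda>n. fact n powr (1 / real n) / real n \<le> (exp 1 * real n) powr (1 / real n) / exp 1) sequentially"
    using eventually_ge_at_top[of 1]
  proof eventually_elim
    case (elim n)
    have "fact n powr (1 / real n) \<le> (exp 1 * real n * (real n / exp 1) ^ n) powr (1 / real n)"
      using fact_le_power_exp[OF elim] by (intro powr_mono2) auto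
    also have "\<dots> = (exp 1 * real n) powr (1 / real n) * (real n / exp 1)"
      using root[OF elim] by (simp add: powr_mult)
    finally show ?case using elim by (simp add: field_simps)
  qed
  show "(\<lambda>n. 1 / exp 1 :: real) \<longlonglongrightarrow> 1 / exp 1" by simp
  have "(\<lambda>n. (exp 1 * real n) powr (1 / real n) / exp 1) \<longlonglongrightarrow> inverse (exp 1)" by real_asymp
  then show "(\<lambda>n. (exp 1 * real n) powr (1 / real n) / exp 1) \<longlonglongrightarrow> 1 / exp 1"
    by (simp add: inverse_eq_divide)
qed

theorem theorem1p1:
  shows "\<exists>C :: nat \<Rightarrow> real.
     (\<forall>n\<ge>1. C n > 0) \<and> bdd_above (C ` {1..}) \<and>
     C \<longlonglongrightarrow> 2 * pi / sqrt (exp 1) \<and>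
     (\<forall>n N M. 1 \<le> n \<longrightarrow> n < N \<longrightarrow> closed_submanifold n N M \<longrightarrow>
        linf_width n N M \<le> C n * sqrt (real n) * vol n N M powr (1 / real n))"
proof -
  \<comment> \<open>Makes C n sqrt(n) V^(1/n) equal to 2 pi (sqrt(n!))^(1/n) V^(1/n), half of the
    critical side length in \<open>linf_width_le_half_side\<close>.\<close>
  define C where "C n = 2 * pi * sqrt (fact n powr (1 / real n) / real n)" for n :: nat
  have "C n > 0" if "n \<ge> 1" for n using that by (simp add: C_def)
  moreover have lim: "C \<longlonglongrightarrow> 2 * pi / sqrt (exp 1)"
  proof -
    have "C \<longlonglongrightarrow> 2 * pi * sqrt (1 / exp 1)"
      unfolding C_def by (intro tendsto_intros fact_root_limit)
    then show ?thesis by (simp add: real_sqrt_divide)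
  qed
  moreover have "bdd_above (C ` {1..})"
    using convergent_imp_Bseq[OF convergentI[OF lim]] Bseq_bdd_above
    by (meson bdd_above_mono image_mono subset_UNIV)
  moreover have "linf_width n N M \<le> C n * sqrt (real n) * vol n N M powr (1 / real n)"
    if n: "1 \<le> n" and M: "closed_submanifold n N M" for n N M
  proof -
    define V where "V = vol n N M"
    have V: "V \<ge> 0" by (simp add: V_def vol_def)
    define X where "X = 2 * pi * sqrt (fact n) powr (1 / real n) * V powr (1 / real n)"
    have X: "X \<ge> 0" by (simp add: X_def)
    have X_eq: "C n * sqrt (real n) * V powr (1 / real n) = X"
    proof -
      have "sqrt (fact n powr (1 / real n)) = sqrt (fact n) powr (1 / real n)"
        by (simp add: powr_half_sqrt[symmetric] powr_powr mult.commute)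
      then show ?thesis using n by (simp add: C_def X_def real_sqrt_divide)
    qed
    have X_pow: "(2 * X) ^ n = 4 ^ n * pi ^ n * sqrt (fact n) * V"
    proof -
      have "2 * X = 4 * pi * sqrt (fact n) powr (1 / real n) * V powr (1 / real n)" by (simp add: X_def)
      then show ?thesis using V n by (simp add: power_mult_distrib powr_inverse_power)
    qed
    \<comment> \<open>At L = 2 X the required strict inequality degenerates to an equality, and for
      V = 0 the side would be 0. Hence a slightly larger side, followed by e \<rightarrow>
      0.\<close>
    have "linf_width n N M \<le> X + e" if e: "e > 0" for e
    proof -
      define L where "L = 2 * (X + e)"
      have L: "L > 0" "2 * X < L" using X e by (auto simp: L_def)
      have "(2 * X) ^ n < L ^ n" using L X n by (intro power_strict_mono) auto
      then have "4 ^ n * pi ^ n * sqrt (fact n) * V < L ^ n" by (simp only: X_pow)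
      then have "4 ^ n * pi ^ n * sqrt (fact n) * V / L ^ n < 1" using L by (simp add: pos_divide_less_eq)
      moreover have "2 ^ n * ((2 * pi / L) ^ n * sqrt (fact n)) * V = 4 ^ n * pi ^ n * sqrt (fact n) * V / L ^ n"
      proof -
        have "(2::real) ^ n * 2 ^ n = 4 ^ n" by (simp add: power_mult_distrib[symmetric])
        then show ?thesis by (simp add: power_divide power_mult_distrib)
      qed
      ultimately have "2 ^ n * ((2 * pi / L) ^ n * sqrt (fact n)) * vol n N M < 1" by (simp add: V_def)
      from linf_width_le_half_side[OF M n L(1) this] show ?thesis by (simp add: L_def)
    qed
    then have "linf_width n N M \<le> X" by (rule field_le_epsilon)
    then show ?thesis by (simp add: X_eq[unfolded V_def])
  qed
  ultimately show ?thesis by blast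
qed

end
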